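(* If $\mathbb{E}|\mu_0|^\varepsilon<\infty$ for some $\varepsilon>0$ and $\mathbb{E}\sigma_0^2\in(0,\infty)$, then for every $x\in\mathbb{R}$, $$\frac{Z_n(-\infty,b_nx+a_n]}{Z_n(\mathbb{R})}\to\Phi(x)\quad\text{a.s. on }\{Z_n(\mathbb{R})\to\infty\},$$ where $a_n=\sum_{i=0}^{n-1}\mu_i$ and $b_n=\left(\sum_{i=0}^{n-1}\sigma_i^2\right)^{1/2}$.
   Context: Branching random walk in a random environment in time. Let $\xi=(\xi_n)_{n\ge 0}$ be a stationary and ergodic sequence of random variables with values in a measurable space $\Theta$; each realization of $\xi_n$ determines a probability distribution $\eta_n=\eta(\xi_n)$ on $\mathbb{N}\times\mathbb{R}\times\mathbb{R}\times\cdots$. Given $\xi$ (quenched law $\mathbb{P}_\xi$, expectation $\mathbb{E}_\xi$), let $X(u)=(N(u),L_1(u),L_2(u),\dots)$, indexed by finite sequences $u\in\{\emptyset\}\cup\bigcup_{n\ge1}\mathbb{N}^n$, be independent random vectors, $X(u)$ having law $\eta_n$ when the length $|u|$ equals $n$ (values $L_i(u)$ with $i>N(u)$ play no role). The initial particle $\emptyset$ is at $S_\emptyset=0$; each particle $u$ of generation $n$, located at $S_u$, is replaced by $N(u)$ particles $ui$ of generation $n+1$ located at $S_{ui}=S_u+L_i(u)$, $1\le i\le N(u)$. Let $\mathbb{T}_n$ be the set of particles of generation $n$ and $Z_n=\sum_{u\in\mathbb{T}_n}\delta_{S_u}$ their counting measure. The annealed law $\mathbb{P}$ (expectation $\mathbb{E}$)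 is $\mathbb{P}_\xi$ integrated against the law of $\xi$; "a.s." refers to $\mathbb{P}$. Write $N=N(\emptyset)$ and $m_n=\mathbb{E}_\xi N(u)$ for $|u|=n$. Standing assumption: $\mathbb{E}\log m_0\in(0,\infty)$ and $\mathbb{E}\frac{N}{m_0}\log^+N<\infty$. Notation: for $|u|=n$, $\mu_n=\frac1{m_n}\mathbb{E}_\xi\sum_{i=1}^{N(u)}L_i(u)$ and $\sigma_n^2=\frac1{m_n}\mathbb{E}_\xi\sum_{i=1}^{N(u)}(L_i(u)-\mu_n)^2$. $\Phi$ is the distribution function of the standard normal law. *)

theory Defs
  imports "HOL-Probability.Probability"
begin

definition shift :: "(nat \<Rightarrow> 'e) \<Rightarrow> nat \<Rightarrow> 'e" where
  "shift \<xi> = (\<lambda>n. \<xi> (Suc n))"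

text \<open>\<open>\<tau>\<close> is the law, on the product of countably many copies of \<open>\<Theta>\<close>, of a stationary and
  ergodic sequence of \<open>\<Theta>\<close>-valued random variables.\<close>

definition stationary_ergodic_law :: "'e measure \<Rightarrow> (nat \<Rightarrow> 'e) measure \<Rightarrow> bool" where
  "stationary_ergodic_law \<Theta> \<tau> \<longleftrightarrow>
     prob_space \<tau> \<and> sets \<tau> = sets (\<Pi>\<^sub>M n\<in>(UNIV::nat set). \<Theta>) \<and>
     distr \<tau> \<tau> shift = \<tau> \<and>
     (\<forall>A\<in>sets \<tau>. shift -` A \<inter> space \<tau> = A \<longrightarrow> measure \<tau> A = 0 \<or> measure \<tau> A = 1)"

text \<open>A value \<open>(k, l)\<close> of \<open>X(u) = (N(u), L\<^sub>1(u), L\<^sub>2(u), \<dots>)\<close> has \<open>k = N(u)\<close> and \<open>l i = L\<^sub>i\<^sub>+\<^sub>1(u)\<close>: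
  children are numbered from 0, so the children of \<open>u\<close> are \<open>u @ [i]\<close> with \<open>i < N(u)\<close>.\<close>

type_synonym offspring = "nat \<times> (nat \<Rightarrow> real)"

definition offspring_algebra :: "offspring measure" where
  "offspring_algebra = count_space UNIV \<Otimes>\<^sub>M (\<Pi>\<^sub>M i\<in>UNIV. borel)"

definition quenched :: "('e \<Rightarrow> offspring measure) \<Rightarrow> (nat \<Rightarrow> 'e) \<Rightarrow> (nat list \<Rightarrow> offspring) measure" where
  "quenched \<eta> \<xi> = (\<Pi>\<^sub>M u\<in>UNIV. \<eta> (\<xi> (length u)))"

definition annealed ::
  "('e \<Rightarrow> offspring measure) \<Rightarrow> (nat \<Rightarrow> 'e) measure \<Rightarrow> ((nat \<Rightarrow> 'e) \<times> (nat list \<Rightarrow> offspring)) measure" where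
  "annealed \<eta> \<tau> = \<tau> \<bind> (\<lambda>\<xi>. distr (quenched \<eta> \<xi>)
      (\<tau> \<Otimes>\<^sub>M (\<Pi>\<^sub>M u\<in>(UNIV::nat list set). offspring_algebra)) (Pair \<xi>))"

text \<open>As \<open>X(u)\<close> has quenched law \<open>\<eta> (\<xi> n)\<close> for \<open>length u = n\<close> (see \<open>quenched_expectation\<close>
  below), \<open>m\<^sub>n\<close>, \<open>\<mu>\<^sub>n\<close> and \<open>\<sigma>\<^sub>n\<^sup>2\<close> are the values at \<open>\<eta> (\<xi> n)\<close> of \<open>mean_number\<close>,
  \<open>mean_position\<close> and \<open>variance_position\<close>. These are Bochner integrals, hence 0 where the
  integrand is not integrable; statements using them have to assume integrability.\<close>

definition offspring_sum :: "(real \<Rightarrow> real) \<Rightarrow> offspring \<Rightarrow> real" where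
  "offspring_sum f z = (\<Sum>i<fst z. f (snd z i))"

definition mean_number :: "offspring measure \<Rightarrow> real" where
  "mean_number \<nu> = (\<integral>z. real (fst z) \<partial>\<nu>)"

definition mean_position :: "offspring measure \<Rightarrow> real" where
  "mean_position \<nu> = 1 / mean_number \<nu> * (\<integral>z. offspring_sum (\<lambda>y. y) z \<partial>\<nu>)"

definition variance_position :: "offspring measure \<Rightarrow> real" where
  "variance_position \<nu> =
     1 / mean_number \<nu> * (\<integral>z. offspring_sum (\<lambda>y. (y - mean_position \<nu>)\<^sup>2) z \<partial>\<nu>)"

definition log_plus :: "real \<Rightarrow> real" where
  "log_plus y = (if y > 1 then ln y else 0)"

definition centering :: "('e \<Rightarrow> offspring measure) \<Rightarrow> (nat \<Rightarrow> 'e) \<Rightarrow> nat \<Rightarrow> real" where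
  "centering \<eta> \<xi> n = (\<Sum>i<n. mean_position (\<eta> (\<xi> i)))"

definition scaling :: "('e \<Rightarrow> offspring measure) \<Rightarrow> (nat \<Rightarrow> 'e) \<Rightarrow> nat \<Rightarrow> real" where
  "scaling \<eta> \<xi> n = sqrt (\<Sum>i<n. variance_position (\<eta> (\<xi> i)))"

fun particles :: "(nat list \<Rightarrow> offspring) \<Rightarrow> nat \<Rightarrow> nat list set" where
  "particles X 0 = {[]}"
| "particles X (Suc n) = {u @ [i] | u i. u \<in> particles X n \<and> i < fst (X u)}"

definition position :: "(nat list \<Rightarrow> offspring) \<Rightarrow> nat list \<Rightarrow> real" where
  "position X u = (\<Sum>k<length u. snd (X (take k u)) (u ! k))"

text \<open>The image of the counting measure on generation \<open>n\<close> under \<open>position X\<close> is the sum of the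
  Dirac masses at the positions of the particles of generation \<open>n\<close>.\<close>

definition counting_measure :: "(nat list \<Rightarrow> offspring) \<Rightarrow> nat \<Rightarrow> real measure" where
  "counting_measure X n = distr (count_space (particles X n)) borel (position X)"

lemma position_Nil [simp]: "position X [] = 0"
  by (simp add: position_def)

lemma position_snoc [simp]: "position X (u @ [i]) = position X u + snd (X u) i"
  by (simp add: position_def nth_append)

lemma finite_particles: "finite (particles X n)"
proof (induction n)
  case (Suc n)
  have "particles X (Suc n) = (\<Union>u\<in>particles X n. (\<lambda>i. u @ [i]) ` {..<fst (X u)})"
    by auto
  with Suc show ?case by simp
qed simp

lemma measure_counting_measure:
  assumes "A \<in> sets borel"
  shows "measure (counting_measure X n) A = card {u \<in> particles X n. position X u \<in> A}"
proof -
  have "measure (counting_measure X n) A =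
      measure (count_space (particles X n)) (position X -` A \<inter> particles X n)"
    unfolding counting_measure_def using assms by (subst measure_distr) auto
  also have "position X -` A \<inter> particles X n = {u \<in> particles X n. position X u \<in> A}" by auto
  finally show ?thesis
    by (simp add: measure_count_space finite_particles)
qed

lemma quenched_expectation:
  fixes g :: "offspring \<Rightarrow> real"
  assumes "\<And>n. prob_space (\<eta> (\<xi> n))" and "g \<in> borel_measurable (\<eta> (\<xi> (length u)))"
  shows "(\<integral>X. g (X u) \<partial>quenched \<eta> \<xi>) = (\<integral>z. g z \<partial>\<eta> (\<xi> (length u)))"
proof -
  let ?M = "\<lambda>u::nat list. \<eta> (\<xi> (length u))"
  have d: "distr (PiM UNIV ?M) (?M u) (\<lambda>X. X u) = ?M u"
    using assms by (intro distr_PiM_component) auto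
  have "(\<integral>z. g z \<partial>?M u) = (\<integral>z. g z \<partial>distr (PiM UNIV ?M) (?M u) (\<lambda>X. X u))"
    by (simp add: d)
  also have "\<dots> = (\<integral>X. g (X u) \<partial>PiM UNIV ?M)"
    using assms by (intro integral_distr measurable_component_singleton) auto
  finally show ?thesis by (simp add: quenched_def)
qed

lemma measurable_quenched:
  assumes \<tau>: "sets \<tau> = sets (\<Pi>\<^sub>M n\<in>(UNIV::nat set). \<Theta>)"
    and \<eta>: "\<eta> \<in> \<Theta> \<rightarrow>\<^sub>M prob_algebra offspring_algebra"
  shows "quenched \<eta> \<in> \<tau> \<rightarrow>\<^sub>M prob_algebra (\<Pi>\<^sub>M u\<in>(UNIV::nat list set). offspring_algebra)"
proof (rule measurable_prob_algebra_generated[OF sets_PiM Int_stable_prod_algebra])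
  have co: "(\<lambda>\<xi>. \<xi> n) \<in> \<tau> \<rightarrow>\<^sub>M \<Theta>" for n
    using measurable_cong_sets[OF \<tau> refl, of \<Theta>] by (simp add: measurable_component_singleton)
  have ker: "(\<lambda>\<xi>. \<eta> (\<xi> n)) \<in> \<tau> \<rightarrow>\<^sub>M prob_algebra offspring_algebra" for n
    using measurable_compose[OF co \<eta>] .
  then have pr: "prob_space (\<eta> (\<xi> n))" "sets (\<eta> (\<xi> n)) = sets offspring_algebra"
    if "\<xi> \<in> space \<tau>" for \<xi> n
    using measurable_space[OF ker that, of n] by (auto simp: space_prob_algebra)
  show "prod_algebra UNIV (\<lambda>u::nat list. offspring_algebra) \<subseteq> Pow (\<Pi>\<^sub>E u\<in>UNIV. space offspring_algebra)"
    by (rule prod_algebra_sets_into_space)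
  show "prob_space (quenched \<eta> \<xi>)" if "\<xi> \<in> space \<tau>" for \<xi>
    unfolding quenched_def using pr(1)[OF that] by (intro prob_space_PiM) auto
  show "sets (quenched \<eta> \<xi>) = sets (\<Pi>\<^sub>M u\<in>(UNIV::nat list set). offspring_algebra)"
    if "\<xi> \<in> space \<tau>" for \<xi>
    unfolding quenched_def using pr(2)[OF that] by (intro sets_PiM_cong) auto
  show "(\<lambda>\<xi>. emeasure (quenched \<eta> \<xi>) A) \<in> borel_measurable \<tau>"
    if A: "A \<in> prod_algebra UNIV (\<lambda>u::nat list. offspring_algebra)" for A
  proof -
    from prod_algebraE[OF A] obtain J E where J: "A = prod_emb UNIV (\<lambda>u::nat list. offspring_algebra) J (Pi\<^sub>E J E)"
        "finite J" "\<And>u. u \<in> J \<Longrightarrow> E u \<in> sets offspring_algebra" by metis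
    have "emeasure (quenched \<eta> \<xi>) A = (\<Prod>u\<in>J. emeasure (\<eta> (\<xi> (length u))) (E u))"
      if \<xi>: "\<xi> \<in> space \<tau>" for \<xi>
    proof -
      have "A = prod_emb UNIV (\<lambda>u::nat list. \<eta> (\<xi> (length u))) J (Pi\<^sub>E J E)"
        unfolding J(1) prod_emb_def using sets_eq_imp_space_eq[OF pr(2)[OF \<xi>]] by simp
      then show ?thesis
        unfolding quenched_def using J pr[OF \<xi>] by (simp add: emeasure_PiM_emb)
    qed
    moreover have "(\<lambda>\<xi>. \<Prod>u\<in>J. emeasure (\<eta> (\<xi> (length u))) (E u)) \<in> borel_measurable \<tau>"
      using J(3) by (intro borel_measurable_prod_ennreal
          measurable_emeasure_kernel[OF measurable_prob_algebraD[OF ker]])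
    ultimately show ?thesis by (simp cong: measurable_cong)
  qed
qed

lemma prob_space_annealed:
  assumes \<tau>: "stationary_ergodic_law \<Theta> \<tau>"
    and \<eta>: "\<eta> \<in> \<Theta> \<rightarrow>\<^sub>M prob_algebra offspring_algebra"
  shows "prob_space (annealed \<eta> \<tau>)"
    and "sets (annealed \<eta> \<tau>) = sets (\<tau> \<Otimes>\<^sub>M (\<Pi>\<^sub>M u\<in>(UNIV::nat list set). offspring_algebra))"
proof -
  let ?G = "\<Pi>\<^sub>M u\<in>(UNIV::nat list set). offspring_algebra"
  have \<tau>': "prob_space \<tau>" "sets \<tau> = sets (\<Pi>\<^sub>M n\<in>(UNIV::nat set). \<Theta>)"
    using \<tau> by (auto simp: stationary_ergodic_law_def)
  have q: "quenched \<eta> \<in> \<tau> \<rightarrow>\<^sub>M prob_algebra ?G"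
    using measurable_quenched[OF \<tau>'(2) \<eta>] .
  have k: "(\<lambda>\<xi>. distr (quenched \<eta> \<xi>) (\<tau> \<Otimes>\<^sub>M ?G) (Pair \<xi>)) \<in> \<tau> \<rightarrow>\<^sub>M prob_algebra (\<tau> \<Otimes>\<^sub>M ?G)"
    by (rule measurable_distr_prob_space2[OF q]) simp
  have t: "\<tau> \<in> space (prob_algebra \<tau>)"
    using \<tau>'(1) by (simp add: space_prob_algebra)
  have "annealed \<eta> \<tau> \<in> space (prob_algebra (\<tau> \<Otimes>\<^sub>M ?G))"
    unfolding annealed_def
    using measurable_space[OF measurable_bind_prob_space[OF measurable_const[OF t] k], of undefined "count_space UNIV"]
    by simp
  then show "prob_space (annealed \<eta> \<tau>)" "sets (annealed \<eta> \<tau>) = sets (\<tau> \<Otimes>\<^sub>M ?G)"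
    by (auto simp: space_prob_algebra)
qed

end

theory Submission
  imports Defs "HOL-Real_Asymp.Real_Asymp"
begin

text \<open>Fix the environment and write \<open>P\<^sub>n = m\<^sub>0 \<cdots> m\<^sub>n\<^sub>-\<^sub>1\<close>. Positions are centered generation by
  generation, so that along a uniformly weighted line of descent the displacements become independent
  centered variables with variances \<open>\<sigma>\<^sub>i\<^sup>2\<close>. Passing from generation \<open>j\<close> to \<open>j + 1\<close> changes
  \<open>P\<^sub>n\<^sup>-\<^sup>1 E(Z\<^sub>n(-\<infinity>, s] | F\<^sub>j)\<close> by a sum of conditionally independent centered terms; after
  truncation at \<open>N(u) \<le> exp (c j / 4)\<close>, where \<open>P\<^sub>j\<close> grows at least like \<open>exp (c j)\<close>, its second
  moment decays exponentially in \<open>j\<close>, uniformly in \<open>n\<close> and \<open>s\<close>, while the truncation errors do not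
  depend on \<open>n\<close> and are summable because \<open>E (N / m\<^sub>0) log\<^sup>+ N < \<infinity>\<close>. Summing over \<open>j \<ge> k\<^sub>n\<close>
  with \<open>k\<^sub>n\<close> logarithmic in \<open>n\<close> and using Borel--Cantelli, \<open>Z\<^sub>n(-\<infinity>, s] / P\<^sub>n\<close> is asymptotically its
  conditional expectation given generation \<open>k\<^sub>n\<close>, to which Lindeberg's theorem applies, since the
  particles of that generation are still within \<open>o(b\<^sub>n)\<close> of their mean position. The same estimate with
  \<open>s = \<infinity>\<close> gives \<open>Z\<^sub>n(\<real>) / P\<^sub>n \<rightarrow> W\<close> almost surely and in \<open>L\<^sup>1\<close>. Finally, \<open>P\<^sub>\<xi>(W = 0)\<close> stays
  below some \<open>r < 1\<close> along infinitely many shifts of the environment; at such a time \<open>k\<close> the event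
  \<open>W = 0\<close> has conditional probability at most \<open>r\<close> to the power \<open>Z\<^sub>k(\<real>)\<close>, so \<open>W > 0\<close> when
  \<open>Z\<^sub>n(\<real>) \<rightarrow> \<infinity>\<close>.\<close>

section \<open>Ergodic sums\<close>

text \<open>For fixed n and s, the conditional expectations given generation j form a martingale in
  j, but this martingale changes with n, so a convergence theorem for one martingale says nothing as
  n grows. Hence the estimates are uniform over test functions with values in [0, 1] and are summed
  over n as well. This fixes the scale of \<open>k n\<close>: the errors made from generation
  \<open>k n\<close> on must be summable in n, while the displacements up to that generation must be
  small against \<open>b n\<close>.

  Only a logarithmic moment of the size-biased N is available, so the population need not be bounded
  in L^2. The truncation level grows exponentially, but slower than the population: it enters the
  second moment linearly and is beaten by the growth, and the logarithmic moment pays exactly for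
  summing the cut-off parts over all generations.

  The environment enters through bounds on ergodic sums that are linear in n up to a random additive
  constant. They come from the sign of an integral by an argument on running minima. Collected in
  \<open>good_env\<close>, they turn the quenched part into an analysis of one deterministic
  environment.\<close>

locale ergodic_map = prob_space M for M :: "'a measure" +
  fixes T :: "'a \<Rightarrow> 'a"
  assumes T_measurable [measurable]: "T \<in> M \<rightarrow>\<^sub>M M"
    and distr_T: "distr M M T = M"
    and ergodic: "\<And>A. A \<in> sets M \<Longrightarrow> T -` A \<inter> space M = A \<Longrightarrow> measure M A = 0 \<or> measure M A = 1"
begin

lemma T_pow_measurable [measurable]: "T ^^ n \<in> M \<rightarrow>\<^sub>M M"
  by (induction n) auto

lemma distr_T_pow: "distr M M (T ^^ n) = M"
proof (induction n)
  case (Suc n)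
  have "distr M M (T ^^ Suc n) = distr (distr M M (T ^^ n)) M T"
    using distr_distr[of T M M "T ^^ n" M] by simp
  also have "\<dots> = M" by (simp only: Suc distr_T)
  finally show ?case .
qed (simp add: id_def)

lemma AE_T_pow:
  assumes "AE x in M. P x"
  shows "AE x in M. \<forall>n. P ((T ^^ n) x)"
proof -
  have "AE x in M. P ((T ^^ n) x)" for n
    using AE_distrD[of "T ^^ n" M M P] assms by (simp only: distr_T_pow T_pow_measurable)
  then show ?thesis by (simp add: AE_all_countable)
qed

lemma integral_T:
  fixes f :: "'a \<Rightarrow> real"
  assumes [measurable]: "integrable M f"
  shows "(\<integral>x. f (T x) \<partial>M) = (\<integral>x. f x \<partial>M)" "integrable M (\<lambda>x. f (T x))"
proof -
  have [measurable]: "f \<in> borel_measurable M" using assms by auto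
  show "(\<integral>x. f (T x) \<partial>M) = (\<integral>x. f x \<partial>M)"
    using integral_distr[of T M M f] by (simp add: distr_T)
  show "integrable M (\<lambda>x. f (T x))"
    using integrable_distr_eq[of T M M f] assms by (simp add: distr_T)
qed

lemma nn_integral_T_pow:
  assumes [measurable]: "f \<in> borel_measurable M"
  shows "(\<integral>\<^sup>+x. f ((T ^^ n) x) \<partial>M) = (\<integral>\<^sup>+x. f x \<partial>M)"
  using nn_integral_distr[of "T ^^ n" M M f] by (simp add: distr_T_pow)

text \<open>The running minimum \<open>m\<^sub>n\<close> of the ergodic sums satisfies
  \<open>m\<^sub>n\<^sub>+\<^sub>1 - m\<^sub>n \<circ> T = min (- m\<^sub>n \<circ> T) f\<close>. The left side has nonpositive integral; where \<open>m\<^sub>n\<close> is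
  unbounded the right side tends to \<open>f\<close>.\<close>

lemma ergodic_sums_bounded_below:
  fixes f :: "'a \<Rightarrow> real"
  assumes f: "integrable M f" and pos: "(\<integral>x. f x \<partial>M) > 0"
  shows "AE x in M. \<exists>C. \<forall>n. - C \<le> (\<Sum>i<n. f ((T ^^ i) x))"
proof -
  have fm [measurable]: "f \<in> borel_measurable M" using f by auto
  define m where "m = rec_nat (\<lambda>x. 0::real) (\<lambda>_ h x. min 0 (f x + h (T x)))"
  have m0 [simp]: "m 0 x = 0" and mS: "m (Suc n) x = min 0 (f x + m n (T x))" for n x
    by (simp_all add: m_def)
  have m_le0: "m n x \<le> 0" for n x by (cases n) (auto simp: mS)
  have m_dec: "m (Suc n) x \<le> m n x" for n x
  proof (induction n arbitrary: x)
    case (Suc n) from Suc[of "T x"] show ?case unfolding mS[of "Suc n"] mS[of n x] by linarith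
  qed (simp add: mS)
  have m_anti: "decseq (\<lambda>n. m n x)" for x by (rule decseq_SucI) (rule m_dec)
  have m_sum: "m n x \<le> (\<Sum>i<n. f ((T ^^ i) x))" for n x
  proof (induction n arbitrary: x)
    case (Suc n)
    have "(\<Sum>i<Suc n. f ((T ^^ i) x)) = f x + (\<Sum>i<n. f ((T ^^ i) (T x)))"
      by (subst sum.lessThan_Suc_shift) (simp add: funpow_swap1)
    with Suc[of "T x"] show ?case by (simp add: mS)
  qed simp
  have m_int: "integrable M (m n)" for n
  proof (induction n)
    case (Suc n)
    have "integrable M (\<lambda>x. min 0 (f x + m n (T x)))"
      using f integral_T(2)[OF Suc] by (intro integrable_min) auto
    then show ?case by (simp add: mS[abs_def])
  qed (simp add: m_def)
  have mm [measurable]: "m n \<in> borel_measurable M" for n using m_int[of n] by auto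
  define A where "A = {x\<in>space M. \<forall>K::nat. \<exists>n. m n x < - real K}"
  have A [measurable]: "A \<in> sets M" unfolding A_def by measurable
  have Tsp: "T x \<in> space M" if "x \<in> space M" for x using measurable_space[OF T_measurable that] .
  \<comment> \<open>Passing from x to \<open>T x\<close> changes a negative running minimum by the
    fixed amount \<open>f x\<close>, which does not affect unboundedness. The equivalence is proved
    at every point because \<open>ergodic\<close> asks for exact invariance.\<close>
  have T_iff: "T x \<in> A \<longleftrightarrow> x \<in> A" if x: "x \<in> space M" for x
  proof
    assume "T x \<in> A"
    show "x \<in> A" unfolding A_def
    proof (safe intro!: x)
      fix K :: nat
      obtain K' :: nat where K': "real K + \<bar>f x\<bar> \<le> real K'" using real_arch_simple by blast
      obtain n where "m n (T x) < - real K'" using \<open>T x \<in> A\<close> by (auto simp: A_def)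
      with K' have "m (Suc n) x < - real K" unfolding mS by linarith
      then show "\<exists>n. m n x < - real K" ..
    qed
  next
    assume "x \<in> A"
    show "T x \<in> A" unfolding A_def
    proof (safe intro!: Tsp x)
      fix K :: nat
      obtain K' :: nat where K': "real K + \<bar>f x\<bar> \<le> real K'" using real_arch_simple by blast
      obtain n where n: "m n x < - real K'" using \<open>x \<in> A\<close> by (auto simp: A_def)
      then obtain n' where "n = Suc n'" by (cases n) auto
      with n K' have "m n' (T x) < - real K" unfolding \<open>n = Suc n'\<close> mS by linarith
      then show "\<exists>n. m n (T x) < - real K" ..
    qed
  qed
  then have "T -` A \<inter> space M = A" using A sets.sets_into_space by blast
  from ergodic[OF A this] have "measure M A = 0"
  proof
    assume A1: "measure M A = 1"
    have AE: "AE x in M. x \<in> A" using A1 A by (simp add: prob_eq_1)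
    define d where "d n x = min (- m n (T x)) (f x)" for n x
    have d_eq: "d n x = m (Suc n) x - m n (T x)" for n x
      unfolding d_def mS by linarith
    have "(\<lambda>n. (\<integral>x. d n x \<partial>M)) \<longlonglongrightarrow> (\<integral>x. f x \<partial>M)"
    proof (rule integral_dominated_convergence[where w="\<lambda>x. \<bar>f x\<bar>"])
      show "AE x in M. (\<lambda>n. d n x) \<longlonglongrightarrow> f x"
      proof (use AE in eventually_elim)
        case (elim x)
        then have "T x \<in> A" using T_iff sets.sets_into_space[OF A] by blast
        moreover obtain K' :: nat where K': "\<bar>f x\<bar> \<le> real K'" using real_arch_simple by blast
        ultimately obtain N where N: "m N (T x) < - real K'" by (auto simp: A_def)
        have "eventually (\<lambda>n. d n x = f x) sequentially"
          unfolding eventually_sequentially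
        proof (intro exI allI impI)
          fix n assume "N \<le> n"
          then have "m n (T x) \<le> m N (T x)" using m_anti by (auto simp: decseq_def)
          then show "d n x = f x" using N K' unfolding d_def by linarith
        qed
        then show ?case by (rule tendsto_eventually)
      qed
      show "AE x in M. norm (d n x) \<le> \<bar>f x\<bar>" for n
      proof (intro AE_I2)
        fix x show "norm (d n x) \<le> \<bar>f x\<bar>" using m_le0[of n "T x"] unfolding d_def real_norm_def by linarith
      qed
    qed (use f in \<open>auto simp: d_def\<close>)
    moreover have "(\<integral>x. d n x \<partial>M) \<le> 0" for n
    proof -
      have "(\<integral>x. d n x \<partial>M) = (\<integral>x. m (Suc n) x \<partial>M) - (\<integral>x. m n x \<partial>M)"
        unfolding d_eq using m_int integral_T[OF m_int] by simp
      also have "\<dots> \<le> 0" using integral_mono[OF m_int m_int m_dec] by simp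
      finally show ?thesis .
    qed
    ultimately have "(\<integral>x. f x \<partial>M) \<le> 0" by (intro LIMSEQ_le_const2) auto
    with pos show ?thesis by simp
  qed
  then have "AE x in M. x \<notin> A" using A by (simp add: prob_eq_0)
  then show ?thesis using AE_space
  proof eventually_elim
    case elim: (elim x)
    then obtain K :: nat where K: "\<And>n. - real K \<le> m n x"
      unfolding A_def by (auto simp: not_less)
    show ?case by (rule exI[of _ "real K"]) (use K m_sum order.trans in blast)
  qed
qed

text \<open>Subtracting c leaves a function of positive mean, whose sums are bounded below. The
  strict gap between c and the mean is what turns boundedness into linear growth.\<close>

corollary ergodic_sums_lower:
  fixes f :: "'a \<Rightarrow> real"
  assumes "integrable M f" and "c < (\<integral>x. f x \<partial>M)"
  shows "AE x in M. \<exists>C. \<forall>n. c * real n - C \<le> (\<Sum>i<n. f ((T ^^ i) x))"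
  using ergodic_sums_bounded_below[of "\<lambda>x. f x - c"] assms
  by (simp add: prob_space sum_subtractf algebra_simps)

corollary ergodic_sums_upper:
  fixes f :: "'a \<Rightarrow> real"
  assumes "integrable M f" and "(\<integral>x. f x \<partial>M) < c"
  shows "AE x in M. \<exists>C. \<forall>n. (\<Sum>i<n. f ((T ^^ i) x)) \<le> c * real n + C"
  using ergodic_sums_bounded_below[of "\<lambda>x. c - f x"] assms
  by (simp add: prob_space sum_subtractf algebra_simps)

text \<open>If the orbit avoided A from time k on, the sums of the indicator would never exceed k,
  against their linear lower bound.\<close>

corollary AE_infinitely_often:
  assumes A: "A \<in> sets M" "measure M A > 0"
  shows "AE x in M. \<forall>k. \<exists>n\<ge>k. (T ^^ n) x \<in> A"
proof -
  have "AE x in M. \<exists>C. \<forall>n. measure M A / 2 * real n - C \<le> (\<Sum>i<n. indicat_real A ((T ^^ i) x))"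
    using A by (intro ergodic_sums_lower) (auto simp: finite_measure.emeasure_eq_measure less_top[symmetric])
  then show ?thesis
  proof eventually_elim
    case (elim x)
    then obtain C where C: "\<And>n. measure M A / 2 * real n - C \<le> (\<Sum>i<n. indicat_real A ((T ^^ i) x))" by auto
    show ?case
    proof (rule ccontr)
      assume "\<not> ?case"
      then obtain k where k: "\<And>n. n \<ge> k \<Longrightarrow> (T ^^ n) x \<notin> A" by auto
      obtain n :: nat where n: "(C + real k) / (measure M A / 2) < real n" using reals_Archimedean2 by blast
      have "(\<Sum>i<n. indicat_real A ((T ^^ i) x)) \<le> (\<Sum>i<n. indicat_real {..<k} i)"
        using k by (intro sum_mono) (auto simp: indicator_def not_less[symmetric])
      also have "\<dots> = real (card ({..<n} \<inter> {..<k}))" by (simp add: indicator_def of_bool_def sum.If_cases lessThan_def)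
      also have "\<dots> \<le> real k" by (metis card_lessThan card_mono finite_lessThan inf_le2 of_nat_mono)
      finally show False using C[of n] n A(2) by (simp add: field_simps)
    qed
  qed
qed

end

section \<open>Product measures and step laws\<close>

text \<open>Redrawing the coordinates in \<open>J\<close> preserves a product measure (\<open>distr_resample\<close> below); this
  replaces conditioning on the coordinates outside \<open>J\<close>.\<close>

definition resample :: "'i set \<Rightarrow> ('i \<Rightarrow> 'a) \<Rightarrow> ('i \<Rightarrow> 'a) \<Rightarrow> 'i \<Rightarrow> 'a" where
  "resample J X Y = (\<lambda>i. if i \<in> J then Y i else X i)"

lemma measurable_resample [measurable (raw)]:
  assumes "f \<in> N \<rightarrow>\<^sub>M PiM UNIV M" "g \<in> N \<rightarrow>\<^sub>M PiM UNIV M"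
  shows "(\<lambda>x. resample J (f x) (g x)) \<in> N \<rightarrow>\<^sub>M PiM UNIV M"
proof (rule measurable_PiM_single')
  show "(\<lambda>\<omega>. resample J (f \<omega>) (g \<omega>) i) \<in> N \<rightarrow>\<^sub>M M i" for i
    unfolding resample_def using assms by (cases "i \<in> J") (auto intro: measurable_component_singleton[THEN measurable_compose[rotated]])
  show "(\<lambda>\<omega>. resample J (f \<omega>) (g \<omega>)) \<in> space N \<rightarrow> (\<Pi>\<^sub>E i\<in>UNIV. space (M i))"
    using assms[THEN measurable_space] by (fastforce simp: resample_def space_PiM PiE_iff)
qed

locale product_prob_UNIV =
  fixes M :: "'i \<Rightarrow> 'a measure"
  assumes prob: "\<And>i. prob_space (M i)"
begin

sublocale P: prob_space "PiM UNIV M"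
  using prob by (rule prob_space_PiM)

text \<open>The preimage of a cylinder is a rectangle: the constraints outside J fall on X, those in
  J on Y, and the two products recombine.\<close>

lemma distr_resample:
  "distr (PiM UNIV M \<Otimes>\<^sub>M PiM UNIV M) (PiM UNIV M) (\<lambda>(X, Y). resample J X Y) = PiM UNIV M"
proof (rule measure_eqI_PiM_infinite[symmetric, OF refl])
  show "finite_measure (PiM UNIV M)" by unfold_locales
  fix A and K :: "'i set" assume K: "finite K" "\<And>i. i \<in> K \<Longrightarrow> A i \<in> sets (M i)"
  let ?E = "\<lambda>K. prod_emb UNIV M K (Pi\<^sub>E K A)"
  have E: "emeasure (PiM UNIV M) (?E L) = (\<Prod>i\<in>L. emeasure (M i) (A i))" if "L \<subseteq> K" for L
    using that K finite_subset[OF that] by (intro emeasure_PiM_emb prob) auto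
  have [measurable]: "?E L \<in> sets (PiM UNIV M)" if "L \<subseteq> K" for L
    using that K finite_subset[OF that] by (intro sets_PiM_I) auto
  have "emeasure (distr (PiM UNIV M \<Otimes>\<^sub>M PiM UNIV M) (PiM UNIV M) (\<lambda>(X, Y). resample J X Y)) (?E K)
      = emeasure (PiM UNIV M \<Otimes>\<^sub>M PiM UNIV M)
          ((\<lambda>(X, Y). resample J X Y) -` ?E K \<inter> space (PiM UNIV M \<Otimes>\<^sub>M PiM UNIV M))"
    by (intro emeasure_distr) auto
  also have "(\<lambda>(X, Y). resample J X Y) -` ?E K \<inter> space (PiM UNIV M \<Otimes>\<^sub>M PiM UNIV M)
      = ?E (K - J) \<times> ?E (K \<inter> J)"
  proof -
    have emb: "?E L = {X \<in> space (PiM UNIV M). \<forall>i\<in>L. X i \<in> A i}" for L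
      by (auto simp: prod_emb_def space_PiM PiE_iff)
    show ?thesis
      unfolding emb by (auto simp: space_pair_measure space_PiM PiE_iff resample_def split: if_splits)
  qed
  also have "emeasure (PiM UNIV M \<Otimes>\<^sub>M PiM UNIV M) \<dots> = (\<Prod>i\<in>K - J. emeasure (M i) (A i)) * (\<Prod>i\<in>K \<inter> J. emeasure (M i) (A i))"
    by (subst P.emeasure_pair_measure_Times) (auto simp: E)
  also have "\<dots> = (\<Prod>i\<in>K. emeasure (M i) (A i))"
    using prod.Int_Diff[OF K(1), of "\<lambda>i. emeasure (M i) (A i)" J] by (simp add: mult.commute)
  finally show "emeasure (PiM UNIV M) (?E K)
      = emeasure (distr (PiM UNIV M \<Otimes>\<^sub>M PiM UNIV M) (PiM UNIV M) (\<lambda>(X, Y). resample J X Y)) (?E K)"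
    by (simp add: E)
qed simp

lemma nn_integral_resample:
  assumes [measurable]: "f \<in> borel_measurable (PiM UNIV M)"
  shows "(\<integral>\<^sup>+X. f X \<partial>PiM UNIV M) = (\<integral>\<^sup>+X. \<integral>\<^sup>+Y. f (resample J X Y) \<partial>PiM UNIV M \<partial>PiM UNIV M)"
proof -
  have "(\<integral>\<^sup>+X. f X \<partial>PiM UNIV M) = (\<integral>\<^sup>+X. f X \<partial>distr (PiM UNIV M \<Otimes>\<^sub>M PiM UNIV M) (PiM UNIV M) (\<lambda>(X, Y). resample J X Y))"
    by (simp only: distr_resample)
  also have "\<dots> = (\<integral>\<^sup>+Z. f (case Z of (X, Y) \<Rightarrow> resample J X Y) \<partial>(PiM UNIV M \<Otimes>\<^sub>M PiM UNIV M))"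
    by (intro nn_integral_distr) auto
  also have "\<dots> = (\<integral>\<^sup>+X. \<integral>\<^sup>+Y. f (resample J X Y) \<partial>PiM UNIV M \<partial>PiM UNIV M)"
    by (subst P.nn_integral_fst[symmetric]) auto
  finally show ?thesis .
qed

lemma nn_integral_coordinate:
  assumes [measurable]: "f \<in> borel_measurable (M i)"
  shows "(\<integral>\<^sup>+X. f (X i) \<partial>PiM UNIV M) = (\<integral>\<^sup>+z. f z \<partial>M i)"
  using nn_integral_distr[of "\<lambda>X. X i" "PiM UNIV M" "M i" f] distr_PiM_component[of UNIV M i] prob
  by simp

lemma integral_coordinate:
  fixes f :: "'a \<Rightarrow> real"
  assumes [measurable]: "f \<in> borel_measurable (M i)"
  shows "(\<integral>X. f (X i) \<partial>PiM UNIV M) = (\<integral>z. f z \<partial>M i)"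
  using integral_distr[of "\<lambda>X. X i" "PiM UNIV M" "M i" f] distr_PiM_component[of UNIV M i] prob
  by simp

lemma indep_coordinates: "P.indep_vars M (\<lambda>i X. X i) UNIV"
proof -
  have "distr (PiM UNIV M) (PiM UNIV M) (\<lambda>X. \<lambda>i\<in>UNIV. X i) = PiM UNIV M"
    by (simp add: restrict_def)
  moreover have "PiM UNIV (\<lambda>i. distr (PiM UNIV M) (M i) (\<lambda>X. X i)) = PiM UNIV M"
    by (intro PiM_cong) (auto intro!: distr_PiM_component prob)
  ultimately show ?thesis
    by (subst P.indep_vars_iff_distr_eq_PiM) auto
qed

text \<open>Independent centered terms are orthogonal. Boundedness makes the products integrable;
  the lemma is applied to truncated terms, which are bounded.\<close>

lemma integral_sum_square:
  fixes f :: "'i \<Rightarrow> 'a \<Rightarrow> real"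
  assumes T: "finite T" and f [measurable]: "\<And>i. i \<in> T \<Longrightarrow> f i \<in> borel_measurable (M i)"
    and bound: "\<And>i z. i \<in> T \<Longrightarrow> \<bar>f i z\<bar> \<le> B" and mean: "\<And>i. i \<in> T \<Longrightarrow> (\<integral>z. f i z \<partial>M i) = 0"
  shows "(\<integral>X. (\<Sum>i\<in>T. f i (X i))\<^sup>2 \<partial>PiM UNIV M) = (\<Sum>i\<in>T. \<integral>z. (f i z)\<^sup>2 \<partial>M i)"
    and "integrable (PiM UNIV M) (\<lambda>X. (\<Sum>i\<in>T. f i (X i))\<^sup>2)"
proof -
  have fm [measurable]: "(\<lambda>X. f i (X i)) \<in> borel_measurable (PiM UNIV M)" if "i \<in> T" for i
    using that by measurable
  have int1: "integrable (PiM UNIV M) (\<lambda>X. f i (X i))" if "i \<in> T" for i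
    using bound that by (intro P.integrable_const_bound[where B=B]) auto
  have cross: "(\<integral>X. f i (X i) * f j (X j) \<partial>PiM UNIV M) = (if i = j then \<integral>z. (f i z)\<^sup>2 \<partial>M i else 0)"
    if ij: "i \<in> T" "j \<in> T" for i j
  proof (cases "i = j")
    case True
    then show ?thesis using integral_coordinate[of "\<lambda>z. (f i z)\<^sup>2" i] ij by (simp add: power2_eq_square)
  next
    case False
    have "P.indep_vars (\<lambda>_. borel) (\<lambda>i X. f i (X i)) {i, j}"
      using ij by (intro P.indep_vars_compose2[OF P.indep_vars_subset[OF indep_coordinates]]) auto
    from P.indep_vars_lebesgue_integral[OF _ this] False show ?thesis
      using int1 ij by (auto simp: integral_coordinate mean)
  qed
  have int2: "integrable (PiM UNIV M) (\<lambda>X. f i (X i) * f j (X j))" if "i \<in> T" "j \<in> T" for i j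
  proof (intro P.integrable_const_bound[where B="B * B"] AE_I2)
    fix X :: "'i \<Rightarrow> 'a"
    show "norm (f i (X i) * f j (X j)) \<le> B * B"
      unfolding real_norm_def abs_mult using bound that
      by (intro mult_mono) (auto intro: order.trans[OF abs_ge_zero])
  qed (use that in measurable)
  have sq: "(\<Sum>i\<in>T. f i (X i))\<^sup>2 = (\<Sum>i\<in>T. \<Sum>j\<in>T. f i (X i) * f j (X j))" for X
    by (simp add: power2_eq_square sum_product)
  show "integrable (PiM UNIV M) (\<lambda>X. (\<Sum>i\<in>T. f i (X i))\<^sup>2)"
    unfolding sq using int2 by auto
  have "(\<integral>X. (\<Sum>i\<in>T. f i (X i))\<^sup>2 \<partial>PiM UNIV M) = (\<Sum>i\<in>T. \<Sum>j\<in>T. \<integral>X. f i (X i) * f j (X j) \<partial>PiM UNIV M)"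
    unfolding sq using int2 by (simp add: Bochner_Integration.integral_sum)
  also have "\<dots> = (\<Sum>i\<in>T. \<Sum>j\<in>T. if i = j then \<integral>z. (f i z)\<^sup>2 \<partial>M i else 0)"
    by (intro sum.cong refl cross)
  also have "\<dots> = (\<Sum>i\<in>T. \<integral>z. (f i z)\<^sup>2 \<partial>M i)" using T by (simp add: sum.delta)
  finally show "(\<integral>X. (\<Sum>i\<in>T. f i (X i))\<^sup>2 \<partial>PiM UNIV M) = (\<Sum>i\<in>T. \<integral>z. (f i z)\<^sup>2 \<partial>M i)" .
qed

end

section \<open>Offspring sums and the law of a centered step\<close>

lemma measurable_offspring [measurable]:
  "fst \<in> offspring_algebra \<rightarrow>\<^sub>M count_space UNIV"
  "(\<lambda>z. snd z i) \<in> borel_measurable offspring_algebra"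
proof -
  show "fst \<in> offspring_algebra \<rightarrow>\<^sub>M count_space UNIV" unfolding offspring_algebra_def by measurable
  have "snd \<in> offspring_algebra \<rightarrow>\<^sub>M (\<Pi>\<^sub>M i\<in>UNIV. borel)" unfolding offspring_algebra_def by measurable
  then show "(\<lambda>z. snd z i) \<in> borel_measurable offspring_algebra"
    by (rule measurable_compose) (rule measurable_component_singleton, simp)
qed

lemma measurable_real_fst [measurable]: "(\<lambda>z. real (fst z)) \<in> borel_measurable offspring_algebra"
  by (rule measurable_compose[OF measurable_offspring(1)]) simp

lemma measurable_random_sum:
  fixes h :: "nat \<Rightarrow> 'b \<Rightarrow> 'c :: {second_countable_topology, topological_comm_monoid_add}"
  assumes "N \<in> B \<rightarrow>\<^sub>M count_space UNIV" and [measurable]: "\<And>i. h i \<in> borel_measurable B"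
  shows "(\<lambda>x. \<Sum>i<N x. h i x) \<in> borel_measurable B"
  by (rule measurable_compose_countable[where f="\<lambda>n x. \<Sum>i<n. h i x", OF _ assms(1)]) auto

lemma measurable_offspring_sum [measurable]:
  "h \<in> borel_measurable borel \<Longrightarrow> offspring_sum h \<in> borel_measurable offspring_algebra"
  unfolding offspring_sum_def[abs_def]
  by (intro measurable_random_sum measurable_offspring measurable_compose[OF measurable_offspring(2)])

text \<open>The centered displacement of a uniformly chosen child under the size-biased offspring
  law: the bias N / m and the choice 1 / N combine to the weight 1 / m on each child. The index of
  the child is an extra coordinate carrying counting measure.\<close>

definition step_law :: "offspring measure \<Rightarrow> real measure" where
  "step_law \<nu> = distr (density (\<nu> \<Otimes>\<^sub>M count_space UNIV)
      (\<lambda>(z, i). if i < fst z then ennreal (1 / mean_number \<nu>) else 0)) borel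
      (\<lambda>(z, i). snd z i - mean_position \<nu>)"

lemma sets_step_law [simp, measurable_cong]: "sets (step_law \<nu>) = sets borel"
  by (simp add: step_law_def)

lemma nn_integral_step_law:
  assumes s [measurable_cong]: "sets \<nu> = sets offspring_algebra" and h [measurable]: "h \<in> borel_measurable borel"
  shows "(\<integral>\<^sup>+y. h y \<partial>step_law \<nu>)
    = (\<integral>\<^sup>+z. ennreal (1 / mean_number \<nu>) * (\<Sum>i<fst z. h (snd z i - mean_position \<nu>)) \<partial>\<nu>)"
proof -
  interpret C: sigma_finite_measure "count_space (UNIV::nat set)"
    by (rule sigma_finite_measure_count_space)
  have meas: "(\<lambda>z. snd z i) \<in> borel_measurable \<nu>" for i by measurable
  have 1 [measurable]: "(\<lambda>(z, i). snd z i - mean_position \<nu>) \<in> borel_measurable (\<nu> \<Otimes>\<^sub>M count_space UNIV)"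
    unfolding split_beta'
    by (rule measurable_compose_countable[where f="\<lambda>i p. snd (fst p) i - mean_position \<nu>" and g=snd])
      (auto intro!: borel_measurable_diff measurable_compose[OF measurable_fst meas])
  have 2 [measurable]: "(\<lambda>(z, i). if i < fst z then ennreal (1 / mean_number \<nu>) else 0)
      \<in> borel_measurable (\<nu> \<Otimes>\<^sub>M count_space UNIV)"
  proof -
    have "fst \<in> \<nu> \<rightarrow>\<^sub>M count_space UNIV" by measurable
    note meas = measurable_compose[OF measurable_fst this]
    show ?thesis unfolding split_beta'
      by (rule measurable_compose_countable[where f="\<lambda>k p. if snd p < k then ennreal (1 / mean_number \<nu>) else 0", OF _ meas])
        measurable
  qed
  have "(\<integral>\<^sup>+y. h y \<partial>step_law \<nu>) = (\<integral>\<^sup>+p. (case p of (z, i) \<Rightarrow> if i < fst z then ennreal (1 / mean_number \<nu>) else 0)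
      * h (case p of (z, i) \<Rightarrow> snd z i - mean_position \<nu>) \<partial>(\<nu> \<Otimes>\<^sub>M count_space UNIV))"
    unfolding step_law_def by (simp add: nn_integral_distr nn_integral_density)
  also have "\<dots> = (\<integral>\<^sup>+z. \<integral>\<^sup>+i. (if i < fst z then ennreal (1 / mean_number \<nu>) else 0)
      * h (snd z i - mean_position \<nu>) \<partial>count_space UNIV \<partial>\<nu>)"
    by (subst C.nn_integral_fst[symmetric]) (auto simp: split_beta')
  also have "\<dots> = (\<integral>\<^sup>+z. ennreal (1 / mean_number \<nu>) * (\<Sum>i<fst z. h (snd z i - mean_position \<nu>)) \<partial>\<nu>)"
  proof (rule nn_integral_cong)
    fix z :: offspring
    have "(\<integral>\<^sup>+i. (if i < fst z then ennreal (1 / mean_number \<nu>) else 0) * h (snd z i - mean_position \<nu>) \<partial>count_space UNIV)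
      = (\<Sum>i<fst z. (if i < fst z then ennreal (1 / mean_number \<nu>) else 0) * h (snd z i - mean_position \<nu>))"
      by (rule nn_integral_count_space') auto
    then show "(\<integral>\<^sup>+i. (if i < fst z then ennreal (1 / mean_number \<nu>) else 0) * h (snd z i - mean_position \<nu>) \<partial>count_space UNIV)
      = ennreal (1 / mean_number \<nu>) * (\<Sum>i<fst z. h (snd z i - mean_position \<nu>))"
      by (simp add: sum_distrib_left)
  qed
  finally show ?thesis .
qed

lemma nn_integral_real_fst:
  assumes s: "sets \<nu> = sets offspring_algebra" and "integrable \<nu> (\<lambda>z. real (fst z))"
  shows "(\<integral>\<^sup>+z. ennreal (real (fst z)) \<partial>\<nu>) = ennreal (mean_number \<nu>)"
  unfolding mean_number_def using assms(2) by (intro nn_integral_eq_integral) auto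

lemma prob_space_step_law:
  assumes s [measurable_cong]: "sets \<nu> = sets offspring_algebra"
    and i: "integrable \<nu> (\<lambda>z. real (fst z))" and m: "mean_number \<nu> > 0"
  shows "prob_space (step_law \<nu>)"
proof
  have "emeasure (step_law \<nu>) (space (step_law \<nu>)) = (\<integral>\<^sup>+y. 1 \<partial>step_law \<nu>)" by simp
  also have "\<dots> = (\<integral>\<^sup>+z. ennreal (1 / mean_number \<nu>) * ennreal (real (fst z)) \<partial>\<nu>)"
    by (subst nn_integral_step_law[OF s]) (auto simp: ennreal_of_nat_eq_real_of_nat)
  also have "\<dots> = ennreal (1 / mean_number \<nu>) * ennreal (mean_number \<nu>)"
    by (subst nn_integral_cmult) (auto simp: nn_integral_real_fst[OF s i])
  also have "\<dots> = 1" using m by (simp flip: ennreal_mult')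
  finally show "emeasure (step_law \<nu>) (space (step_law \<nu>)) = 1" .
qed

section \<open>Lindeberg's theorem\<close>

lemma exp_minus_approx:
  fixes s :: real assumes "0 \<le> s" shows "\<bar>exp (- s) - (1 - s)\<bar> \<le> s\<^sup>2"
proof -
  have "1 - s \<le> exp (- s)" using exp_ge_add_one_self[of "- s"] by simp
  moreover have "exp (- s) \<le> 1 / (1 + s)"
    using exp_ge_add_one_self[of s] assms by (simp add: exp_minus field_simps)
  moreover have "1 / (1 + s) \<le> 1 - s + s\<^sup>2"
  proof -
    have "(1 - s + s\<^sup>2) * (1 + s) = 1 + s ^ 3" by (simp add: algebra_simps power2_eq_square power3_eq_cube)
    moreover have "0 \<le> s ^ 3" using assms by simp
    ultimately have "1 \<le> (1 - s + s\<^sup>2) * (1 + s)" by linarith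
    then show ?thesis using assms by (simp add: pos_divide_le_eq)
  qed
  ultimately show ?thesis by linarith
qed

text \<open>The first two terms bound the Taylor remainder, with the integral split at |x| =
  \<delta> b. The third is the cost s^2 of replacing 1 - s by exp (- s), where s = t^2 v / (2 b^2)
  and one factor v / b^2 is estimated by \<delta>^2 + e. Every term carries a factor e or v / b^2,
  so the bounds can be added up over a row of the array.\<close>

lemma (in real_distribution) char_lindeberg_approx:
  assumes "integrable M (\<lambda>x. x)" and "(\<integral>x. x \<partial>M) = 0"
    and sq: "integrable M (\<lambda>x. x\<^sup>2)" and v: "(\<integral>x. x\<^sup>2 \<partial>M) = v"
    and b: "b > 0" and \<delta>: "\<delta> > 0"
  defines "e \<equiv> (\<integral>x. x\<^sup>2 * indicator {x. \<bar>x\<bar> > \<delta> * b} x \<partial>M) / b\<^sup>2"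
  shows "cmod (char M (t / b) - exp (- (t\<^sup>2 * (v / b\<^sup>2) / 2)))
    \<le> t\<^sup>2 * e + \<bar>t\<bar> ^ 3 * \<delta> / 6 * (v / b\<^sup>2) + t ^ 4 / 4 * ((\<delta>\<^sup>2 + e) * (v / b\<^sup>2))"
    and "0 \<le> e"
proof -
  let ?I = "\<lambda>x. x\<^sup>2 * indicator {x. \<bar>x\<bar> > \<delta> * b} x :: real"
  have intI: "integrable M ?I"
    by (rule Bochner_Integration.integrable_bound[OF sq]) (auto simp: indicator_def)
  have e0: "0 \<le> integral\<^sup>L M ?I" by (intro integral_nonneg_AE AE_I2) auto
  then show "0 \<le> e" unfolding e_def using b by simp
  have v0: "0 \<le> v" unfolding v[symmetric] by simp
  have "v = (\<integral>x. x\<^sup>2 \<partial>M)" using v by simp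
  also have "\<dots> \<le> (\<integral>x. ?I x + (\<delta> * b)\<^sup>2 \<partial>M)"
  proof (rule integral_mono[OF sq])
    fix x
    show "x\<^sup>2 \<le> ?I x + (\<delta> * b)\<^sup>2"
      using b \<delta> abs_le_square_iff[of x "\<delta> * b"] by (cases "\<bar>x\<bar> > \<delta> * b") (auto simp: abs_mult)
  qed (use intI in auto)
  also have "\<dots> = integral\<^sup>L M ?I + (\<delta> * b)\<^sup>2" using intI prob_space by (simp add: space_eq_univ)
  finally have "v / b\<^sup>2 \<le> e + \<delta>\<^sup>2" unfolding e_def using b by (simp add: field_simps power_mult_distrib)
  then have vb: "v / b\<^sup>2 * (v / b\<^sup>2) \<le> (\<delta>\<^sup>2 + e) * (v / b\<^sup>2)"
    using v0 by (intro mult_right_mono) auto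
  have "cmod (char M (t / b) - (1 - (t / b)\<^sup>2 * v / 2))
      \<le> (t / b)\<^sup>2 / 6 * (\<integral>x. min (6 * x\<^sup>2) (\<bar>t / b\<bar> * \<bar>x\<bar> ^ 3) \<partial>M)"
    using assms by (intro char_approx3) (auto simp: v)
  also have "\<dots> \<le> (t / b)\<^sup>2 / 6 * (\<integral>x. 6 * ?I x + \<bar>t\<bar> * \<delta> * x\<^sup>2 \<partial>M)"
  proof (intro mult_left_mono integral_mono)
    show "integrable M (\<lambda>x. min (6 * x\<^sup>2) (\<bar>t / b\<bar> * \<bar>x\<bar> ^ 3))"
      by (rule Bochner_Integration.integrable_bound[OF integrable_mult_right[OF sq, of 6]]) (auto simp: min_def)
    show "integrable M (\<lambda>x. 6 * ?I x + \<bar>t\<bar> * \<delta> * x\<^sup>2)" using intI sq by auto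
    fix x
    show "min (6 * x\<^sup>2) (\<bar>t / b\<bar> * \<bar>x\<bar> ^ 3) \<le> 6 * ?I x + \<bar>t\<bar> * \<delta> * x\<^sup>2"
    proof (cases "\<bar>x\<bar> > \<delta> * b")
      case True then show ?thesis using \<delta> by (simp add: min.coboundedI1)
    next
      case False
      then have "\<bar>x\<bar> / b \<le> \<delta>" using b by (simp add: pos_divide_le_eq)
      then have "\<bar>t\<bar> * x\<^sup>2 * (\<bar>x\<bar> / b) \<le> \<bar>t\<bar> * x\<^sup>2 * \<delta>" by (rule mult_left_mono) simp
      moreover have "\<bar>x\<bar> ^ 3 = x\<^sup>2 * \<bar>x\<bar>" by (simp add: power3_eq_cube power2_eq_square)
      then have "\<bar>t / b\<bar> * \<bar>x\<bar> ^ 3 = \<bar>t\<bar> * x\<^sup>2 * (\<bar>x\<bar> / b)"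
        using b by (simp add: abs_divide)
      ultimately show ?thesis using False by (simp add: min.coboundedI2 mult_ac)
    qed
  qed auto
  also have "(\<integral>x. 6 * ?I x + \<bar>t\<bar> * \<delta> * x\<^sup>2 \<partial>M) = 6 * integral\<^sup>L M ?I + \<bar>t\<bar> * \<delta> * v"
    using intI sq by (simp add: v)
  also have "(t / b)\<^sup>2 / 6 * \<dots> = t\<^sup>2 * e + \<bar>t\<bar> ^ 3 * \<delta> / 6 * (v / b\<^sup>2)"
  proof -
    have "\<bar>t\<bar> ^ 3 = t\<^sup>2 * \<bar>t\<bar>" by (simp add: power3_eq_cube power2_eq_square)
    then show ?thesis unfolding e_def using b by (simp add: field_simps)
  qed
  finally have 1: "cmod (char M (t / b) - (1 - (t / b)\<^sup>2 * v / 2)) \<le> t\<^sup>2 * e + \<bar>t\<bar> ^ 3 * \<delta> / 6 * (v / b\<^sup>2)" .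
  define s where "s = t\<^sup>2 * (v / b\<^sup>2) / 2"
  have s: "0 \<le> s" "(t / b)\<^sup>2 * v / 2 = s" unfolding s_def using v0 by (auto simp: power_divide)
  have "s\<^sup>2 = t ^ 4 / 4 * (v / b\<^sup>2 * (v / b\<^sup>2))"
    unfolding s_def by (simp add: power2_eq_square power4_eq_xxxx mult_ac)
  also have "\<dots> \<le> t ^ 4 / 4 * ((\<delta>\<^sup>2 + e) * (v / b\<^sup>2))" using vb by (intro mult_left_mono) auto
  finally have "\<bar>exp (- s) - (1 - s)\<bar> \<le> t ^ 4 / 4 * ((\<delta>\<^sup>2 + e) * (v / b\<^sup>2))"
    using exp_minus_approx[OF s(1)] by linarith
  moreover have "cmod (complex_of_real (1 - s) - exp (- s)) = \<bar>exp (- s) - (1 - s)\<bar>"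
    by (metis abs_minus_commute norm_of_real of_real_diff)
  moreover have "cmod (char M (t / b) - exp (- s)) \<le> cmod (char M (t / b) - complex_of_real (1 - s))
      + cmod (complex_of_real (1 - s) - exp (- s))"
    using dist_triangle[of "char M (t / b)" "exp (- s)" "complex_of_real (1 - s)"] by (simp add: dist_norm)
  ultimately show "cmod (char M (t / b) - exp (- (t\<^sup>2 * (v / b\<^sup>2) / 2)))
    \<le> t\<^sup>2 * e + \<bar>t\<bar> ^ 3 * \<delta> / 6 * (v / b\<^sup>2) + t ^ 4 / 4 * ((\<delta>\<^sup>2 + e) * (v / b\<^sup>2))"
    using 1 unfolding s by (simp add: s_def)
qed

text \<open>The products of the characteristic functions and of their Gaussian counterparts are
  compared factor by factor, all factors having modulus at most 1. The sum starts at
  \<open>k n\<close> but is normalized by the full \<open>b n\<close>; \<open>k_neg\<close> says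
  that the omitted variance is negligible.\<close>

theorem lindeberg_clt:
  fixes \<kappa> :: "nat \<Rightarrow> real measure" and v b :: "nat \<Rightarrow> real" and k :: "nat \<Rightarrow> nat"
  assumes rd: "\<And>i. real_distribution (\<kappa> i)"
    and mean: "\<And>i. integrable (\<kappa> i) (\<lambda>x. x)" "\<And>i. (\<integral>x. x \<partial>\<kappa> i) = 0"
    and var: "\<And>i. integrable (\<kappa> i) (\<lambda>x. x\<^sup>2)" "\<And>i. (\<integral>x. x\<^sup>2 \<partial>\<kappa> i) = v i"
    and b_pos: "eventually (\<lambda>n. b n > 0) sequentially" and b_sq: "\<And>n. (b n)\<^sup>2 = (\<Sum>i<n. v i)"
    and lind: "\<And>\<delta>. \<delta> > 0 \<Longrightarrow>
      (\<lambda>n. (\<Sum>i<n. \<integral>x. x\<^sup>2 * indicator {x. \<bar>x\<bar> > \<delta> * b n} x \<partial>\<kappa> i) / (b n)\<^sup>2) \<longlonglongrightarrow> 0"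
    and k_le: "eventually (\<lambda>n. k n \<le> n) sequentially"
    and k_neg: "(\<lambda>n. (\<Sum>i<k n. v i) / (b n)\<^sup>2) \<longlonglongrightarrow> 0"
  shows "weak_conv_m (\<lambda>n. distr (PiM UNIV \<kappa>) borel (\<lambda>\<omega>. (\<Sum>i=k n..<n. \<omega> i) / b n)) std_normal_distribution"
proof -
  interpret \<kappa>: real_distribution "\<kappa> i" for i by (rule rd)
  interpret product_prob_UNIV \<kappa> by unfold_locales
  have co [measurable]: "(\<lambda>\<omega>. \<omega> i) \<in> borel_measurable (PiM UNIV \<kappa>)" for i
    using measurable_component_singleton[of i UNIV \<kappa>] by simp
  have v0: "0 \<le> v i" for i unfolding var(2)[symmetric] by simp
  define \<phi> where "\<phi> n t = char (distr (PiM UNIV \<kappa>) borel (\<lambda>\<omega>. (\<Sum>i=k n..<n. \<omega> i) / b n)) t" for n t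
  define \<psi> where "\<psi> n t = (\<Prod>i=k n..<n. complex_of_real (exp (- (t\<^sup>2 * (v i / (b n)\<^sup>2) / 2))))" for n and t :: real
  have \<phi>_prod: "\<phi> n t = (\<Prod>i=k n..<n. char (\<kappa> i) (t / b n))" for n t
  proof -
    have "P.indep_vars (\<lambda>_. borel) (\<lambda>i \<omega>. \<omega> i / b n) {k n..<n}"
      by (rule P.indep_vars_compose2[OF P.indep_vars_subset[OF indep_coordinates]]) auto
    from P.char_distr_sum[OF this, of t]
    have "\<phi> n t = (\<Prod>i=k n..<n. char (distr (PiM UNIV \<kappa>) borel (\<lambda>\<omega>. \<omega> i / b n)) t)"
      unfolding \<phi>_def by (simp add: sum_divide_distrib)
    moreover have "char (distr (PiM UNIV \<kappa>) borel (\<lambda>\<omega>. \<omega> i / b n)) t = char (\<kappa> i) (t / b n)" for i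
    proof -
      have "char (distr (PiM UNIV \<kappa>) borel (\<lambda>\<omega>. \<omega> i / b n)) t = (CLINT \<omega>|PiM UNIV \<kappa>. iexp (t / b n * \<omega> i))"
        by (simp add: char_def integral_distr)
      also have "\<dots> = (CLINT x|distr (PiM UNIV \<kappa>) (\<kappa> i) (\<lambda>\<omega>. \<omega> i). iexp (t / b n * x))"
        by (intro integral_distr[symmetric]) auto
      also have "\<dots> = char (\<kappa> i) (t / b n)"
        using prob by (simp add: distr_PiM_component char_def)
      finally show ?thesis .
    qed
    ultimately show ?thesis by simp
  qed
  have \<psi>_lim: "(\<lambda>n. \<psi> n t) \<longlonglongrightarrow> complex_of_real (exp (- (t\<^sup>2 / 2)))" for t
  proof -
    have "(\<lambda>n. exp (- (t\<^sup>2 / 2 * (1 - (\<Sum>i<k n. v i) / (b n)\<^sup>2)))) \<longlonglongrightarrow> exp (- (t\<^sup>2 / 2 * (1 - 0)))"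
      by (intro tendsto_intros k_neg)
    moreover have "eventually (\<lambda>n. exp (- (t\<^sup>2 / 2 * (1 - (\<Sum>i<k n. v i) / (b n)\<^sup>2))) =
        (\<Prod>i=k n..<n. exp (- (t\<^sup>2 * (v i / (b n)\<^sup>2) / 2)))) sequentially"
      using b_pos k_le
    proof eventually_elim
      case (elim n)
      have "(\<Sum>i<n. v i) = (\<Sum>i<k n. v i) + (\<Sum>i=k n..<n. v i)"
        using elim(2) by (metis atLeast0LessThan sum.atLeastLessThan_concat zero_le)
      then have "(b n)\<^sup>2 - (\<Sum>i<k n. v i) = (\<Sum>i=k n..<n. v i)" by (simp add: b_sq)
      moreover have "1 - (\<Sum>i<k n. v i) / (b n)\<^sup>2 = ((b n)\<^sup>2 - (\<Sum>i<k n. v i)) / (b n)\<^sup>2"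
        using elim(1) by (simp add: diff_divide_distrib)
      ultimately have "1 - (\<Sum>i<k n. v i) / (b n)\<^sup>2 = (\<Sum>i=k n..<n. v i) / (b n)\<^sup>2" by simp
      then show ?case
        by (simp add: exp_sum[symmetric] sum_negf sum_divide_distrib sum_distrib_left mult.commute)
    qed
    ultimately have "(\<lambda>n. \<Prod>i=k n..<n. exp (- (t\<^sup>2 * (v i / (b n)\<^sup>2) / 2))) \<longlonglongrightarrow> exp (- (t\<^sup>2 / 2))"
      by (simp add: filterlim_cong)
    from tendsto_of_real[OF this, where 'a=complex] show ?thesis by (simp add: \<psi>_def)
  qed
  define L where "L \<delta> n = (\<Sum>i<n. \<integral>x. x\<^sup>2 * indicator {x. \<bar>x\<bar> > \<delta> * b n} x \<partial>\<kappa> i) / (b n)\<^sup>2" for \<delta> n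
  have main: "cmod (\<phi> n t - \<psi> n t) \<le> t\<^sup>2 * L \<delta> n + \<bar>t\<bar> ^ 3 * \<delta> / 6 + t ^ 4 / 4 * (\<delta>\<^sup>2 + L \<delta> n)"
    if n: "b n > 0" "k n \<le> n" and \<delta>: "\<delta> > 0" for n t \<delta>
  proof -
    define e where "e i = (\<integral>x. x\<^sup>2 * indicator {x. \<bar>x\<bar> > \<delta> * b n} x \<partial>\<kappa> i) / (b n)\<^sup>2" for i
    have e: "cmod (char (\<kappa> i) (t / b n) - exp (- (t\<^sup>2 * (v i / (b n)\<^sup>2) / 2)))
        \<le> t\<^sup>2 * e i + \<bar>t\<bar> ^ 3 * \<delta> / 6 * (v i / (b n)\<^sup>2) + t ^ 4 / 4 * ((\<delta>\<^sup>2 + e i) * (v i / (b n)\<^sup>2))"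
      and e0: "0 \<le> e i" for i
      unfolding e_def by (rule \<kappa>.char_lindeberg_approx; fact mean var n \<delta>)+
    have eL: "(\<Sum>i<n. e i) = L \<delta> n" by (simp add: e_def L_def sum_divide_distrib)
    have eL1: "e i \<le> L \<delta> n" if "i < n" for i
      unfolding eL[symmetric] using that e0 by (intro member_le_sum) auto
    \<comment> \<open>The weights \<open>v i / (b n)\<^sup>2\<close> sum to 1, so the error terms
      carrying them do not accumulate with n.\<close>
    have v1: "(\<Sum>i<n. v i / (b n)\<^sup>2) = 1"
      using n by (simp add: sum_divide_distrib[symmetric] b_sq[symmetric])
    have "cmod (\<phi> n t - \<psi> n t) \<le> (\<Sum>i=k n..<n. cmod (char (\<kappa> i) (t / b n) - complex_of_real (exp (- (t\<^sup>2 * (v i / (b n)\<^sup>2) / 2)))))"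
      unfolding \<phi>_prod \<psi>_def
      using v0 by (intro norm_prod_diff) (auto simp: \<kappa>.cmod_char_le_1 norm_of_real simp del: of_real_exp)
    also have "\<dots> \<le> (\<Sum>i<n. t\<^sup>2 * e i + \<bar>t\<bar> ^ 3 * \<delta> / 6 * (v i / (b n)\<^sup>2) + t ^ 4 / 4 * ((\<delta>\<^sup>2 + e i) * (v i / (b n)\<^sup>2)))"
    proof (rule order.trans[OF sum_mono[OF e] sum_mono2])
      show "0 \<le> t\<^sup>2 * e i + \<bar>t\<bar> ^ 3 * \<delta> / 6 * (v i / (b n)\<^sup>2) + t ^ 4 / 4 * ((\<delta>\<^sup>2 + e i) * (v i / (b n)\<^sup>2))" for i
        using norm_ge_zero e order.trans by blast
    qed auto
    also have "\<dots> \<le> (\<Sum>i<n. t\<^sup>2 * e i + \<bar>t\<bar> ^ 3 * \<delta> / 6 * (v i / (b n)\<^sup>2) + t ^ 4 / 4 * ((\<delta>\<^sup>2 + L \<delta> n) * (v i / (b n)\<^sup>2)))"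
      using eL1 v0 by (intro sum_mono add_mono mult_left_mono mult_right_mono order.refl) auto
    also have "\<dots> = t\<^sup>2 * (\<Sum>i<n. e i) + \<bar>t\<bar> ^ 3 * \<delta> / 6 * (\<Sum>i<n. v i / (b n)\<^sup>2) + t ^ 4 / 4 * ((\<delta>\<^sup>2 + L \<delta> n) * (\<Sum>i<n. v i / (b n)\<^sup>2))"
      by (simp only: sum.distrib sum_distrib_left)
    also have "\<dots> = t\<^sup>2 * L \<delta> n + \<bar>t\<bar> ^ 3 * \<delta> / 6 + t ^ 4 / 4 * (\<delta>\<^sup>2 + L \<delta> n)" by (simp add: eL v1)
    finally show ?thesis .
  qed
  have diff: "(\<lambda>n. \<phi> n t - \<psi> n t) \<longlonglongrightarrow> 0" for t
  proof (rule tendstoI)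
    fix r :: real assume r: "r > 0"
    define C where "C = \<bar>t\<bar> ^ 3 / 6 + t ^ 4 / 4"
    have C0: "0 \<le> C" by (simp add: C_def)
    \<comment> \<open>As \<delta> \<le> 1, the square of \<delta> is at most \<delta>, so the part
      of the bound without \<open>L \<delta> n\<close> is at most C \<delta> \<le> r / 2. For this
      fixed \<delta> the rest tends to 0.\<close>
    define \<delta> where "\<delta> = min 1 (r / (2 * (C + 1)))"
    have \<delta>: "0 < \<delta>" "\<delta> \<le> 1" "\<delta> \<le> r / (2 * (C + 1))" using r C0 by (auto simp: \<delta>_def)
    have "C * \<delta> \<le> C * (r / (2 * (C + 1)))" using \<delta> C0 by (intro mult_left_mono) auto
    also have "\<dots> \<le> r / 2" using r C0 by (simp add: field_simps)
    finally have C\<delta>: "C * \<delta> \<le> r / 2" .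
    have "(\<lambda>n. (t\<^sup>2 + t ^ 4 / 4) * L \<delta> n) \<longlonglongrightarrow> (t\<^sup>2 + t ^ 4 / 4) * 0"
      using lind[OF \<delta>(1)] unfolding L_def by (intro tendsto_intros)
    then have "eventually (\<lambda>n. (t\<^sup>2 + t ^ 4 / 4) * L \<delta> n < r / 2) sequentially"
      using r by (intro order_tendstoD(2)[where y=0]) auto
    with b_pos k_le show "eventually (\<lambda>n. dist (\<phi> n t - \<psi> n t) 0 < r) sequentially"
    proof eventually_elim
      case (elim n)
      have "\<delta>\<^sup>2 \<le> \<delta>" using \<delta> by (simp add: power2_eq_square mult_left_le)
      then have "t ^ 4 / 4 * \<delta>\<^sup>2 \<le> t ^ 4 / 4 * \<delta>" by (intro mult_left_mono) auto
      then have "\<bar>t\<bar> ^ 3 * \<delta> / 6 + t ^ 4 / 4 * \<delta>\<^sup>2 \<le> C * \<delta>" by (simp add: C_def algebra_simps)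
      moreover have "cmod (\<phi> n t - \<psi> n t) \<le> (t\<^sup>2 + t ^ 4 / 4) * L \<delta> n + (\<bar>t\<bar> ^ 3 * \<delta> / 6 + t ^ 4 / 4 * \<delta>\<^sup>2)"
        using main[OF elim(1,2) \<delta>(1), of t] by (simp add: algebra_simps add_divide_distrib)
      ultimately show ?case using C\<delta> elim(3) by (simp only: dist_norm diff_zero)
    qed
  qed
  show ?thesis
  proof (rule levy_continuity)
    show "real_distribution (distr (PiM UNIV \<kappa>) borel (\<lambda>\<omega>. (\<Sum>i=k n..<n. \<omega> i) / b n))" for n
      by (rule P.real_distribution_distr) measurable
    show "real_distribution std_normal_distribution" by (rule real_dist_normal_dist)
    show "(\<lambda>n. char (distr (PiM UNIV \<kappa>) borel (\<lambda>\<omega>. (\<Sum>i=k n..<n. \<omega> i) / b n)) t) \<longlonglongrightarrow> char std_normal_distribution t" for t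
      using tendsto_add[OF diff[of t] \<psi>_lim[of t]] by (simp add: \<phi>_def char_std_normal_distribution exp_of_real)
  qed
qed

section \<open>Branching in a fixed environment\<close>

lemma length_particles: "u \<in> particles X n \<Longrightarrow> length u = n"
  by (induction n arbitrary: u) auto

lemma particles_cong:
  "(\<And>u. length u < n \<Longrightarrow> X u = Y u) \<Longrightarrow> particles X n = particles Y n"
proof (induction n)
  case (Suc n)
  have "particles X n = particles Y n" using Suc by simp
  moreover have "X u = Y u" if "u \<in> particles X n" for u
    using Suc.prems[of u] length_particles[OF that] by simp
  ultimately show ?case by auto
qed simp

lemma position_cong:
  "(\<And>w. length w < length u \<Longrightarrow> X w = Y w) \<Longrightarrow> position X u = position Y u"
  unfolding position_def by (intro sum.cong) auto

lemma sum_particles_Suc: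
  "(\<Sum>v\<in>particles X (Suc n). f v) = (\<Sum>u\<in>particles X n. \<Sum>i<fst (X u). f (u @ [i]))"
proof -
  have "particles X (Suc n) = (\<lambda>(u, i). u @ [i]) ` (SIGMA u:particles X n. {..<fst (X u)})"
    by force
  moreover have "inj_on (\<lambda>(u, i). u @ [i]) (SIGMA u:particles X n. {..<fst (X u)})"
    by (auto simp: inj_on_def)
  ultimately show ?thesis
    by (simp only: sum.reindex) (simp add: sum.Sigma finite_particles split_beta)
qed

lemma countable_finite_lists: "countable {T :: nat list set. finite T}"
  by (rule countable_Collect_finite)

context
  fixes B :: "'b measure" and Xf :: "'b \<Rightarrow> nat list \<Rightarrow> offspring"
  assumes Xf: "\<And>u. (\<lambda>b. Xf b u) \<in> B \<rightarrow>\<^sub>M offspring_algebra"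
begin

lemma measurable_fst_Xf: "(\<lambda>b. fst (Xf b u)) \<in> B \<rightarrow>\<^sub>M count_space UNIV"
  by (rule measurable_compose[OF Xf measurable_offspring(1)])

lemma measurable_snd_Xf: "(\<lambda>b. snd (Xf b u) i) \<in> borel_measurable B"
  by (rule measurable_compose[OF Xf measurable_offspring(2)])

lemma pred_in_particles: "Measurable.pred B (\<lambda>b. u \<in> particles (Xf b) n)"
proof (induction n arbitrary: u)
  case (Suc n)
  have [measurable]: "Measurable.pred B (\<lambda>b. i < fst (Xf b w))" for i w
    by (rule measurable_compose[OF measurable_fst_Xf]) simp
  note Suc[measurable]
  have "(\<lambda>b. u \<in> particles (Xf b) (Suc n)) = (\<lambda>b. \<exists>w i. u = w @ [i] \<and> w \<in> particles (Xf b) n \<and> i < fst (Xf b w))"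
    by auto
  then show ?case by simp
qed simp

text \<open>A generation is a random element of the countable collection of finite sets of words, so
  it suffices to look at singletons; a sum over a generation then splits into countably many sums
  over fixed sets.\<close>

lemma measurable_particles: "(\<lambda>b. particles (Xf b) n) \<in> B \<rightarrow>\<^sub>M count_space {T. finite T}"
  unfolding measurable_count_space_eq_countable[OF countable_finite_lists]
proof safe
  fix T :: "nat list set"
  note pred_in_particles[measurable]
  have "{b \<in> space B. \<forall>u. (u \<in> particles (Xf b) n) = (u \<in> T)} \<in> sets B" by measurable
  also have "{b \<in> space B. \<forall>u. (u \<in> particles (Xf b) n) = (u \<in> T)} = (\<lambda>b. particles (Xf b) n) -` {T} \<inter> space B"
    by auto
  finally show "(\<lambda>b. particles (Xf b) n) -` {T} \<inter> space B \<in> sets B" .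
qed (auto simp: finite_particles)

lemma measurable_sum_particles:
  fixes f :: "nat list \<Rightarrow> 'b \<Rightarrow> 'c :: {second_countable_topology, topological_comm_monoid_add}"
  assumes [measurable]: "\<And>u. f u \<in> borel_measurable B"
  shows "(\<lambda>b. \<Sum>u\<in>particles (Xf b) n. f u b) \<in> borel_measurable B"
  by (rule measurable_compose_countable'[where f="\<lambda>T b. \<Sum>u\<in>T. f u b", OF _ measurable_particles countable_finite_lists])
    measurable

lemma measurable_position: "(\<lambda>b. position (Xf b) u) \<in> borel_measurable B"
  unfolding position_def using measurable_snd_Xf by (intro borel_measurable_sum)

end

section \<open>Moments of the step law\<close>

lemma offspring_sum_nonneg: "(\<And>y. 0 \<le> h y) \<Longrightarrow> 0 \<le> offspring_sum h z"
  unfolding offspring_sum_def by (intro sum_nonneg) auto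

lemma ennreal_offspring_sum:
  "(\<And>y. 0 \<le> h y) \<Longrightarrow> ennreal (offspring_sum h z) = (\<Sum>i<fst z. ennreal (h (snd z i)))"
  unfolding offspring_sum_def by (simp add: sum_ennreal)

lemma integral_step_law_nonneg:
  assumes s [measurable_cong]: "sets \<nu> = sets offspring_algebra" and m: "mean_number \<nu> > 0"
    and h [measurable]: "h \<in> borel_measurable borel" and h0: "\<And>y. 0 \<le> h y"
    and i: "integrable (step_law \<nu>) h"
  shows "integrable \<nu> (offspring_sum (\<lambda>y. h (y - mean_position \<nu>)))"
    and "(\<integral>y. h y \<partial>step_law \<nu>) = 1 / mean_number \<nu> * (\<integral>z. offspring_sum (\<lambda>y. h (y - mean_position \<nu>)) z \<partial>\<nu>)"
proof -
  let ?o = "offspring_sum (\<lambda>y. h (y - mean_position \<nu>))"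
  have o0: "0 \<le> ?o z" for z using h0 by (intro offspring_sum_nonneg) auto
  have [measurable]: "?o \<in> borel_measurable \<nu>" by measurable
  have "ennreal (\<integral>y. h y \<partial>step_law \<nu>) = (\<integral>\<^sup>+y. ennreal (h y) \<partial>step_law \<nu>)"
    using i h0 by (intro nn_integral_eq_integral[symmetric]) auto
  also have "\<dots> = (\<integral>\<^sup>+z. ennreal (1 / mean_number \<nu>) * ennreal (?o z) \<partial>\<nu>)"
    by (subst nn_integral_step_law[OF s]) (auto simp: ennreal_offspring_sum h0)
  also have "\<dots> = (\<integral>\<^sup>+z. ennreal (1 / mean_number \<nu> * ?o z) \<partial>\<nu>)"
    using m o0 by (intro nn_integral_cong ennreal_mult[symmetric]) auto
  finally have eq: "(\<integral>\<^sup>+z. ennreal (1 / mean_number \<nu> * ?o z) \<partial>\<nu>) = ennreal (\<integral>y. h y \<partial>step_law \<nu>)" by simp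
  have i': "integrable \<nu> (\<lambda>z. 1 / mean_number \<nu> * ?o z)"
    using eq m o0 by (intro integrableI_nn_integral_finite[where x="\<integral>y. h y \<partial>step_law \<nu>"])
      (auto intro!: Bochner_Integration.integral_nonneg h0)
  from integrable_mult_right[OF i', of "mean_number \<nu>"] show "integrable \<nu> ?o" using m by simp
  have "ennreal (\<integral>z. 1 / mean_number \<nu> * ?o z \<partial>\<nu>) = ennreal (\<integral>y. h y \<partial>step_law \<nu>)"
    unfolding eq[symmetric] using i' m o0 by (intro nn_integral_eq_integral[symmetric]) auto
  then show "(\<integral>y. h y \<partial>step_law \<nu>) = 1 / mean_number \<nu> * (\<integral>z. ?o z \<partial>\<nu>)"
    using m o0 h0 by (subst (asm) ennreal_inj) (auto intro!: Bochner_Integration.integral_nonneg mult_nonneg_nonneg)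
qed

text \<open>Positive and negative parts are treated separately. Integrability is assumed under the
  step law, because an offspring sum can be integrable through cancellation between
  siblings.\<close>

lemma integral_step_law:
  assumes s: "sets \<nu> = sets offspring_algebra" and m: "mean_number \<nu> > 0"
    and h [measurable]: "h \<in> borel_measurable borel" and i: "integrable (step_law \<nu>) h"
  shows "integrable \<nu> (offspring_sum (\<lambda>y. h (y - mean_position \<nu>)))"
    and "(\<integral>y. h y \<partial>step_law \<nu>) = 1 / mean_number \<nu> * (\<integral>z. offspring_sum (\<lambda>y. h (y - mean_position \<nu>)) z \<partial>\<nu>)"
proof -
  let ?p = "\<lambda>y. max 0 (h y)" and ?n = "\<lambda>y. max 0 (- h y)"
  have ip: "integrable (step_law \<nu>) ?p" and "integrable (step_law \<nu>) ?n"
    using i by auto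
  note p = integral_step_law_nonneg[OF s m _ _ this(1)] and n = integral_step_law_nonneg[OF s m _ _ this(2)]
  have o: "offspring_sum (\<lambda>y. h (y - mean_position \<nu>)) = (\<lambda>z. offspring_sum (\<lambda>y. ?p (y - mean_position \<nu>)) z
      - offspring_sum (\<lambda>y. ?n (y - mean_position \<nu>)) z)"
    unfolding offspring_sum_def by (auto simp: fun_eq_iff sum_subtractf[symmetric] intro!: sum.cong)
  show "integrable \<nu> (offspring_sum (\<lambda>y. h (y - mean_position \<nu>)))"
    unfolding o using p(1) n(1) by auto
  have "(\<integral>y. h y \<partial>step_law \<nu>) = (\<integral>y. ?p y - ?n y \<partial>step_law \<nu>)"
    by (intro Bochner_Integration.integral_cong) auto
  also have "\<dots> = (\<integral>y. ?p y \<partial>step_law \<nu>) - (\<integral>y. ?n y \<partial>step_law \<nu>)"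
    using ip \<open>integrable (step_law \<nu>) ?n\<close> by (rule Bochner_Integration.integral_diff)
  also have "\<dots> = 1 / mean_number \<nu> * (\<integral>z. offspring_sum (\<lambda>y. h (y - mean_position \<nu>)) z \<partial>\<nu>)"
    unfolding o using p n by (simp add: Bochner_Integration.integral_diff right_diff_distrib)
  finally show "(\<integral>y. h y \<partial>step_law \<nu>) = 1 / mean_number \<nu> * (\<integral>z. offspring_sum (\<lambda>y. h (y - mean_position \<nu>)) z \<partial>\<nu>)" .
qed

locale offspring_law =
  fixes \<nu> :: "offspring measure"
  assumes prob_offspring: "prob_space \<nu>"
    and sets_offspring [measurable_cong]: "sets \<nu> = sets offspring_algebra"
    and number_integrable: "integrable \<nu> (\<lambda>z. real (fst z))"
    and number_pos: "mean_number \<nu> > 0"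
    and position_integrable: "integrable \<nu> (offspring_sum (\<lambda>y. y))"
    and square_integrable: "integrable \<nu> (offspring_sum (\<lambda>y. (y - mean_position \<nu>)\<^sup>2))"
begin

lemma real_distribution_step_law: "real_distribution (step_law \<nu>)"
proof -
  interpret prob_space "step_law \<nu>"
    by (rule prob_space_step_law[OF sets_offspring number_integrable number_pos])
  show ?thesis by unfold_locales (auto simp: step_law_def)
qed

sublocale step: real_distribution "step_law \<nu>" by (rule real_distribution_step_law)

lemma variance_position_nonneg: "0 \<le> variance_position \<nu>"
  unfolding variance_position_def using number_pos
  by (intro mult_nonneg_nonneg Bochner_Integration.integral_nonneg offspring_sum_nonneg) auto

lemma nn_integral_step_law_square: "(\<integral>\<^sup>+y. ennreal (y\<^sup>2) \<partial>step_law \<nu>) = ennreal (variance_position \<nu>)"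
proof -
  let ?o = "offspring_sum (\<lambda>y. (y - mean_position \<nu>)\<^sup>2)"
  have o0: "0 \<le> ?o z" for z by (intro offspring_sum_nonneg) auto
  have "(\<integral>\<^sup>+y. ennreal (y\<^sup>2) \<partial>step_law \<nu>) = (\<integral>\<^sup>+z. ennreal (1 / mean_number \<nu>) * ennreal (?o z) \<partial>\<nu>)"
    by (subst nn_integral_step_law[OF sets_offspring]) (auto simp: ennreal_offspring_sum)
  also have "\<dots> = ennreal (1 / mean_number \<nu>) * ennreal (\<integral>z. ?o z \<partial>\<nu>)"
    using square_integrable o0 by (subst nn_integral_cmult) (auto simp: nn_integral_eq_integral)
  also have "\<dots> = ennreal (variance_position \<nu>)"
    unfolding variance_position_def using number_pos o0
    by (intro ennreal_mult[symmetric]) (auto intro!: Bochner_Integration.integral_nonneg)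
  finally show ?thesis .
qed

lemma step_law_square:
  "integrable (step_law \<nu>) (\<lambda>y. y\<^sup>2)" "(\<integral>y. y\<^sup>2 \<partial>step_law \<nu>) = variance_position \<nu>"
proof -
  show "integrable (step_law \<nu>) (\<lambda>y. y\<^sup>2)"
    by (rule integrableI_nn_integral_finite[OF _ _ nn_integral_step_law_square]) auto
  then show "(\<integral>y. y\<^sup>2 \<partial>step_law \<nu>) = variance_position \<nu>"
    using nn_integral_step_law_square nn_integral_eq_integral[of "step_law \<nu>" "\<lambda>y. y\<^sup>2"] variance_position_nonneg
    by auto
qed

text \<open>Integrability of a single step comes from its second moment:
  \<open>position_integrable\<close> controls only the sum over siblings, in which terms may
  cancel.\<close>

lemma step_law_mean:
  "integrable (step_law \<nu>) (\<lambda>y. y)" "(\<integral>y. y \<partial>step_law \<nu>) = 0"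
proof -
  show i: "integrable (step_law \<nu>) (\<lambda>y. y)"
    by (rule step.square_integrable_imp_integrable[OF _ step_law_square(1)]) auto
  have "(\<integral>z. offspring_sum (\<lambda>y. y - mean_position \<nu>) z \<partial>\<nu>)
      = (\<integral>z. offspring_sum (\<lambda>y. y) z - mean_position \<nu> * real (fst z) \<partial>\<nu>)"
    by (simp add: offspring_sum_def sum_subtractf mult.commute)
  also have "\<dots> = (\<integral>z. offspring_sum (\<lambda>y. y) z \<partial>\<nu>) - mean_position \<nu> * mean_number \<nu>"
    using number_integrable position_integrable by (simp add: mean_number_def)
  also have "\<dots> = 0" using number_pos by (simp add: mean_position_def)
  finally show "(\<integral>y. y \<partial>step_law \<nu>) = 0"
    using integral_step_law(2)[OF sets_offspring number_pos _ i] by simp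
qed

lemma nn_integral_step_law_shift_square:
  "(\<integral>\<^sup>+y. ennreal ((s + y)\<^sup>2) \<partial>step_law \<nu>) = ennreal (s\<^sup>2 + variance_position \<nu>)"
proof -
  have e: "(s + y)\<^sup>2 = s\<^sup>2 + 2 * s * y + y\<^sup>2" for y :: real by (simp add: power2_eq_square algebra_simps)
  have i: "integrable (step_law \<nu>) (\<lambda>y. (s + y)\<^sup>2)"
    unfolding e using step_law_square step_law_mean by auto
  have "(\<integral>y. (s + y)\<^sup>2 \<partial>step_law \<nu>) = s\<^sup>2 + variance_position \<nu>"
    unfolding e using step_law_square step_law_mean step.prob_space by (simp add: step.space_eq_univ)
  then show ?thesis using i by (subst nn_integral_eq_integral) auto
qed

end

declare particles.simps(2) [simp del]

lemma space_offspring_algebra [simp]: "space offspring_algebra = UNIV"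
  by (auto simp: offspring_algebra_def space_pair_measure space_PiM)

section \<open>Normalized sums over a generation and their measurability\<close>

locale branching_env =
  fixes \<nu> :: "nat \<Rightarrow> offspring measure"
  assumes offspring_law: "\<And>j. offspring_law (\<nu> j)"
begin

sublocale L: offspring_law "\<nu> j" for j by (rule offspring_law)

sublocale product_prob_UNIV "\<lambda>u::nat list. \<nu> (length u)"
  by (rule product_prob_UNIV.intro) (rule L.prob_offspring)

abbreviation Q :: "(nat list \<Rightarrow> offspring) measure" where
  "Q \<equiv> PiM UNIV (\<lambda>u. \<nu> (length u))"

definition m :: "nat \<Rightarrow> real" where "m n = mean_number (\<nu> n)"

definition growth :: "nat \<Rightarrow> real" where "growth n = (\<Prod>i<n. m i)"

definition cpos :: "(nat list \<Rightarrow> offspring) \<Rightarrow> nat list \<Rightarrow> real" where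
  "cpos X u = position X u - (\<Sum>i<length u. mean_position (\<nu> i))"

definition A :: "nat \<Rightarrow> (real \<Rightarrow> real) \<Rightarrow> (nat list \<Rightarrow> offspring) \<Rightarrow> real" where
  "A n h X = (\<Sum>u\<in>particles X n. h (cpos X u)) / growth n"

abbreviation W :: "nat \<Rightarrow> (nat list \<Rightarrow> offspring) \<Rightarrow> real" where
  "W n \<equiv> A n (\<lambda>_. 1)"

text \<open>What a particle at centered position s with offspring z contributes to
  \<open>A (Suc n) h\<close>, up to the factor \<open>1 / growth n\<close>. Its mean is
  \<open>K n h s\<close>, see \<open>integral_F\<close>.\<close>

definition F :: "nat \<Rightarrow> (real \<Rightarrow> real) \<Rightarrow> real \<Rightarrow> offspring \<Rightarrow> real" where
  "F n h s z = offspring_sum (\<lambda>y. h (s + (y - mean_position (\<nu> n)))) z / m n"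

definition K :: "nat \<Rightarrow> (real \<Rightarrow> real) \<Rightarrow> real \<Rightarrow> real" where
  "K n h s = (\<integral>y. h (s + y) \<partial>step_law (\<nu> n))"

text \<open>The change \<open>A (Suc n) h - A n (K n h)\<close> is split into the fluctuation \<open>D\<close> of the families of size at
  most \<open>t\<close>, the contribution \<open>R\<close> of the larger families and the mean of the latter
  (\<open>deviation_bound\<close> below).\<close>

definition F_trunc :: "nat \<Rightarrow> real \<Rightarrow> (real \<Rightarrow> real) \<Rightarrow> real \<Rightarrow> offspring \<Rightarrow> real" where
  "F_trunc n t h s z = (if real (fst z) \<le> t then F n h s z else 0)"

definition D :: "nat \<Rightarrow> real \<Rightarrow> (real \<Rightarrow> real) \<Rightarrow> (nat list \<Rightarrow> offspring) \<Rightarrow> real" where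
  "D n t h X = (\<Sum>u\<in>particles X n. F_trunc n t h (cpos X u) (X u)
      - (\<integral>z. F_trunc n t h (cpos X u) z \<partial>\<nu> n)) / growth n"

definition R :: "nat \<Rightarrow> real \<Rightarrow> (nat list \<Rightarrow> offspring) \<Rightarrow> real" where
  "R n t X = (\<Sum>u\<in>particles X n. if real (fst (X u)) \<le> t then 0 else real (fst (X u)) / m n) / growth n"

definition tail :: "nat \<Rightarrow> real \<Rightarrow> real" where
  "tail n t = (\<integral>z. (if real (fst z) \<le> t then 0 else real (fst z) / m n) \<partial>\<nu> n)"

lemma m_pos: "0 < m n" unfolding m_def by (rule L.number_pos)

lemma growth_pos: "0 < growth n" unfolding growth_def by (intro prod_pos) (simp add: m_pos)

lemma growth_Suc: "growth (Suc n) = growth n * m n" by (simp add: growth_def)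

lemma growth_0 [simp]: "growth 0 = 1" by (simp add: growth_def)

lemma cpos_Nil [simp]: "cpos X [] = 0" by (simp add: cpos_def)

lemma cpos_snoc: "cpos X (u @ [i]) = cpos X u + (snd (X u) i - mean_position (\<nu> (length u)))"
  by (simp add: cpos_def)

lemma A_Suc: "A (Suc n) h X = (\<Sum>u\<in>particles X n. F n h (cpos X u) (X u)) / growth n"
  by (simp add: A_def sum_particles_Suc F_def offspring_sum_def cpos_snoc length_particles growth_Suc
      sum_divide_distrib mult.commute cong: sum.cong)

lemma coordinate_measurable: "(\<lambda>X. X u) \<in> Q \<rightarrow>\<^sub>M offspring_algebra"
  using measurable_component_singleton[of u UNIV "\<lambda>u. \<nu> (length u)"]
  by (simp add: L.sets_offspring cong: measurable_cong_sets)

lemmas measurable_generation_sum = measurable_sum_particles[of "\<lambda>X. X" Q, OF coordinate_measurable]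

lemma cpos_measurable [measurable]: "(\<lambda>X. cpos X u) \<in> borel_measurable Q"
  unfolding cpos_def using measurable_position[of "\<lambda>X. X" Q, OF coordinate_measurable] by simp

lemma F_measurable:
  assumes [measurable]: "h \<in> borel_measurable borel"
  shows "(\<lambda>p. F n h (fst p) (snd p)) \<in> borel_measurable (borel \<Otimes>\<^sub>M offspring_algebra)"
  unfolding F_def offspring_sum_def
  by (intro borel_measurable_divide measurable_random_sum measurable_compose[OF measurable_snd measurable_offspring(1)]
      measurable_compose[OF _ assms] borel_measurable_add borel_measurable_diff measurable_compose[OF measurable_snd measurable_offspring(2)])
    auto

lemma F_trunc_measurable:
  assumes [measurable]: "h \<in> borel_measurable borel"
  shows "(\<lambda>p. F_trunc n t h (fst p) (snd p)) \<in> borel_measurable (borel \<Otimes>\<^sub>M offspring_algebra)"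
proof -
  have "(\<lambda>p. real (fst (snd p))) \<in> borel_measurable (borel \<Otimes>\<^sub>M offspring_algebra)"
    by (rule measurable_compose[OF measurable_snd measurable_real_fst])
  note [measurable] = this F_measurable[OF assms]
  show ?thesis unfolding F_trunc_def by measurable
qed

lemma K_measurable [measurable]:
  assumes [measurable]: "h \<in> borel_measurable borel"
  shows "K n h \<in> borel_measurable borel"
  unfolding K_def by measurable

lemma A_measurable [measurable]:
  assumes [measurable]: "h \<in> borel_measurable borel"
  shows "A n h \<in> borel_measurable Q"
  unfolding A_def by (intro borel_measurable_divide measurable_generation_sum) measurable

lemma joint_measurable:
  assumes "(\<lambda>p. f (fst p) (snd p)) \<in> borel_measurable (borel \<Otimes>\<^sub>M offspring_algebra)"
  shows "(\<lambda>X. f (cpos X u) (X u)) \<in> borel_measurable Q"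
proof -
  have "(\<lambda>X. (cpos X u, X u)) \<in> Q \<rightarrow>\<^sub>M borel \<Otimes>\<^sub>M offspring_algebra"
    by (intro measurable_Pair cpos_measurable coordinate_measurable)
  from measurable_compose[OF this assms] show ?thesis by simp
qed

lemma slice_measurable:
  assumes "(\<lambda>p. f (fst p) (snd p)) \<in> borel_measurable (borel \<Otimes>\<^sub>M offspring_algebra)"
  shows "f s \<in> borel_measurable (\<nu> n)"
  using measurable_compose[OF measurable_Pair1'[of s borel offspring_algebra] assms]
  by (simp cong: measurable_cong_sets add: L.sets_offspring)

lemma integral_slice_measurable:
  fixes f :: "real \<Rightarrow> offspring \<Rightarrow> real"
  assumes "(\<lambda>p. f (fst p) (snd p)) \<in> borel_measurable (borel \<Otimes>\<^sub>M offspring_algebra)"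
  shows "(\<lambda>s. \<integral>z. f s z \<partial>\<nu> n) \<in> borel_measurable borel"
proof -
  interpret prob_space "\<nu> n" by (rule L.prob_offspring)
  have "(\<lambda>(s, z). f s z) \<in> borel_measurable (borel \<Otimes>\<^sub>M \<nu> n)"
    using assms by (simp add: split_beta' cong: measurable_cong_sets sets_pair_measure_cong add: L.sets_offspring)
  then show ?thesis by (rule borel_measurable_lebesgue_integral)
qed

lemma D_measurable [measurable]:
  assumes [measurable]: "h \<in> borel_measurable borel"
  shows "D n t h \<in> borel_measurable Q"
  unfolding D_def
  by (intro borel_measurable_divide measurable_generation_sum borel_measurable_diff
      joint_measurable F_trunc_measurable assms
      measurable_compose[OF cpos_measurable integral_slice_measurable]) auto

lemma overshoot_measurable:
  "(\<lambda>p. if real (fst (snd p)) \<le> t then 0 else real (fst (snd p)) / m n)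
    \<in> borel_measurable (borel \<Otimes>\<^sub>M offspring_algebra)"
proof -
  have [measurable]: "(\<lambda>p. real (fst (snd p))) \<in> borel_measurable (borel \<Otimes>\<^sub>M offspring_algebra)"
    by (rule measurable_compose[OF measurable_snd measurable_real_fst])
  show ?thesis by measurable
qed

lemma R_measurable [measurable]: "R n t \<in> borel_measurable Q"
  unfolding R_def
  by (intro borel_measurable_divide measurable_generation_sum
     joint_measurable[where f="\<lambda>s z. if real (fst z) \<le> t then 0 else real (fst z) / m n"] overshoot_measurable) auto

section \<open>First and second moments over a generation\<close>

definition J :: "nat \<Rightarrow> nat list set" where "J n = {u. n \<le> length u}"

text \<open>The coordinates outside \<open>J n\<close> determine the first n generations and their
  positions. Redrawing \<open>J n\<close> keeps these and supplies fresh offspring, which amounts to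
  conditioning on generation n.\<close>

lemma particles_resample [simp]: "particles (resample (J n) X Y) n = particles X n"
  by (rule particles_cong) (simp add: resample_def J_def)

lemma cpos_resample: "length u = n \<Longrightarrow> cpos (resample (J n) X Y) u = cpos X u"
  unfolding cpos_def by (subst position_cong[of u _ X]) (auto simp: resample_def J_def)

lemma resample_J [simp]: "length u = n \<Longrightarrow> resample (J n) X Y u = Y u"
  by (simp add: resample_def J_def)

text \<open>After redrawing \<open>J n\<close>, the set of particles and their positions still
  depend on X alone, while the offspring of u is the independent \<open>Y u\<close> with law
  \<open>\<nu> n\<close>.\<close>

lemma nn_integral_generation:
  fixes f :: "real \<Rightarrow> offspring \<Rightarrow> ennreal"
  assumes f: "(\<lambda>p. f (fst p) (snd p)) \<in> borel_measurable (borel \<Otimes>\<^sub>M offspring_algebra)"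
  shows "(\<integral>\<^sup>+X. (\<Sum>u\<in>particles X n. f (cpos X u) (X u)) \<partial>Q)
    = (\<integral>\<^sup>+X. (\<Sum>u\<in>particles X n. \<integral>\<^sup>+z. f (cpos X u) z \<partial>\<nu> n) \<partial>Q)"
proof -
  have "(\<integral>\<^sup>+X. (\<Sum>u\<in>particles X n. f (cpos X u) (X u)) \<partial>Q)
      = (\<integral>\<^sup>+X. \<integral>\<^sup>+Y. (\<Sum>u\<in>particles X n. f (cpos X u) (Y u)) \<partial>Q \<partial>Q)"
    by (subst nn_integral_resample[where J="J n"])
      (auto intro!: measurable_generation_sum joint_measurable f nn_integral_cong sum.cong
         simp: cpos_resample length_particles)
  also have "\<dots> = (\<integral>\<^sup>+X. (\<Sum>u\<in>particles X n. \<integral>\<^sup>+z. f (cpos X u) z \<partial>\<nu> n) \<partial>Q)"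
  proof (rule nn_integral_cong)
    fix X
    have "(\<integral>\<^sup>+Y. (\<Sum>u\<in>particles X n. f (cpos X u) (Y u)) \<partial>Q)
        = (\<Sum>u\<in>particles X n. \<integral>\<^sup>+Y. f (cpos X u) (Y u) \<partial>Q)"
    proof (rule nn_integral_sum)
      fix u assume "u \<in> particles X n"
      then show "(\<lambda>Y. f (cpos X u) (Y u)) \<in> borel_measurable Q"
        by (intro measurable_compose[where N="\<nu> (length u)", OF _ slice_measurable[OF f]] measurable_component_singleton) auto
    qed
    also have "\<dots> = (\<Sum>u\<in>particles X n. \<integral>\<^sup>+z. f (cpos X u) z \<partial>\<nu> n)"
    proof (rule sum.cong[OF refl])
      fix u assume "u \<in> particles X n"
      then show "(\<integral>\<^sup>+Y. f (cpos X u) (Y u) \<partial>Q) = (\<integral>\<^sup>+z. f (cpos X u) z \<partial>\<nu> n)"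
        using nn_integral_coordinate[OF slice_measurable[OF f], where i=u] by (simp add: length_particles)
    qed
    finally show "(\<integral>\<^sup>+Y. (\<Sum>u\<in>particles X n. f (cpos X u) (Y u)) \<partial>Q)
        = (\<Sum>u\<in>particles X n. \<integral>\<^sup>+z. f (cpos X u) z \<partial>\<nu> n)" .
  qed
  finally show ?thesis .
qed

text \<open>The many-to-one formula for one step: the weight 1 / m in \<open>step_law\<close> is
  paid back by the factor \<open>m n\<close>.\<close>

lemma nn_integral_many_to_one_Suc:
  fixes h :: "real \<Rightarrow> ennreal"
  assumes [measurable]: "h \<in> borel_measurable borel"
  shows "(\<integral>\<^sup>+X. (\<Sum>v\<in>particles X (Suc n). h (cpos X v)) \<partial>Q)
    = (\<integral>\<^sup>+X. (\<Sum>u\<in>particles X n. ennreal (m n) * (\<integral>\<^sup>+y. h (cpos X u + y) \<partial>step_law (\<nu> n))) \<partial>Q)"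
proof -
  define f :: "real \<Rightarrow> offspring \<Rightarrow> ennreal"
    where "f s z = (\<Sum>i<fst z. h (s + (snd z i - mean_position (\<nu> n))))" for s z
  have f: "(\<lambda>p. f (fst p) (snd p)) \<in> borel_measurable (borel \<Otimes>\<^sub>M offspring_algebra)"
    unfolding f_def
    by (intro measurable_random_sum measurable_compose[OF measurable_snd measurable_offspring(1)]
      measurable_compose[OF _ assms] borel_measurable_add borel_measurable_diff measurable_compose[OF measurable_snd measurable_offspring(2)])
      auto
  have "(\<integral>\<^sup>+z. f s z \<partial>\<nu> n) = ennreal (m n) * (\<integral>\<^sup>+y. h (s + y) \<partial>step_law (\<nu> n))" for s
  proof -
    have fs: "f s \<in> borel_measurable (\<nu> n)" by (rule slice_measurable[OF f])
    have "(\<integral>\<^sup>+y. h (s + y) \<partial>step_law (\<nu> n)) = (\<integral>\<^sup>+z. ennreal (1 / m n) * f s z \<partial>\<nu> n)"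
      by (subst nn_integral_step_law[OF L.sets_offspring]) (auto simp: f_def m_def)
    also have "\<dots> = ennreal (1 / m n) * (\<integral>\<^sup>+z. f s z \<partial>\<nu> n)" by (rule nn_integral_cmult[OF fs])
    finally show ?thesis using m_pos[of n] by (simp add: mult.assoc[symmetric] flip: ennreal_mult)
  qed
  with nn_integral_generation[OF f] show ?thesis
    by (simp add: sum_particles_Suc f_def cpos_snoc length_particles cong: sum.cong)
qed

lemma nn_integral_population: "(\<integral>\<^sup>+X. of_nat (card (particles X n)) \<partial>Q) = ennreal (growth n)"
proof (induction n)
  case 0 then show ?case by (simp add: P.emeasure_space_1)
next
  case (Suc n)
  have "(\<integral>\<^sup>+X. of_nat (card (particles X (Suc n))) \<partial>Q)
      = (\<integral>\<^sup>+X. ennreal (m n) * of_nat (card (particles X n)) \<partial>Q)"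
    using nn_integral_many_to_one_Suc[of "\<lambda>_. 1" n] L.step.emeasure_space_1 by (simp add: mult.commute)
  also have "\<dots> = ennreal (m n) * (\<integral>\<^sup>+X. of_nat (card (particles X n)) \<partial>Q)"
    by (rule nn_integral_cmult) (use measurable_generation_sum[of "\<lambda>_ _. 1 :: ennreal" n] in simp)
  finally show ?case using m_pos[of n] growth_pos[of n]
    by (simp only: Suc growth_Suc ennreal_mult[symmetric] less_imp_le) (simp add: mult.commute)
qed

lemma A_nonneg: "(\<And>s. 0 \<le> h s) \<Longrightarrow> 0 \<le> A n h X"
  unfolding A_def using growth_pos[of n] by (intro divide_nonneg_pos sum_nonneg) auto

lemma W_eq: "W n X = real (card (particles X n)) / growth n"
  by (simp add: A_def)

lemma W_nonneg: "0 \<le> W n X" by (rule A_nonneg) simp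

lemma nn_integral_W: "(\<integral>\<^sup>+X. ennreal (W n X) \<partial>Q) = 1"
proof -
  have "(\<integral>\<^sup>+X. ennreal (W n X) \<partial>Q) = (\<integral>\<^sup>+X. ennreal (1 / growth n) * of_nat (card (particles X n)) \<partial>Q)"
    using growth_pos[of n]
    by (intro nn_integral_cong) (simp add: W_eq ennreal_of_nat_eq_real_of_nat flip: ennreal_mult)
  also have "\<dots> = ennreal (1 / growth n) * (\<integral>\<^sup>+X. of_nat (card (particles X n)) \<partial>Q)"
    by (rule nn_integral_cmult) (use measurable_generation_sum[of "\<lambda>_ _. 1 :: ennreal" n] in simp)
  also have "\<dots> = 1" using growth_pos[of n] by (simp add: nn_integral_population flip: ennreal_mult)
  finally show ?thesis .
qed

text \<open>The steps along a line of descent are centered, so each generation adds its variance and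
  no cross term. This is the second moment behind \<open>AE_far\<close>.\<close>

lemma nn_integral_square_sum:
  "(\<integral>\<^sup>+X. (\<Sum>u\<in>particles X n. ennreal ((cpos X u)\<^sup>2)) \<partial>Q) = ennreal (growth n * (\<Sum>i<n. variance_position (\<nu> i)))"
proof (induction n)
  case 0 then show ?case by simp
next
  case (Suc n)
  let ?v = "variance_position (\<nu> n)"
  have v0: "0 \<le> variance_position (\<nu> i)" for i by (rule L.variance_position_nonneg)
  have meas1: "(\<lambda>X. \<Sum>u\<in>particles X n. ennreal ((cpos X u)\<^sup>2)) \<in> borel_measurable Q"
    by (intro measurable_generation_sum) measurable
  have meas2: "(\<lambda>X. of_nat (card (particles X n)) :: ennreal) \<in> borel_measurable Q"
    using measurable_generation_sum[of "\<lambda>_ _. 1 :: ennreal" n] by simp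
  have "(\<integral>\<^sup>+X. (\<Sum>u\<in>particles X (Suc n). ennreal ((cpos X u)\<^sup>2)) \<partial>Q)
      = (\<integral>\<^sup>+X. (\<Sum>u\<in>particles X n. ennreal (m n) * ennreal ((cpos X u)\<^sup>2 + ?v)) \<partial>Q)"
    by (subst nn_integral_many_to_one_Suc[of "\<lambda>y. ennreal (y\<^sup>2)"]) (auto simp: L.nn_integral_step_law_shift_square)
  also have "\<dots> = (\<integral>\<^sup>+X. ennreal (m n) * ((\<Sum>u\<in>particles X n. ennreal ((cpos X u)\<^sup>2)) + ennreal ?v * of_nat (card (particles X n))) \<partial>Q)"
    by (intro nn_integral_cong)
      (simp add: sum_distrib_left[symmetric] ennreal_plus v0 sum.distrib mult.commute[of "ennreal ?v"])
  also have "\<dots> = ennreal (m n) * (ennreal (growth n * (\<Sum>i<n. variance_position (\<nu> i))) + ennreal ?v * ennreal (growth n))"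
  proof -
    note [measurable] = meas1 meas2
    show ?thesis
      by (simp only: nn_integral_cmult nn_integral_add meas1 meas2 borel_measurable_add borel_measurable_times
          borel_measurable_const borel_measurable_times_ennreal Suc nn_integral_population)
  qed
  also have "\<dots> = ennreal (m n * (growth n * (\<Sum>i<n. variance_position (\<nu> i)) + ?v * growth n))"
    using m_pos[of n] growth_pos[of n] v0
    by (simp add: ennreal_mult ennreal_plus sum_nonneg mult_nonneg_nonneg)
  also have "m n * (growth n * (\<Sum>i<n. variance_position (\<nu> i)) + ?v * growth n)
      = growth (Suc n) * (\<Sum>i<Suc n. variance_position (\<nu> i))"
    by (simp add: growth_Suc algebra_simps)
  finally show ?case .
qed

section \<open>One-step deviations\<close>

lemma integrable_bounded_step:
  fixes h :: "real \<Rightarrow> real"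
  assumes [measurable]: "h \<in> borel_measurable borel" and h: "\<And>y. 0 \<le> h y" "\<And>y. h y \<le> 1"
  shows "integrable (step_law (\<nu> n)) (\<lambda>y. h (s + y))"
  by (rule L.step.integrable_const_bound[where B=1]) (use h in auto)

lemma K_bounds:
  assumes [measurable]: "h \<in> borel_measurable borel" and h: "\<And>y. 0 \<le> h y" "\<And>y. h y \<le> 1"
  shows "0 \<le> K n h s" "K n h s \<le> 1"
proof -
  show "0 \<le> K n h s" unfolding K_def using h by (intro Bochner_Integration.integral_nonneg) auto
  have "K n h s \<le> (\<integral>y. 1 \<partial>step_law (\<nu> n))"
    unfolding K_def using h integrable_bounded_step[OF assms] by (intro integral_mono) auto
  then show "K n h s \<le> 1" using L.step.prob_space by (simp add: L.step.space_eq_univ)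
qed

lemma F_bounds:
  assumes h: "\<And>y. 0 \<le> h y" "\<And>y. h y \<le> 1"
  shows "0 \<le> F n h s z" "F n h s z \<le> real (fst z) / m n"
proof -
  show "0 \<le> F n h s z" unfolding F_def using m_pos[of n] h
    by (intro divide_nonneg_pos offspring_sum_nonneg) auto
  have "offspring_sum (\<lambda>y. h (s + (y - mean_position (\<nu> n)))) z \<le> (\<Sum>i<fst z. 1)"
    unfolding offspring_sum_def using h by (intro sum_mono) auto
  then show "F n h s z \<le> real (fst z) / m n"
    unfolding F_def using m_pos[of n] by (intro divide_right_mono) auto
qed

lemma integral_F:
  assumes [measurable]: "h \<in> borel_measurable borel" and h: "\<And>y. 0 \<le> h y" "\<And>y. h y \<le> 1"
  shows "integrable (\<nu> n) (F n h s)" "(\<integral>z. F n h s z \<partial>\<nu> n) = K n h s"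
  using integral_step_law[OF L.sets_offspring L.number_pos _ integrable_bounded_step[OF assms, where n=n and s=s]]
  by (auto simp: F_def[abs_def] K_def m_def)

lemma integrable_number: "integrable (\<nu> n) (\<lambda>z. real (fst z) / m n)"
  using L.number_integrable[of n] by simp

lemma fst_measurable [measurable]: "(\<lambda>z. real (fst z)) \<in> borel_measurable (\<nu> n)"
  by (simp add: L.sets_offspring cong: measurable_cong_sets)

lemma tail_integrable: "integrable (\<nu> n) (\<lambda>z. if real (fst z) \<le> t then 0 else real (fst z) / m n)"
  using m_pos[of n] by (intro Bochner_Integration.integrable_bound[OF integrable_number[of n]]) auto

lemma tail_nonneg: "0 \<le> tail n t"
  unfolding tail_def using m_pos[of n] by (intro Bochner_Integration.integral_nonneg) auto

lemma F_trunc_bounds: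
  assumes h: "\<And>y. 0 \<le> h y" "\<And>y. h y \<le> 1" and t: "0 \<le> t"
  shows "0 \<le> F_trunc n t h s z" "F_trunc n t h s z \<le> t / m n" "F_trunc n t h s z \<le> F n h s z"
    "F n h s z \<le> F_trunc n t h s z + (if real (fst z) \<le> t then 0 else real (fst z) / m n)"
  using F_bounds[where h=h, OF h, where n=n and s=s and z=z] t m_pos[of n] divide_right_mono[of "real (fst z)" t "m n"]
  by (auto simp: F_trunc_def intro: order.trans)

lemma F_trunc_integrable:
  assumes hm: "h \<in> borel_measurable borel" and h: "\<And>y. 0 \<le> h y" "\<And>y. h y \<le> 1" and t: "0 \<le> t"
  shows "integrable (\<nu> n) (F_trunc n t h s)"
proof (rule Bochner_Integration.integrable_bound[OF integral_F(1)[OF hm h, where n=n and s=s] slice_measurable[OF F_trunc_measurable[OF hm]]], rule AE_I2)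
  fix z
  show "norm (F_trunc n t h s z) \<le> norm (F n h s z)"
    using F_trunc_bounds(1,3)[where h=h, OF h t, where n=n and s=s and z=z] by simp
qed

lemma deviation_bound:
  assumes hm: "h \<in> borel_measurable borel" and h: "\<And>y. 0 \<le> h y" "\<And>y. h y \<le> 1" and t: "0 \<le> t"
  shows "\<bar>A (Suc n) h X - A n (K n h) X\<bar> \<le> \<bar>D n t h X\<bar> + R n t X + tail n t * W n X"
proof -
  let ?g = "\<lambda>s. \<integral>z. F_trunc n t h s z \<partial>\<nu> n"
  let ?o = "\<lambda>z. if real (fst z) \<le> t then 0 else real (fst z) / m n"
  let ?T = "particles X n"
  \<comment> \<open>Dropping large families lowers the mean by at most the mean of what they could
    contribute, and this holds for every h with values in [0, 1].\<close>
  have g: "\<bar>?g s - K n h s\<bar> \<le> tail n t" for s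
  proof -
    have "?g s \<le> K n h s"
      unfolding integral_F(2)[OF hm h, symmetric]
      by (intro integral_mono F_trunc_integrable integral_F F_trunc_bounds hm h t)
    moreover have "K n h s \<le> (\<integral>z. F_trunc n t h s z + ?o z \<partial>\<nu> n)"
      unfolding integral_F(2)[OF hm h, symmetric]
      by (intro integral_mono Bochner_Integration.integrable_add tail_integrable F_trunc_integrable integral_F F_trunc_bounds hm h t)
    moreover have "\<dots> = ?g s + tail n t"
      unfolding tail_def by (intro Bochner_Integration.integral_add tail_integrable F_trunc_integrable hm h t)
    ultimately show ?thesis by linarith
  qed
  have "growth n * (A (Suc n) h X - A n (K n h) X)
      = (\<Sum>u\<in>?T. F n h (cpos X u) (X u) - K n h (cpos X u))"
    unfolding A_Suc unfolding A_def using growth_pos[of n] by (simp add: sum_subtractf right_diff_distrib)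
  also have "\<dots> = (\<Sum>u\<in>?T. F_trunc n t h (cpos X u) (X u) - ?g (cpos X u))
      + (\<Sum>u\<in>?T. F n h (cpos X u) (X u) - F_trunc n t h (cpos X u) (X u))
      + (\<Sum>u\<in>?T. ?g (cpos X u) - K n h (cpos X u))"
    by (simp add: sum.distrib[symmetric])
  finally have "growth n * \<bar>A (Suc n) h X - A n (K n h) X\<bar> = \<bar>\<dots>\<bar>"
    using growth_pos[of n] by (metis abs_mult abs_of_pos)
  also have "\<dots> \<le> \<bar>\<Sum>u\<in>?T. F_trunc n t h (cpos X u) (X u) - ?g (cpos X u)\<bar>
      + \<bar>\<Sum>u\<in>?T. F n h (cpos X u) (X u) - F_trunc n t h (cpos X u) (X u)\<bar>
      + \<bar>\<Sum>u\<in>?T. ?g (cpos X u) - K n h (cpos X u)\<bar>"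
    by linarith
  also have "\<bar>\<Sum>u\<in>?T. F n h (cpos X u) (X u) - F_trunc n t h (cpos X u) (X u)\<bar> \<le> (\<Sum>u\<in>?T. ?o (X u))"
  proof (intro order.trans[OF sum_abs] sum_mono)
    fix u
    show "\<bar>F n h (cpos X u) (X u) - F_trunc n t h (cpos X u) (X u)\<bar> \<le> ?o (X u)"
      using F_trunc_bounds(3,4)[where h=h, OF h t, where n=n and s="cpos X u" and z="X u"] by linarith
  qed
  also have "\<bar>\<Sum>u\<in>?T. ?g (cpos X u) - K n h (cpos X u)\<bar> \<le> (\<Sum>u\<in>?T. tail n t)"
    using g by (intro order.trans[OF sum_abs] sum_mono)
  finally have "growth n * \<bar>A (Suc n) h X - A n (K n h) X\<bar>
      \<le> \<bar>\<Sum>u\<in>?T. F_trunc n t h (cpos X u) (X u) - ?g (cpos X u)\<bar> + (\<Sum>u\<in>?T. ?o (X u)) + (\<Sum>u\<in>?T. tail n t)"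
    by simp
  also have "\<dots> = growth n * (\<bar>D n t h X\<bar> + R n t X + tail n t * W n X)"
    using growth_pos[of n] by (simp add: D_def R_def W_eq algebra_simps abs_divide)
  finally show ?thesis using growth_pos[of n] by (simp add: mult_le_cancel_left_pos)
qed

lemma R_nonneg: "0 \<le> R n t X"
  unfolding R_def using growth_pos[of n] m_pos[of n] by (intro divide_nonneg_pos sum_nonneg) auto

lemma nn_integral_R: "(\<integral>\<^sup>+X. ennreal (R n t X) \<partial>Q) = ennreal (tail n t)"
proof -
  let ?o = "\<lambda>z::offspring. if real (fst z) \<le> t then 0 else real (fst z) / m n"
  have o0: "0 \<le> ?o z" for z using m_pos[of n] by auto
  have ot: "(\<integral>\<^sup>+z. ennreal (?o z) \<partial>\<nu> n) = ennreal (tail n t)"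
    unfolding tail_def by (intro nn_integral_eq_integral tail_integrable) (use o0 in auto)
  have om: "(\<lambda>p. ennreal (?o (snd p))) \<in> borel_measurable (borel \<Otimes>\<^sub>M offspring_algebra)"
    by (intro measurable_compose[OF overshoot_measurable]) auto
  have "(\<integral>\<^sup>+X. ennreal (R n t X) \<partial>Q) = (\<integral>\<^sup>+X. ennreal (1 / growth n) * (\<Sum>u\<in>particles X n. ennreal (?o (X u))) \<partial>Q)"
    using growth_pos[of n] o0
    by (intro nn_integral_cong) (subst sum_ennreal, simp, simp add: R_def sum_nonneg flip: ennreal_mult)
  also have "\<dots> = ennreal (1 / growth n) * (\<integral>\<^sup>+X. (\<Sum>u\<in>particles X n. ennreal (?o (X u))) \<partial>Q)"
    by (intro nn_integral_cmult measurable_generation_sum joint_measurable[where f="\<lambda>s z. ennreal (?o z)"] om)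
  also have "(\<integral>\<^sup>+X. (\<Sum>u\<in>particles X n. ennreal (?o (X u))) \<partial>Q)
      = (\<integral>\<^sup>+X. ennreal (tail n t) * of_nat (card (particles X n)) \<partial>Q)"
    by (subst nn_integral_generation[where f="\<lambda>s z. ennreal (?o z)", OF om]) (simp only: ot sum_constant mult.commute)
  also have "\<dots> = ennreal (tail n t) * ennreal (growth n)"
    using measurable_generation_sum[of "\<lambda>_ _. 1 :: ennreal" n] by (subst nn_integral_cmult) (simp_all add: nn_integral_population)
  finally show ?thesis
    using growth_pos[of n] tail_nonneg[of n t] by (simp flip: ennreal_mult)
qed

text \<open>Given the first n generations, D is a sum of independent centered terms divided by
  \<open>growth n\<close>. Each has variance at most \<open>t / m n\<close>, and the expected number
  of terms is \<open>growth n\<close>, so one of the two factors \<open>growth n\<close> in the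
  denominator survives and combines with \<open>m n\<close> to
  \<open>growth (Suc n)\<close>.\<close>

lemma nn_integral_D_square:
  assumes hm: "h \<in> borel_measurable borel" and h: "\<And>y. 0 \<le> h y" "\<And>y. h y \<le> 1" and t: "0 \<le> t"
  shows "(\<integral>\<^sup>+X. ennreal ((D n t h X)\<^sup>2) \<partial>Q) \<le> ennreal (t / growth (Suc n))"
proof -
  note [measurable] = hm
  let ?g = "\<lambda>s. \<integral>z. F_trunc n t h s z \<partial>\<nu> n"
  interpret \<nu>: prob_space "\<nu> n" by (rule L.prob_offspring)
  have tm: "0 \<le> t / m n" using t m_pos[of n] by simp
  have g: "0 \<le> ?g s" "?g s \<le> t / m n" "?g s \<le> 1" for s
  proof -
    show "0 \<le> ?g s" by (intro Bochner_Integration.integral_nonneg F_trunc_bounds h t)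
    have "?g s \<le> (\<integral>z. t / m n \<partial>\<nu> n)"
      by (intro integral_mono F_trunc_integrable F_trunc_bounds hm h t) auto
    then show "?g s \<le> t / m n" by (simp add: \<nu>.prob_space)
    have "?g s \<le> (\<integral>z. F n h s z \<partial>\<nu> n)"
      by (intro integral_mono F_trunc_integrable F_trunc_bounds integral_F hm h t)
    also have "\<dots> \<le> 1" using integral_F(2)[OF hm h] K_bounds[OF hm h] by simp
    finally show "?g s \<le> 1" .
  qed
  \<comment> \<open>One factor of the square is bounded by \<open>t / m n\<close>, the other has
    mean at most 1. The variance is therefore linear in t.\<close>
  have var: "(\<integral>z. (F_trunc n t h s z - ?g s)\<^sup>2 \<partial>\<nu> n) \<le> t / m n" for s
  proof -
    have sq: "integrable (\<nu> n) (\<lambda>z. (F_trunc n t h s z)\<^sup>2)"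
      using F_trunc_bounds(1,2)[where h=h, OF h t, where n=n] slice_measurable[OF F_trunc_measurable[OF hm]] tm
      by (intro \<nu>.integrable_const_bound[where B="(t / m n)\<^sup>2"]) (auto intro!: power_mono)
    have "(\<integral>z. (F_trunc n t h s z - ?g s)\<^sup>2 \<partial>\<nu> n) = (\<integral>z. (F_trunc n t h s z)\<^sup>2 \<partial>\<nu> n) - (?g s)\<^sup>2"
      by (rule \<nu>.variance_eq[OF F_trunc_integrable[OF hm h t] sq])
    also have "\<dots> \<le> (\<integral>z. (F_trunc n t h s z)\<^sup>2 \<partial>\<nu> n)" by simp
    also have "\<dots> \<le> (\<integral>z. t / m n * F_trunc n t h s z \<partial>\<nu> n)"
    proof (intro integral_mono sq integrable_mult_right F_trunc_integrable hm h t)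
      fix z show "(F_trunc n t h s z)\<^sup>2 \<le> t / m n * F_trunc n t h s z"
        unfolding power2_eq_square by (intro mult_right_mono F_trunc_bounds h t)
    qed
    also have "\<dots> = t / m n * ?g s" by simp
    also have "\<dots> \<le> t / m n" using g[of s] tm by (intro mult_left_le) auto
    finally show ?thesis .
  qed
  have inner: "(\<integral>\<^sup>+Y. ennreal ((D n t h (resample (J n) X Y))\<^sup>2) \<partial>Q)
      \<le> ennreal (t / m n / (growth n)\<^sup>2) * of_nat (card (particles X n))" for X
  proof -
    let ?T = "particles X n"
    let ?f = "\<lambda>u z. F_trunc n t h (cpos X u) z - ?g (cpos X u)"
    have len: "length u = n" if "u \<in> ?T" for u using that by (rule length_particles)
    have D_eq: "D n t h (resample (J n) X Y) = (\<Sum>u\<in>?T. ?f u (Y u)) / growth n" for Y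
      unfolding D_def by (simp add: len cpos_resample cong: sum.cong)
    have fm: "?f u \<in> borel_measurable (\<nu> (length u))" for u
      by (intro borel_measurable_diff slice_measurable[OF F_trunc_measurable[OF hm]]) auto
    have fb: "\<bar>?f u z\<bar> \<le> t / m n" for u z
      using F_trunc_bounds(1,2)[where h=h, OF h t, where n=n and s="cpos X u" and z=z] g[of "cpos X u"] by linarith
    have f0: "(\<integral>z. ?f u z \<partial>\<nu> (length u)) = 0" if "u \<in> ?T" for u
      using F_trunc_integrable[OF hm h t, where n=n] len[OF that] by (simp add: \<nu>.prob_space)
    note S = integral_sum_square[of ?T ?f "t / m n", OF finite_particles fm fb f0]
    have "(\<integral>Y. (\<Sum>u\<in>?T. ?f u (Y u))\<^sup>2 \<partial>Q) \<le> (\<Sum>u\<in>?T. t / m n)"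
    proof -
      have "(\<integral>Y. (\<Sum>u\<in>?T. ?f u (Y u))\<^sup>2 \<partial>Q) = (\<Sum>u\<in>?T. \<integral>z. (?f u z)\<^sup>2 \<partial>\<nu> (length u))"
        by (rule S(1))
      also have "\<dots> \<le> (\<Sum>u\<in>?T. t / m n)"
        using var len by (intro sum_mono) simp
      finally show ?thesis .
    qed
    then have "ennreal (1 / (growth n)\<^sup>2) * ennreal (\<integral>Y. (\<Sum>u\<in>?T. ?f u (Y u))\<^sup>2 \<partial>Q)
        \<le> ennreal (1 / (growth n)\<^sup>2) * ennreal (\<Sum>u\<in>?T. t / m n)"
      by (intro mult_left_mono ennreal_leI) auto
    also have "\<dots> = ennreal (t / m n / (growth n)\<^sup>2) * of_nat (card ?T)"
      using tm t m_pos[of n] by (simp add: ennreal_of_nat_eq_real_of_nat mult_ac flip: ennreal_mult)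
    finally have le: "ennreal (1 / (growth n)\<^sup>2) * ennreal (\<integral>Y. (\<Sum>u\<in>?T. ?f u (Y u))\<^sup>2 \<partial>Q)
        \<le> ennreal (t / m n / (growth n)\<^sup>2) * of_nat (card ?T)" .
    have "(\<integral>\<^sup>+Y. ennreal ((D n t h (resample (J n) X Y))\<^sup>2) \<partial>Q)
        = (\<integral>\<^sup>+Y. ennreal (1 / (growth n)\<^sup>2) * ennreal ((\<Sum>u\<in>?T. ?f u (Y u))\<^sup>2) \<partial>Q)"
      unfolding D_eq by (intro nn_integral_cong) (simp add: power_divide flip: ennreal_mult)
    also have "\<dots> = ennreal (1 / (growth n)\<^sup>2) * (\<integral>\<^sup>+Y. ennreal ((\<Sum>u\<in>?T. ?f u (Y u))\<^sup>2) \<partial>Q)"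
      using S(2) by (intro nn_integral_cmult) auto
    also have "(\<integral>\<^sup>+Y. ennreal ((\<Sum>u\<in>?T. ?f u (Y u))\<^sup>2) \<partial>Q) = ennreal (\<integral>Y. (\<Sum>u\<in>?T. ?f u (Y u))\<^sup>2 \<partial>Q)"
      by (rule nn_integral_eq_integral[OF S(2)]) auto
    finally show ?thesis using le by simp
  qed
  have "(\<integral>\<^sup>+X. ennreal ((D n t h X)\<^sup>2) \<partial>Q) = (\<integral>\<^sup>+X. \<integral>\<^sup>+Y. ennreal ((D n t h (resample (J n) X Y))\<^sup>2) \<partial>Q \<partial>Q)"
    by (rule nn_integral_resample) measurable
  also have "\<dots> \<le> (\<integral>\<^sup>+X. ennreal (t / m n / (growth n)\<^sup>2) * of_nat (card (particles X n)) \<partial>Q)"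
    by (intro nn_integral_mono inner)
  also have "\<dots> = ennreal (t / m n / (growth n)\<^sup>2) * ennreal (growth n)"
    using measurable_generation_sum[of "\<lambda>_ _. 1 :: ennreal" n] by (subst nn_integral_cmult) (simp_all add: nn_integral_population)
  also have "\<dots> = ennreal (t / growth (Suc n))"
  proof -
    have "t / m n / (growth n)\<^sup>2 * growth n = t / growth (Suc n)"
      using growth_pos[of n] by (simp add: growth_Suc power2_eq_square)
    then show ?thesis
      using growth_pos[of n] tm by (metis ennreal_mult' less_imp_le mult.commute)
  qed
  finally show ?thesis .
qed

end

section \<open>Limits in a fixed environment\<close>

lemma pred_tendsto:
  fixes f :: "nat \<Rightarrow> 'a \<Rightarrow> real"
  assumes [measurable]: "\<And>n. f n \<in> borel_measurable M"
  shows "Measurable.pred M (\<lambda>x. (\<lambda>n. f n x) \<longlonglongrightarrow> c)"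
proof -
  have "((\<lambda>n. f n x) \<longlonglongrightarrow> c) \<longleftrightarrow> (\<forall>i. \<exists>N. \<forall>n\<ge>N. dist (f n x) c < inverse (real (Suc i)))" for x
  proof
    assume "(\<lambda>n. f n x) \<longlonglongrightarrow> c"
    then show "\<forall>i. \<exists>N. \<forall>n\<ge>N. dist (f n x) c < inverse (real (Suc i))"
      unfolding LIMSEQ_def by simp
  next
    assume *: "\<forall>i. \<exists>N. \<forall>n\<ge>N. dist (f n x) c < inverse (real (Suc i))"
    show "(\<lambda>n. f n x) \<longlonglongrightarrow> c" unfolding LIMSEQ_def
    proof (intro allI impI)
      fix r :: real assume "0 < r"
      then obtain i where "inverse (real (Suc i)) < r" using reals_Archimedean by blast
      with * show "\<exists>N. \<forall>n\<ge>N. dist (f n x) c < r" by (meson order.strict_trans)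
    qed
  qed
  then show ?thesis by (simp only:) measurable
qed

text \<open>The form of Borel-Cantelli used here: a series of nonnegative terms with summable means
  has finite expectation, hence converges almost surely.\<close>

lemma AE_summable:
  fixes f :: "nat \<Rightarrow> 'a \<Rightarrow> real" and g :: "nat \<Rightarrow> real"
  assumes [measurable]: "\<And>n. f n \<in> borel_measurable M" and f0: "\<And>n x. 0 \<le> f n x"
    and le: "\<And>n. (\<integral>\<^sup>+x. ennreal (f n x) \<partial>M) \<le> ennreal (g n)" and g: "summable g" "\<And>n. 0 \<le> g n"
  shows "AE x in M. summable (\<lambda>n. f n x)"
proof -
  have "(\<integral>\<^sup>+x. (\<Sum>n. ennreal (f n x)) \<partial>M) = (\<Sum>n. \<integral>\<^sup>+x. ennreal (f n x) \<partial>M)"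
    by (rule nn_integral_suminf) measurable
  also have "\<dots> \<le> (\<Sum>n. ennreal (g n))" by (intro suminf_le le) auto
  also have "\<dots> < \<infinity>" using g by (simp add: suminf_ennreal2)
  finally have "AE x in M. (\<Sum>n. ennreal (f n x)) \<noteq> \<infinity>"
    by (intro nn_integral_PInf_AE) auto
  then show ?thesis
    by eventually_elim (intro summable_suminf_not_top f0, simp)
qed

lemma summable_inverse_Suc_square: "summable (\<lambda>n. inverse ((real (Suc n))\<^sup>2))"
  using inverse_power_summable[of 2, where 'a=real] summable_Suc_iff[of "\<lambda>n. inverse ((real n)\<^sup>2)"]
  by (simp only: power_inverse le_refl simp_thms)

text \<open>Eventually the argument lies between x - d / 2 and x + d / 2. Monotonicity encloses the
  value between those at two fixed points, where the pointwise limit applies.\<close>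

lemma cdf_tendsto_shifted:
  fixes G :: "nat \<Rightarrow> real \<Rightarrow> real" and \<Phi> :: "real \<Rightarrow> real"
  assumes mono: "\<And>n. mono (G n)" and lim: "\<And>y. (\<lambda>n. G n y) \<longlonglongrightarrow> \<Phi> y" and cont: "isCont \<Phi> x"
    and \<rho>: "\<rho> \<longlonglongrightarrow> 0"
  shows "(\<lambda>n. G n (x + \<rho> n)) \<longlonglongrightarrow> \<Phi> x"
proof (rule tendstoI)
  fix r :: real assume r: "r > 0"
  from cont r obtain d where d: "d > 0" "\<And>y. dist y x < d \<Longrightarrow> dist (\<Phi> y) (\<Phi> x) < r / 2"
    unfolding continuous_at by (metis LIM_def dist_self half_gt_zero_iff zero_less_dist_iff dist_commute r)
  let ?l = "x - d / 2" and ?u = "x + d / 2"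
  have "eventually (\<lambda>n. dist (G n ?l) (\<Phi> ?l) < r / 2) sequentially"
    "eventually (\<lambda>n. dist (G n ?u) (\<Phi> ?u) < r / 2) sequentially"
    "eventually (\<lambda>n. dist (\<rho> n) 0 < d / 2) sequentially"
    using tendstoD[OF lim half_gt_zero[OF r]] tendstoD[OF \<rho> half_gt_zero[OF d(1)]] by blast+
  then show "eventually (\<lambda>n. dist (G n (x + \<rho> n)) (\<Phi> x) < r) sequentially"
  proof eventually_elim
    case (elim n)
    have "G n ?l \<le> G n (x + \<rho> n)" "G n (x + \<rho> n) \<le> G n ?u"
      using elim(3) by (auto intro!: monoD[OF mono] simp: dist_real_def)
    moreover have "dist (\<Phi> ?l) (\<Phi> x) < r / 2" "dist (\<Phi> ?u) (\<Phi> x) < r / 2"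
      using d by (auto simp: dist_real_def)
    ultimately show ?case using elim(1,2) unfolding dist_real_def by linarith
  qed
qed

lemma isCont_cdf_std_normal: "isCont (cdf std_normal_distribution) x"
proof -
  interpret real_distribution std_normal_distribution by (rule real_dist_normal_dist)
  have "emeasure std_normal_distribution {x} = (\<integral>\<^sup>+y. ennreal (std_normal_density y) * indicator {x} y \<partial>lborel)"
    by (intro emeasure_density) auto
  also have "\<dots> = 0"
    by (subst nn_integral_0_iff_AE) (auto intro!: AE_I[where N="{x}"] simp: indicator_def)
  finally show ?thesis by (simp add: isCont_cdf measure_def)
qed

section \<open>The random walk along a line of descent\<close>

context branching_env
begin

abbreviation S_space :: "(nat \<Rightarrow> real) measure" where
  "S_space \<equiv> PiM UNIV (\<lambda>i. step_law (\<nu> i))"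

sublocale S: product_prob_UNIV "\<lambda>i. step_law (\<nu> i)"
  by (rule product_prob_UNIV.intro) (rule L.step.prob_space_axioms)

lemma S_coordinate [measurable]: "(\<lambda>\<omega>. \<omega> i) \<in> borel_measurable S_space"
  using measurable_component_singleton[of i UNIV "\<lambda>i. step_law (\<nu> i)"] by (simp cong: measurable_cong_sets)

text \<open>The probability that a line of descent at centered position y in generation j is at most
  s in generation n. Thus \<open>A j (H s n j)\<close> is the conditional expectation of
  \<open>A n (indicator {..s})\<close> given the first j generations.\<close>

definition H :: "real \<Rightarrow> nat \<Rightarrow> nat \<Rightarrow> real \<Rightarrow> real" where
  "H s n j y = measure S_space {\<omega> \<in> space S_space. y + (\<Sum>i=j..<n. \<omega> i) \<le> s}"

lemma H_bounds: "0 \<le> H s n j y" "H s n j y \<le> 1"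
  by (auto simp: H_def)

lemma H_end: "H s n n = indicator {..s}"
proof
  fix y
  have "{\<omega> \<in> space S_space. y + (\<Sum>i=n..<n. \<omega> i) \<le> s} = (if y \<le> s then space S_space else {})" by auto
  then show "H s n n y = indicator {..s} y" unfolding H_def by (auto simp: S.P.prob_space)
qed

lemma H_antimono: "y \<le> y' \<Longrightarrow> H s n j y' \<le> H s n j y"
  unfolding H_def by (intro S.P.finite_measure_mono) auto

lemma H_measurable [measurable]: "H s n j \<in> borel_measurable borel"
proof -
  have "mono (\<lambda>y. - H s n j y)" using H_antimono by (auto simp: mono_def)
  then have "(\<lambda>y. - (- H s n j y)) \<in> borel_measurable borel"
    by (intro borel_measurable_uminus borel_measurable_mono)
  then show ?thesis by simp
qed

text \<open>The backward equation. Redrawing every coordinate except j separates the step j, kept in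
  X, from the later steps, taken from Y.\<close>

lemma K_H:
  assumes "j < n"
  shows "K j (H s n (Suc j)) = H s n j"
proof
  fix y
  let ?E = "\<lambda>j y. {\<omega> \<in> space S_space. y + (\<Sum>i=j..<n. \<omega> i) \<le> s}"
  have E [measurable]: "?E j y \<in> sets S_space" for j y by measurable
  have Hn: "ennreal (H s n j y) = emeasure S_space (?E j y)" for j y
    unfolding H_def by (simp add: S.P.emeasure_eq_measure)
  have "ennreal (H s n j y) = (\<integral>\<^sup>+\<omega>. indicator (?E j y) \<omega> \<partial>S_space)" by (simp add: Hn)
  also have "\<dots> = (\<integral>\<^sup>+X. \<integral>\<^sup>+Y. indicator (?E j y) (resample (- {j}) X Y) \<partial>S_space \<partial>S_space)"
    by (rule S.nn_integral_resample) measurable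
  also have "\<dots> = (\<integral>\<^sup>+X. \<integral>\<^sup>+Y. indicator (?E (Suc j) (y + X j)) Y \<partial>S_space \<partial>S_space)"
  proof (intro nn_integral_cong)
    fix X Y assume XY: "X \<in> space S_space" "Y \<in> space S_space"
    have "(\<Sum>i=j..<n. resample (- {j}) X Y i) = X j + (\<Sum>i=Suc j..<n. Y i)"
      using assms by (simp add: sum.atLeast_Suc_lessThan resample_def)
    moreover have "resample (- {j}) X Y \<in> space S_space"
      using XY by (auto simp: resample_def space_PiM)
    ultimately show "(indicator (?E j y) (resample (- {j}) X Y) :: ennreal) = indicator (?E (Suc j) (y + X j)) Y"
      using XY by (simp add: indicator_def add.assoc)
  qed
  also have "\<dots> = (\<integral>\<^sup>+X. ennreal (H s n (Suc j) (y + X j)) \<partial>S_space)"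
    by (intro nn_integral_cong) (simp add: Hn)
  also have "\<dots> = (\<integral>\<^sup>+z. ennreal (H s n (Suc j) (y + z)) \<partial>step_law (\<nu> j))"
  proof (rule S.nn_integral_coordinate[where f="\<lambda>z. ennreal (H s n (Suc j) (y + z))"])
    show "(\<lambda>z. ennreal (H s n (Suc j) (y + z))) \<in> borel_measurable (step_law (\<nu> j))"
      by (intro measurable_compose[OF _ measurable_ennreal] measurable_compose[OF _ H_measurable]) simp
  qed
  also have "\<dots> = ennreal (K j (H s n (Suc j)) y)"
    unfolding K_def
    by (intro nn_integral_eq_integral integrable_bounded_step H_measurable H_bounds) (auto simp: H_bounds)
  finally show "K j (H s n (Suc j)) y = H s n j y"
    using H_bounds K_bounds[OF H_measurable H_bounds] by simp
qed

lemma K_one: "K j (\<lambda>_. 1) = (\<lambda>_. 1)"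
  unfolding K_def using L.step.prob_space by (simp add: L.step.space_eq_univ)

end

text \<open>The properties of a typical environment on which the quenched limit theorem rests. The
  rates \<open>c\<close>, \<open>a\<^sub>1\<close>, \<open>a\<^sub>2\<close> will come from the law
  of the environment, the constants \<open>C\<^sub>1\<close>, \<open>C\<^sub>2\<close> from its
  realization. \<open>variance_tail\<close> is the source of Lindeberg's condition.\<close>

locale good_env = branching_env +
  fixes c C\<^sub>1 a\<^sub>1 a\<^sub>2 C\<^sub>2 :: real
  assumes c_pos: "0 < c" and C\<^sub>1_pos: "0 < C\<^sub>1" and a\<^sub>1_pos: "0 < a\<^sub>1"
    and growth_lower: "\<And>n. C\<^sub>1 * exp (c * real n) \<le> growth n"
    and tail_summable: "summable (\<lambda>j. tail j (exp (c * real j / 4)))"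
    and variance_lower: "\<And>n. a\<^sub>1 * real n - C\<^sub>2 \<le> (\<Sum>i<n. variance_position (\<nu> i))"
    and variance_upper: "\<And>n. (\<Sum>i<n. variance_position (\<nu> i)) \<le> a\<^sub>2 * real n + C\<^sub>2"
    and variance_tail: "\<And>\<epsilon>. 0 < \<epsilon> \<Longrightarrow> \<exists>M C. \<forall>n.
      (\<Sum>i<n. \<integral>y. y\<^sup>2 * indicator {y. \<bar>y\<bar> > M} y \<partial>step_law (\<nu> i)) \<le> \<epsilon> * real n + C"
begin

section \<open>Summable deviations and convergence of the normalized population\<close>

definition t :: "nat \<Rightarrow> real" where "t j = exp (c * real j / 4)"

definition dec :: "nat \<Rightarrow> real" where "dec j = exp (- c / 4) ^ j"

definition C\<^sub>D :: real where "C\<^sub>D = (1 + 1 / C\<^sub>1) / 2"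

lemma C\<^sub>D_pos: "0 < C\<^sub>D" using C\<^sub>1_pos by (simp add: C\<^sub>D_def field_simps)

lemma t_nonneg: "0 \<le> t j" by (simp add: t_def)

lemma dec_exp: "dec j = exp (- (c * real j / 4))"
  by (simp add: dec_def exp_of_nat_mult[symmetric] mult_ac)

lemma dec_nonneg: "0 \<le> dec j" by (simp add: dec_def)

lemma dec_summable: "summable dec"
  unfolding dec_def[abs_def] using c_pos by (intro summable_geometric) simp

text \<open>The second moment is turned into a first moment by 2 |y| \<le> d + y^2 / d with d =
  \<open>dec j\<close>. Since \<open>t j\<close> is 1 / d and the growth is at least
  \<open>C\<^sub>1\<close> / d^4, the second moment is at most d^3 / \<open>C\<^sub>1\<close>.
  Division by d leaves d^2 / \<open>C\<^sub>1\<close>, which is at most d /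
  \<open>C\<^sub>1\<close>, and the two halves add up to \<open>C\<^sub>D * dec j\<close>.\<close>

lemma nn_integral_D:
  assumes hm: "h \<in> borel_measurable borel" and h: "\<And>y. 0 \<le> h y" "\<And>y. h y \<le> 1"
  shows "(\<integral>\<^sup>+X. ennreal \<bar>D j (t j) h X\<bar> \<partial>Q) \<le> ennreal (C\<^sub>D * dec j)"
proof -
  note [measurable] = hm
  have d: "0 < dec j" by (simp add: dec_def)
  have amgm: "\<bar>y\<bar> \<le> (dec j + y\<^sup>2 / dec j) / 2" for y :: real
  proof -
    have "0 \<le> (dec j - \<bar>y\<bar>)\<^sup>2 / dec j" using d by simp
    also have "\<dots> = dec j + y\<^sup>2 / dec j - 2 * \<bar>y\<bar>"
      using d by (simp add: field_simps power2_eq_square)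
    finally show ?thesis by simp
  qed
  have "(\<integral>\<^sup>+X. ennreal \<bar>D j (t j) h X\<bar> \<partial>Q)
      \<le> (\<integral>\<^sup>+X. ennreal (dec j / 2) + ennreal (1 / (2 * dec j)) * ennreal ((D j (t j) h X)\<^sup>2) \<partial>Q)"
  proof (rule nn_integral_mono)
    fix X
    have "ennreal \<bar>D j (t j) h X\<bar> \<le> ennreal (dec j / 2 + 1 / (2 * dec j) * (D j (t j) h X)\<^sup>2)"
      using amgm[of "D j (t j) h X"] by (intro ennreal_leI) (simp add: field_simps)
    also have "\<dots> = ennreal (dec j / 2) + ennreal (1 / (2 * dec j)) * ennreal ((D j (t j) h X)\<^sup>2)"
      using d by (subst ennreal_plus, simp, simp, subst ennreal_mult) auto
    finally show "ennreal \<bar>D j (t j) h X\<bar> \<le> \<dots>" .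
  qed
  also have "\<dots> = ennreal (dec j / 2) + ennreal (1 / (2 * dec j)) * (\<integral>\<^sup>+X. ennreal ((D j (t j) h X)\<^sup>2) \<partial>Q)"
    by (simp add: nn_integral_add nn_integral_cmult P.emeasure_space_1)
  also have "\<dots> \<le> ennreal (dec j / 2) + ennreal (1 / (2 * dec j)) * ennreal (t j / growth (Suc j))"
    by (intro add_mono mult_left_mono nn_integral_D_square hm h t_nonneg) auto
  also have "\<dots> = ennreal (dec j / 2 + 1 / (2 * dec j) * (t j / growth (Suc j)))"
    using d t_nonneg[of j] growth_pos[of "Suc j"]
    by (subst ennreal_plus, simp, simp, subst ennreal_mult) auto
  also have "\<dots> \<le> ennreal (C\<^sub>D * dec j)"
  proof (rule ennreal_leI)
    have e: "exp (c * real j / 4) * exp (c * real j / 4) * exp (c * real j / 4) * exp (c * real j / 4) = exp (c * real j)"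
      by (simp flip: exp_add)
    have "C\<^sub>1 * exp (c * real j) \<le> C\<^sub>1 * exp (c * real (Suc j))"
      using C\<^sub>1_pos c_pos by simp
    also have "\<dots> \<le> growth (Suc j)" by (rule growth_lower)
    finally have "t j / growth (Suc j) \<le> t j / (C\<^sub>1 * exp (c * real j))"
      using C\<^sub>1_pos t_nonneg growth_pos[of "Suc j"] by (intro divide_left_mono) auto
    also have "\<dots> = dec j * dec j * dec j / C\<^sub>1"
      unfolding e[symmetric] dec_exp t_def by (simp add: exp_minus field_simps)
    finally have "1 / (2 * dec j) * (t j / growth (Suc j)) \<le> 1 / (2 * dec j) * (dec j * dec j * dec j / C\<^sub>1)"
      using d by (intro mult_left_mono) auto
    also have "\<dots> = dec j * dec j / (2 * C\<^sub>1)" using d by (simp add: field_simps)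
    also have "\<dots> \<le> dec j / (2 * C\<^sub>1)"
      using C\<^sub>1_pos d c_pos by (intro divide_right_mono) (auto simp: dec_exp)
    finally have "dec j / 2 + 1 / (2 * dec j) * (t j / growth (Suc j)) \<le> dec j / 2 + dec j / (2 * C\<^sub>1)" by simp
    also have "\<dots> = C\<^sub>D * dec j" by (simp add: C\<^sub>D_def add_divide_distrib distrib_right)
    finally show "dec j / 2 + 1 / (2 * dec j) * (t j / growth (Suc j)) \<le> C\<^sub>D * dec j" .
  qed
  finally show ?thesis .
qed

text \<open>The part of \<open>deviation_bound\<close> that is free of the test function: one almost
  sure summability statement covers all n and s at once.\<close>

definition E :: "nat \<Rightarrow> (nat list \<Rightarrow> offspring) \<Rightarrow> real" where
  "E j X = R j (t j) X + tail j (t j) * W j X"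

lemma E_nonneg: "0 \<le> E j X"
  unfolding E_def by (intro add_nonneg_nonneg mult_nonneg_nonneg R_nonneg tail_nonneg W_nonneg)

lemma E_measurable [measurable]: "E j \<in> borel_measurable Q"
  unfolding E_def[abs_def] by measurable

lemma nn_integral_E: "(\<integral>\<^sup>+X. ennreal (E j X) \<partial>Q) = ennreal (2 * tail j (t j))"
proof -
  have "(\<integral>\<^sup>+X. ennreal (E j X) \<partial>Q) = (\<integral>\<^sup>+X. ennreal (R j (t j) X) + ennreal (tail j (t j)) * ennreal (W j X) \<partial>Q)"
    unfolding E_def using R_nonneg tail_nonneg W_nonneg
    by (intro nn_integral_cong) (simp add: ennreal_mult ennreal_plus mult_nonneg_nonneg)
  also have "\<dots> = ennreal (tail j (t j)) + ennreal (tail j (t j)) * 1"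
    by (simp add: nn_integral_add nn_integral_cmult nn_integral_R nn_integral_W)
  also have "\<dots> = ennreal (2 * tail j (t j))"
    using tail_nonneg by (simp flip: ennreal_plus)
  finally show ?thesis .
qed

lemma AE_summable_E: "AE X in Q. summable (\<lambda>j. E j X)"
  by (rule AE_summable[where g="\<lambda>j. 2 * tail j (t j)"])
    (use tail_summable in \<open>auto simp: nn_integral_E E_nonneg tail_nonneg t_def intro!: summable_mult\<close>)

lemma step_bound:
  assumes hm: "h \<in> borel_measurable borel" and h: "\<And>y. 0 \<le> h y" "\<And>y. h y \<le> 1"
  shows "\<bar>A (Suc j) h X - A j (K j h) X\<bar> \<le> \<bar>D j (t j) h X\<bar> + E j X"
  using deviation_bound[OF hm h t_nonneg[of j], where n=j and X=X] by (simp add: E_def)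

lemma W_increment: "\<bar>W (Suc j) X - W j X\<bar> \<le> \<bar>D j (t j) (\<lambda>_. 1) X\<bar> + E j X"
  using step_bound[of "\<lambda>_. 1" j X] by (simp add: K_one)

lemma nn_integral_W_increment:
  "(\<integral>\<^sup>+X. ennreal \<bar>W (Suc j) X - W j X\<bar> \<partial>Q) \<le> ennreal (C\<^sub>D * dec j + 2 * tail j (t j))"
proof -
  have "(\<integral>\<^sup>+X. ennreal \<bar>W (Suc j) X - W j X\<bar> \<partial>Q) \<le> (\<integral>\<^sup>+X. ennreal \<bar>D j (t j) (\<lambda>_. 1) X\<bar> + ennreal (E j X) \<partial>Q)"
    using W_increment E_nonneg by (intro nn_integral_mono) (simp flip: ennreal_plus)
  also have "\<dots> = (\<integral>\<^sup>+X. ennreal \<bar>D j (t j) (\<lambda>_. 1) X\<bar> \<partial>Q) + ennreal (2 * tail j (t j))"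
    by (subst nn_integral_add) (auto simp: nn_integral_E)
  also have "\<dots> \<le> ennreal (C\<^sub>D * dec j) + ennreal (2 * tail j (t j))"
    by (intro add_right_mono nn_integral_D) auto
  also have "\<dots> = ennreal (C\<^sub>D * dec j + 2 * tail j (t j))"
    using C\<^sub>D_pos dec_nonneg tail_nonneg by (simp add: ennreal_plus)
  finally show ?thesis .
qed

lemma increment_summable: "summable (\<lambda>j. C\<^sub>D * dec j + 2 * tail j (t j))"
  using tail_summable dec_summable by (auto simp: t_def intro!: summable_add summable_mult)

lemma increment_nonneg: "0 \<le> C\<^sub>D * dec j + 2 * tail j (t j)"
  using C\<^sub>D_pos dec_nonneg tail_nonneg by simp

lemma AE_W_converges: "AE X in Q. convergent (\<lambda>n. W n X)"
proof -
  have "AE X in Q. summable (\<lambda>j. \<bar>W (Suc j) X - W j X\<bar>)"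
    by (rule AE_summable[OF _ _ nn_integral_W_increment increment_summable increment_nonneg]) auto
  then show ?thesis
  proof eventually_elim
    case (elim X)
    then have "summable (\<lambda>j. W (Suc j) X - W j X)" by (rule summable_rabs_cancel)
    then have "convergent (\<lambda>n. \<Sum>j<n. W (Suc j) X - W j X)" by (simp add: summable_iff_convergent)
    then have "convergent (\<lambda>n. W n X - W 0 X)" 
      by (simp only: sum_lessThan_telescope[of "\<lambda>j. W j X"])
    then show ?case by (simp only: convergent_diff_const_right_iff)
  qed
qed

text \<open>If \<open>W n\<close> tends to 0, then \<open>W k\<close> is at most the sum of all
  later increments in absolute value. For large k the mean of that sum is below 1 / 2, whereas
  \<open>W k\<close> has mean 1.\<close>

lemma W_not_AE_null: "\<not> (AE X in Q. (\<lambda>n. W n X) \<longlonglongrightarrow> 0)"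
proof
  assume null: "AE X in Q. (\<lambda>n. W n X) \<longlonglongrightarrow> 0"
  let ?e = "\<lambda>j. C\<^sub>D * dec j + 2 * tail j (t j)"
  have "(\<lambda>k. \<Sum>j. ?e (j + k)) \<longlonglongrightarrow> 0" by (rule suminf_exist_split2[OF increment_summable])
  then have "eventually (\<lambda>k. (\<Sum>j. ?e (j + k)) < 1 / 2) sequentially"
    by (rule order_tendstoD) simp
  then obtain k where k: "(\<Sum>j. ?e (j + k)) < 1 / 2" by (auto simp: eventually_sequentially)
  have "AE X in Q. ennreal (W k X) \<le> (\<Sum>j. ennreal \<bar>W (Suc (j + k)) X - W (j + k) X\<bar>)"
    using null
  proof eventually_elim
    case (elim X)
    let ?S = "\<Sum>j. ennreal \<bar>W (Suc (j + k)) X - W (j + k) X\<bar>"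
    have le: "ennreal \<bar>W k X - W (n + k) X\<bar> \<le> ?S" for n
    proof -
      have "\<bar>W k X - W (n + k) X\<bar> = \<bar>\<Sum>j<n. W (Suc (j + k)) X - W (j + k) X\<bar>"
        using sum_lessThan_telescope[of "\<lambda>j. W (j + k) X" n] by (simp add: abs_minus_commute)
      also have "\<dots> \<le> (\<Sum>j<n. \<bar>W (Suc (j + k)) X - W (j + k) X\<bar>)" by (rule sum_abs)
      finally have "ennreal \<bar>W k X - W (n + k) X\<bar> \<le> (\<Sum>j<n. ennreal \<bar>W (Suc (j + k)) X - W (j + k) X\<bar>)"
        by (simp add: ennreal_leI sum_ennreal)
      also have "\<dots> \<le> ?S" by (intro sum_le_suminf) auto
      finally show ?thesis .
    qed
    have "(\<lambda>n. W (n + k) X) \<longlonglongrightarrow> 0" using elim by (rule LIMSEQ_ignore_initial_segment)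
    then have "(\<lambda>n. ennreal \<bar>W k X - W (n + k) X\<bar>) \<longlonglongrightarrow> ennreal \<bar>W k X - 0\<bar>"
      by (intro tendsto_intros)
    then have "ennreal \<bar>W k X - 0\<bar> \<le> ?S" by (rule LIMSEQ_le_const2) (use le in auto)
    then show ?case using W_nonneg[of k X] by simp
  qed
  then have "(\<integral>\<^sup>+X. ennreal (W k X) \<partial>Q) \<le> (\<integral>\<^sup>+X. (\<Sum>j. ennreal \<bar>W (Suc (j + k)) X - W (j + k) X\<bar>) \<partial>Q)"
    by (rule nn_integral_mono_AE)
  also have "\<dots> = (\<Sum>j. \<integral>\<^sup>+X. ennreal \<bar>W (Suc (j + k)) X - W (j + k) X\<bar> \<partial>Q)"
    by (rule nn_integral_suminf) measurable
  also have "\<dots> \<le> (\<Sum>j. ennreal (?e (j + k)))" by (intro suminf_le nn_integral_W_increment) auto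
  also have "\<dots> = ennreal (\<Sum>j. ?e (j + k))"
    using increment_nonneg summable_ignore_initial_segment[OF increment_summable]
    by (intro suminf_ennreal2) auto
  also have "\<dots> \<le> ennreal (1 / 2)" using k by (intro ennreal_leI) simp
  finally have "ennreal 1 \<le> ennreal (1 / 2)" by (simp add: nn_integral_W)
  then show False by (subst (asm) ennreal_le_iff) auto
qed

section \<open>The normalization and the intermediate generation\<close>

abbreviation v :: "nat \<Rightarrow> real" where "v i \<equiv> variance_position (\<nu> i)"

definition b :: "nat \<Rightarrow> real" where "b n = sqrt (\<Sum>i<n. v i)"

text \<open>Logarithmic growth is fast enough for \<open>dec_k\<close> and slow enough for \<open>k_square_over_b\<close>.\<close>

definition k :: "nat \<Rightarrow> nat" where "k n = nat \<lceil>8 / c * ln (real n + 1)\<rceil>"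

lemma b_square: "(b n)\<^sup>2 = (\<Sum>i<n. v i)"
  unfolding b_def by (intro real_sqrt_pow2 sum_nonneg L.variance_position_nonneg)

lemma b_ge: "sqrt (a\<^sub>1 * real n - C\<^sub>2) \<le> b n"
  unfolding b_def by (intro real_sqrt_le_mono variance_lower)

lemma b_at_top: "filterlim b at_top sequentially"
proof (rule filterlim_at_top_mono)
  show "filterlim (\<lambda>n. sqrt (a\<^sub>1 * real n - C\<^sub>2)) at_top sequentially"
    using a\<^sub>1_pos by real_asymp
qed (use b_ge in auto)

lemma b_eventually_pos: "eventually (\<lambda>n. 0 < b n) sequentially"
  using b_at_top by (simp add: filterlim_at_top_dense)

lemma variance_denominator: "eventually (\<lambda>n. 0 < a\<^sub>1 * real n - C\<^sub>2) sequentially"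
  using a\<^sub>1_pos by real_asymp

lemma k_ge: "8 / c * ln (real n + 1) \<le> real (k n)" unfolding k_def by linarith

lemma k_le: "real (k n) \<le> 8 / c * ln (real n + 1) + 1"
proof -
  have "0 \<le> 8 / c * ln (real n + 1)" using c_pos by (intro mult_nonneg_nonneg ln_ge_zero) auto
  then show ?thesis unfolding k_def by linarith
qed

lemma k_at_top: "filterlim k at_top sequentially"
proof -
  have "filterlim (\<lambda>n. real (k n)) at_top sequentially"
  proof (rule filterlim_at_top_mono)
    show "filterlim (\<lambda>n. 8 / c * ln (real n + 1)) at_top sequentially" using c_pos by real_asymp
  qed (use k_ge in auto)
  then show ?thesis by (simp add: filterlim_sequentially_iff_filterlim_real)
qed

lemma k_eventually_le: "eventually (\<lambda>n. k n \<le> n) sequentially"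
proof -
  have "eventually (\<lambda>n. 8 / c * ln (real n + 1) + 1 \<le> real n) sequentially" using c_pos by real_asymp
  then show ?thesis
  proof eventually_elim
    case (elim n)
    then have "real (k n) \<le> real n" using k_le[of n] by linarith
    then show ?case by simp
  qed
qed

text \<open>This is where the factor 8 / c in \<open>k\<close> comes from: multiplied by the rate c
  / 4 of \<open>dec\<close> it gives the exponent 2, enough for summability in n.\<close>

lemma dec_k: "dec (k n) \<le> inverse ((real (Suc n))\<^sup>2)"
proof -
  have "c * (8 / c * ln (real n + 1)) \<le> c * real (k n)" using k_ge c_pos by (intro mult_left_mono) auto
  then have "- (c * real (k n) / 4) \<le> - 2 * ln (real n + 1)" using c_pos by simp
  then have "dec (k n) \<le> exp (- 2 * ln (real n + 1))" by (simp add: dec_exp)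
  also have "\<dots> = inverse (exp (ln (real n + 1)) * exp (ln (real n + 1)))"
  proof -
    have "exp (- 2 * ln (real n + 1)) = exp (- (ln (real n + 1) + ln (real n + 1)))" by simp
    also have "\<dots> = inverse (exp (ln (real n + 1) + ln (real n + 1)))" by (rule exp_minus)
    finally show ?thesis by (simp only: exp_add)
  qed
  also have "\<dots> = inverse ((real (Suc n))\<^sup>2)" by (simp add: power2_eq_square add.commute)
  finally show ?thesis .
qed

text \<open>The square of \<open>k n + 1\<close> is the threshold in \<open>far\<close> at
  generation \<open>k n\<close>. It is of order log^2 n, while \<open>b n\<close> is at least of
  order sqrt n.\<close>

lemma k_square_over_b: "(\<lambda>n. (real (k n) + 1)\<^sup>2 / b n) \<longlonglongrightarrow> 0"
proof (rule tendsto_sandwich[where f="\<lambda>_. 0"])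
  show "(\<lambda>n. (8 / c * ln (real n + 1) + 2)\<^sup>2 / sqrt (a\<^sub>1 * real n - C\<^sub>2)) \<longlonglongrightarrow> 0"
    using c_pos a\<^sub>1_pos by real_asymp
  show "eventually (\<lambda>n. 0 \<le> (real (k n) + 1)\<^sup>2 / b n) sequentially"
    using b_eventually_pos by eventually_elim simp
  show "eventually (\<lambda>n. (real (k n) + 1)\<^sup>2 / b n
      \<le> (8 / c * ln (real n + 1) + 2)\<^sup>2 / sqrt (a\<^sub>1 * real n - C\<^sub>2)) sequentially"
    using variance_denominator
  proof eventually_elim
    case (elim n)
    then show ?case using k_le[of n] b_ge[of n]
      by (intro frac_le power_mono) auto
  qed
qed simp

lemma variance_k: "(\<lambda>n. (\<Sum>i<k n. v i) / (b n)\<^sup>2) \<longlonglongrightarrow> 0"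
proof (rule tendsto_sandwich[where f="\<lambda>_. 0"])
  show "(\<lambda>n. (\<bar>a\<^sub>2\<bar> * (8 / c * ln (real n + 1) + 1) + \<bar>C\<^sub>2\<bar>) / (a\<^sub>1 * real n - C\<^sub>2)) \<longlonglongrightarrow> 0"
    using c_pos a\<^sub>1_pos by real_asymp
  show "eventually (\<lambda>n. 0 \<le> (\<Sum>i<k n. v i) / (b n)\<^sup>2) sequentially"
    by (intro always_eventually allI divide_nonneg_nonneg sum_nonneg L.variance_position_nonneg) auto
  show "eventually (\<lambda>n. (\<Sum>i<k n. v i) / (b n)\<^sup>2
      \<le> (\<bar>a\<^sub>2\<bar> * (8 / c * ln (real n + 1) + 1) + \<bar>C\<^sub>2\<bar>) / (a\<^sub>1 * real n - C\<^sub>2)) sequentially"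
    using variance_denominator
  proof eventually_elim
    case (elim n)
    have "(\<Sum>i<k n. v i) \<le> a\<^sub>2 * real (k n) + C\<^sub>2" by (rule variance_upper)
    also have "\<dots> \<le> \<bar>a\<^sub>2\<bar> * real (k n) + \<bar>C\<^sub>2\<bar>" by (intro add_mono mult_right_mono) auto
    also have "\<dots> \<le> \<bar>a\<^sub>2\<bar> * (8 / c * ln (real n + 1) + 1) + \<bar>C\<^sub>2\<bar>"
      by (intro add_right_mono mult_left_mono k_le) auto
    finally have *: "(\<Sum>i<k n. v i) \<le> \<bar>a\<^sub>2\<bar> * (8 / c * ln (real n + 1) + 1) + \<bar>C\<^sub>2\<bar>" .
    show ?case
    proof (rule frac_le)
      show "0 \<le> \<bar>a\<^sub>2\<bar> * (8 / c * ln (real n + 1) + 1) + \<bar>C\<^sub>2\<bar>"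
        using * by (rule order.trans[rotated]) (intro sum_nonneg L.variance_position_nonneg)
    qed (use elim variance_lower[of n] * in \<open>auto simp: b_square\<close>)
  qed
qed simp

text \<open>The level \<delta> \<open>b n\<close> eventually exceeds any fixed M, so the truncated
  variances are dominated by those at level M, whose sum grows with an arbitrarily small slope by
  \<open>variance_tail\<close>.\<close>

lemma lindeberg_condition:
  assumes \<delta>: "0 < \<delta>"
  shows "(\<lambda>n. (\<Sum>i<n. \<integral>y. y\<^sup>2 * indicator {y. \<bar>y\<bar> > \<delta> * b n} y \<partial>step_law (\<nu> i)) / (b n)\<^sup>2) \<longlonglongrightarrow> 0"
    (is "?f \<longlonglongrightarrow> 0")
proof (rule tendstoI)
  fix r :: real assume r: "0 < r"
  let ?I = "\<lambda>M i. \<integral>y. y\<^sup>2 * indicator {y. \<bar>y\<bar> > M} y \<partial>step_law (\<nu> i)"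
  have int: "integrable (step_law (\<nu> i)) (\<lambda>y. y\<^sup>2 * indicator {y. \<bar>y\<bar> > M} y)" for M i
    by (rule Bochner_Integration.integrable_bound[OF L.step_law_square(1)]) (auto simp: indicator_def)
  \<comment> \<open>With this slope the quotient against
    \<open>a\<^sub>1 * real n - C\<^sub>2\<close> tends to r / 2.\<close>
  define e where "e = r * a\<^sub>1 / 2"
  have "0 < e" using r a\<^sub>1_pos by (simp add: e_def)
  then obtain M C where M: "\<And>n. (\<Sum>i<n. ?I M i) \<le> e * real n + C" using variance_tail by metis
  have "(\<lambda>n. (e * real n + C) / (a\<^sub>1 * real n - C\<^sub>2)) \<longlonglongrightarrow> e * inverse a\<^sub>1"
    using a\<^sub>1_pos \<open>0 < e\<close> by real_asymp
  then have "eventually (\<lambda>n. (e * real n + C) / (a\<^sub>1 * real n - C\<^sub>2) < r) sequentially"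
    by (rule order_tendstoD) (use a\<^sub>1_pos r in \<open>simp add: e_def field_simps\<close>)
  moreover have "eventually (\<lambda>n. M / \<delta> \<le> b n) sequentially"
    using b_at_top by (simp add: filterlim_at_top)
  ultimately show "eventually (\<lambda>n. dist (?f n) 0 < r) sequentially"
    using variance_denominator
  proof eventually_elim
    case (elim n)
    have 0: "0 \<le> (\<Sum>i<n. ?I (\<delta> * b n) i)"
      by (intro sum_nonneg Bochner_Integration.integral_nonneg) auto
    have "M \<le> \<delta> * b n" using elim(2) \<delta> by (simp add: field_simps)
    then have "(\<Sum>i<n. ?I (\<delta> * b n) i) \<le> (\<Sum>i<n. ?I M i)"
      by (intro sum_mono integral_mono int) (auto simp: indicator_def)
    also have "\<dots> \<le> e * real n + C" by (rule M)
    finally have "?f n \<le> (e * real n + C) / (a\<^sub>1 * real n - C\<^sub>2)"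
      using elim(3) variance_lower[of n] 0 by (intro frac_le) (auto simp: b_square)
    moreover have "0 \<le> ?f n" using 0 by simp
    ultimately show ?case using elim(1) by simp
  qed
qed

definition G :: "nat \<Rightarrow> real \<Rightarrow> real" where
  "G n = cdf (distr S_space borel (\<lambda>\<omega>. (\<Sum>i=k n..<n. \<omega> i) / b n))"

lemma G_tendsto: "(\<lambda>n. G n y) \<longlonglongrightarrow> cdf std_normal_distribution y"
proof -
  have "weak_conv_m (\<lambda>n. distr S_space borel (\<lambda>\<omega>. (\<Sum>i=k n..<n. \<omega> i) / b n)) std_normal_distribution"
    by (rule lindeberg_clt[where v=v and b=b and k=k and \<kappa>="\<lambda>i. step_law (\<nu> i)",
        OF L.real_distribution_step_law L.step_law_mean L.step_law_square
          b_eventually_pos b_square lindeberg_condition k_eventually_le variance_k])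
  then show ?thesis
    using isCont_cdf_std_normal unfolding weak_conv_m_def weak_conv_def G_def by blast
qed

lemma G_measure: "G n y = measure S_space {\<omega> \<in> space S_space. (\<Sum>i=k n..<n. \<omega> i) / b n \<le> y}"
  unfolding G_def cdf_def by (subst measure_distr) (auto intro!: arg_cong[where f="measure S_space"])

lemma G_mono: "mono (G n)"
  unfolding mono_def G_measure by (auto intro!: S.P.finite_measure_mono)

lemma H_eq_G: "0 < b n \<Longrightarrow> H (b n * x) n (k n) y = G n (x - y / b n)"
  unfolding H_def G_measure
  by (intro arg_cong[where f="measure S_space"]) (auto simp: field_simps)

text \<open>For each n the expected sum is a geometric tail starting at \<open>k n\<close>, hence a
  multiple of \<open>dec (k n)\<close>, which is summable in n. The functions h may change with n
  and j, because \<open>nn_integral_D\<close> is uniform in them.\<close>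

lemma AE_D_sum:
  assumes hm: "\<And>n j. h n j \<in> borel_measurable borel"
    and h: "\<And>n j y. 0 \<le> h n j y" "\<And>n j y. h n j y \<le> 1"
  shows "AE X in Q. (\<lambda>n. \<Sum>j=k n..<n. \<bar>D j (t j) (h n j) X\<bar>) \<longlonglongrightarrow> 0"
proof -
  note [measurable] = hm
  define q where "q = exp (- c / 4)"
  have q: "0 < q" "q < 1" using c_pos by (auto simp: q_def)
  have dec_q: "dec j = q ^ j" for j by (simp add: dec_def q_def)
  have geo: "(\<Sum>j=l..<n. dec j) \<le> dec l / (1 - q)" for l n
  proof -
    have "(\<Sum>j=l..<n. dec j) = q ^ l * (\<Sum>i=0..<n-l. q ^ i)"
    proof (cases "l \<le> n")
      case True
      then show ?thesis using sum.shift_bounds_nat_ivl[of dec 0 l "n - l"]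
        by (simp add: dec_q sum_distrib_left power_add mult.commute)
    qed simp
    also have "\<dots> \<le> q ^ l * (\<Sum>i. q ^ i)"
      using q by (intro mult_left_mono sum_le_suminf summable_geometric) auto
    also have "\<dots> = dec l / (1 - q)" using q by (simp add: suminf_geometric dec_q)
    finally show ?thesis .
  qed
  have "AE X in Q. summable (\<lambda>n. \<Sum>j=k n..<n. \<bar>D j (t j) (h n j) X\<bar>)"
  proof (rule AE_summable[where g="\<lambda>n. C\<^sub>D / (1 - q) * inverse ((real (Suc n))\<^sup>2)"])
    show "(\<integral>\<^sup>+X. ennreal (\<Sum>j=k n..<n. \<bar>D j (t j) (h n j) X\<bar>) \<partial>Q)
        \<le> ennreal (C\<^sub>D / (1 - q) * inverse ((real (Suc n))\<^sup>2))" for n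
    proof -
      have "(\<integral>\<^sup>+X. ennreal (\<Sum>j=k n..<n. \<bar>D j (t j) (h n j) X\<bar>) \<partial>Q)
          = (\<Sum>j=k n..<n. \<integral>\<^sup>+X. ennreal \<bar>D j (t j) (h n j) X\<bar> \<partial>Q)"
        by (subst nn_integral_sum[symmetric]) (auto intro!: nn_integral_cong)
      also have "\<dots> \<le> (\<Sum>j=k n..<n. ennreal (C\<^sub>D * dec j))"
        by (intro sum_mono nn_integral_D hm h)
      also have "\<dots> = ennreal (C\<^sub>D * (\<Sum>j=k n..<n. dec j))"
        using C\<^sub>D_pos dec_nonneg by (simp add: sum_ennreal sum_distrib_left)
      also have "\<dots> \<le> ennreal (C\<^sub>D * (dec (k n) / (1 - q)))"
        using C\<^sub>D_pos by (intro ennreal_leI mult_left_mono geo) auto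
      also have "\<dots> \<le> ennreal (C\<^sub>D / (1 - q) * inverse ((real (Suc n))\<^sup>2))"
      proof (rule ennreal_leI)
        have "C\<^sub>D * (dec (k n) / (1 - q)) = C\<^sub>D / (1 - q) * dec (k n)" by simp
        also have "\<dots> \<le> C\<^sub>D / (1 - q) * inverse ((real (Suc n))\<^sup>2)"
          using C\<^sub>D_pos q by (intro mult_left_mono dec_k) auto
        finally show "C\<^sub>D * (dec (k n) / (1 - q)) \<le> C\<^sub>D / (1 - q) * inverse ((real (Suc n))\<^sup>2)" .
      qed
      finally show ?thesis .
    qed
    show "summable (\<lambda>n. C\<^sub>D / (1 - q) * inverse ((real (Suc n))\<^sup>2))"
      by (intro summable_mult summable_inverse_Suc_square)
  qed (use C\<^sub>D_pos q in \<open>auto intro!: sum_nonneg\<close>)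
  then show ?thesis by eventually_elim (rule summable_LIMSEQ_zero)
qed

section \<open>Convergence of the normalized distribution function\<close>

definition far :: "nat \<Rightarrow> real \<Rightarrow> real" where "far n = indicator {y. \<bar>y\<bar> > (real n + 1)\<^sup>2}"

lemma far_measurable [measurable]: "far n \<in> borel_measurable borel"
  unfolding far_def by measurable

text \<open>Chebyshev's inequality: at threshold (n + 1)^2 the mean is at most the variance, linear
  in n, divided by (n + 1)^4. The threshold is high enough for summability and, at the logarithmic
  generation \<open>k n\<close>, still negligible against \<open>b n\<close>.\<close>

lemma AE_far: "AE X in Q. (\<lambda>n. A n (far n) X) \<longlonglongrightarrow> 0"
proof -
  let ?g = "\<lambda>n. (\<bar>a\<^sub>2\<bar> + \<bar>C\<^sub>2\<bar>) * inverse ((real (Suc n))\<^sup>2)"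
  have "AE X in Q. summable (\<lambda>n. A n (far n) X)"
  proof (rule AE_summable[where g="?g"])
    fix n
    define s where "s = real n + 1"
    have s: "1 \<le> s" "s > 0" by (auto simp: s_def)
    have "(\<integral>\<^sup>+X. ennreal (A n (far n) X) \<partial>Q)
        \<le> (\<integral>\<^sup>+X. ennreal (1 / (growth n * s ^ 4)) * (\<Sum>u\<in>particles X n. ennreal ((cpos X u)\<^sup>2)) \<partial>Q)"
    proof (rule nn_integral_mono)
      fix X
      have far_le: "far n y \<le> y\<^sup>2 / s ^ 4" for y
      proof (cases "\<bar>y\<bar> > s\<^sup>2")
        case True
        then have "(s\<^sup>2)\<^sup>2 \<le> \<bar>y\<bar>\<^sup>2" by (intro power_mono) auto
        then have "s ^ 4 \<le> y\<^sup>2" by simp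
        then show ?thesis using True s by (simp add: far_def s_def[symmetric])
      qed (use s in \<open>auto simp: far_def s_def\<close>)
      have "A n (far n) X \<le> (\<Sum>u\<in>particles X n. (cpos X u)\<^sup>2 / s ^ 4) / growth n"
        unfolding A_def using growth_pos[of n] by (intro divide_right_mono sum_mono far_le) auto
      also have "\<dots> = 1 / (growth n * s ^ 4) * (\<Sum>u\<in>particles X n. (cpos X u)\<^sup>2)"
        by (simp add: sum_divide_distrib[symmetric] mult.commute)
      finally have "ennreal (A n (far n) X) \<le> ennreal (1 / (growth n * s ^ 4) * (\<Sum>u\<in>particles X n. (cpos X u)\<^sup>2))"
        by (rule ennreal_leI)
      also have "\<dots> = ennreal (1 / (growth n * s ^ 4)) * (\<Sum>u\<in>particles X n. ennreal ((cpos X u)\<^sup>2))"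
        using growth_pos[of n] s by (subst ennreal_mult) (auto simp: sum_ennreal intro!: sum_nonneg)
      finally show "ennreal (A n (far n) X) \<le> \<dots>" .
    qed
    also have "\<dots> = ennreal (1 / (growth n * s ^ 4)) * ennreal (growth n * (\<Sum>i<n. v i))"
      by (subst nn_integral_cmult) (auto intro!: measurable_generation_sum simp: nn_integral_square_sum simp del: sum_ennreal)
    also have "\<dots> = ennreal (1 / (growth n * s ^ 4) * (growth n * (\<Sum>i<n. v i)))"
      using growth_pos[of n] s
      by (intro ennreal_mult[symmetric]) (auto intro!: mult_nonneg_nonneg sum_nonneg L.variance_position_nonneg)
    also have "\<dots> \<le> ennreal (?g n)"
    proof (rule ennreal_leI)
      have "(\<Sum>i<n. v i) \<le> a\<^sub>2 * real n + C\<^sub>2" by (rule variance_upper)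
      also have "\<dots> \<le> \<bar>a\<^sub>2\<bar> * s\<^sup>2 + \<bar>C\<^sub>2\<bar> * s\<^sup>2"
      proof -
        have "s \<le> s\<^sup>2" using s by (simp add: power2_eq_square)
        then have "real n \<le> s\<^sup>2" "1 \<le> s\<^sup>2" using s by (auto simp: s_def)
        then have "\<bar>a\<^sub>2\<bar> * real n \<le> \<bar>a\<^sub>2\<bar> * s\<^sup>2" "\<bar>C\<^sub>2\<bar> * 1 \<le> \<bar>C\<^sub>2\<bar> * s\<^sup>2" by (intro mult_left_mono; simp)+
        moreover have "a\<^sub>2 * real n \<le> \<bar>a\<^sub>2\<bar> * real n" by (intro mult_right_mono) auto
        ultimately show ?thesis by linarith
      qed
      finally have "(\<Sum>i<n. v i) / s ^ 4 \<le> (\<bar>a\<^sub>2\<bar> * s\<^sup>2 + \<bar>C\<^sub>2\<bar> * s\<^sup>2) / s ^ 4"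
        using s by (intro divide_right_mono) auto
      also have "\<dots> = (\<bar>a\<^sub>2\<bar> + \<bar>C\<^sub>2\<bar>) * (s\<^sup>2 / s ^ 4)" by (simp add: algebra_simps add_divide_distrib)
      also have "s\<^sup>2 / s ^ 4 = inverse (s\<^sup>2)" using s by (simp add: power2_eq_square power4_eq_xxxx field_simps)
      finally show "1 / (growth n * s ^ 4) * (growth n * (\<Sum>i<n. v i)) \<le> ?g n"
        using growth_pos[of n] by (simp add: s_def add.commute)
    qed
    finally show "(\<integral>\<^sup>+X. ennreal (A n (far n) X) \<partial>Q) \<le> ennreal (?g n)" .
  next
    show "summable ?g"
      by (intro summable_mult summable_inverse_Suc_square)
  qed (auto simp: far_def intro!: A_nonneg)
  then show ?thesis by eventually_elim (rule summable_LIMSEQ_zero)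
qed

text \<open>\<open>A j (H s n j)\<close> interpolates between the prediction made at generation l
  and the actual count at generation n. By \<open>K_H\<close> each increment is a one-step deviation
  of the kind bounded in \<open>step_bound\<close>.\<close>

lemma telescope_bound:
  assumes "l \<le> n"
  shows "\<bar>A n (indicator {..s}) X - A l (H s n l) X\<bar>
    \<le> (\<Sum>j=l..<n. \<bar>D j (t j) (H s n (Suc j)) X\<bar>) + (\<Sum>j=l..<n. E j X)"
proof -
  have "A n (indicator {..s}) X - A l (H s n l) X = (\<Sum>j=l..<n. A (Suc j) (H s n (Suc j)) X - A j (H s n j) X)"
    using sum_Suc_diff'[OF assms, of "\<lambda>j. A j (H s n j) X"] by (simp add: H_end)
  also have "\<bar>\<dots>\<bar> \<le> (\<Sum>j=l..<n. \<bar>D j (t j) (H s n (Suc j)) X\<bar> + E j X)"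
  proof (intro order.trans[OF sum_abs] sum_mono)
    fix j assume "j \<in> {l..<n}"
    then show "\<bar>A (Suc j) (H s n (Suc j)) X - A j (H s n j) X\<bar> \<le> \<bar>D j (t j) (H s n (Suc j)) X\<bar> + E j X"
      using step_bound[where h="H s n (Suc j)" and j=j and X=X, OF H_measurable H_bounds] K_H[of j n s] by (simp only: atLeastLessThan_iff simp_thms)
  qed
  finally show ?thesis by (simp add: sum.distrib)
qed

text \<open>Quantifying over w inside yields one null set whatever the limit of \<open>W n\<close>
  is. At generation \<open>k n\<close> the prediction for a particle is close to the normal value
  unless the particle is far, and the far ones have vanishing weight.\<close>

theorem AE_cdf_tendsto:
  "AE X in Q. \<forall>w. (\<lambda>n. W n X) \<longlonglongrightarrow> w \<longrightarrow>
    (\<lambda>n. A n (indicator {..b n * x}) X) \<longlonglongrightarrow> cdf std_normal_distribution x * w"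
proof -
  let ?\<Phi> = "cdf std_normal_distribution x"
  have "AE X in Q. (\<lambda>n. \<Sum>j=k n..<n. \<bar>D j (t j) (H (b n * x) n (Suc j)) X\<bar>) \<longlonglongrightarrow> 0"
    by (rule AE_D_sum[where h="\<lambda>n j. H (b n * x) n (Suc j)"]) (rule H_measurable H_bounds)+
  with AE_summable_E AE_far show ?thesis
  proof eventually_elim
    case (elim X)
    show ?case
    proof (intro allI impI)
      fix w assume w: "(\<lambda>n. W n X) \<longlonglongrightarrow> w"
      note summ = elim(1)
      let ?Dn = "\<lambda>n. \<Sum>j=k n..<n. \<bar>D j (t j) (H (b n * x) n (Suc j)) X\<bar>"
      let ?En = "\<lambda>n. \<Sum>j. E (j + k n) X"
      define \<rho> where "\<rho> n = (real (k n) + 1)\<^sup>2 / b n" for n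
      \<comment> \<open>For particles within the threshold the argument of \<open>G n\<close> lies
        between \<open>x - \<rho> n\<close> and \<open>x + \<rho> n\<close>. By monotonicity the
        deviation from the limit is at most the larger of the two end deviations, hence at most
        their sum.\<close>
      define d where "d n = \<bar>G n (x + \<rho> n) - ?\<Phi>\<bar> + \<bar>G n (x + - \<rho> n) - ?\<Phi>\<bar>" for n
      have \<rho>: "\<rho> \<longlonglongrightarrow> 0" using k_square_over_b by (simp add: \<rho>_def[abs_def])
      note shifted = cdf_tendsto_shifted[OF G_mono G_tendsto isCont_cdf_std_normal]
      have "(\<lambda>n. - \<rho> n) \<longlonglongrightarrow> 0" using tendsto_minus[OF \<rho>] by simp
      note shifted[OF \<rho>] shifted[OF this]
      then have "d \<longlonglongrightarrow> \<bar>?\<Phi> - ?\<Phi>\<bar> + \<bar>?\<Phi> - ?\<Phi>\<bar>" unfolding d_def[abs_def] by (intro tendsto_intros)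
      then have d: "d \<longlonglongrightarrow> 0" by simp
      have E0: "?En \<longlonglongrightarrow> 0"
        by (rule filterlim_compose[OF suminf_exist_split2[OF elim(1)] k_at_top])
      have Wk: "(\<lambda>n. W (k n) X) \<longlonglongrightarrow> w" by (rule filterlim_compose[OF w k_at_top])
      have far0: "(\<lambda>n. A (k n) (far (k n)) X) \<longlonglongrightarrow> 0" by (rule filterlim_compose[OF elim(2) k_at_top])
      have "(\<lambda>n. ?Dn n + ?En n + d n * W (k n) X + A (k n) (far (k n)) X) \<longlonglongrightarrow> 0 + 0 + 0 * w + 0"
        by (intro tendsto_intros elim(3) E0 d Wk far0)
      then have bound: "(\<lambda>n. ?Dn n + ?En n + d n * W (k n) X + A (k n) (far (k n)) X) \<longlonglongrightarrow> 0" by simp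
      have "eventually (\<lambda>n. norm (A n (indicator {..b n * x}) X - ?\<Phi> * W (k n) X)
          \<le> ?Dn n + ?En n + d n * W (k n) X + A (k n) (far (k n)) X) sequentially"
        using k_eventually_le b_eventually_pos
      proof eventually_elim
        case (elim n)
        have "(\<Sum>j=k n..<n. E j X) = (\<Sum>j<n - k n. E (j + k n) X)"
          using sum.shift_bounds_nat_ivl[of "\<lambda>j. E j X" 0 "k n" "n - k n"] elim(1)
          by (simp add: lessThan_atLeast0)
        also have "\<dots> \<le> ?En n"
          using E_nonneg by (intro sum_le_suminf summable_ignore_initial_segment summ) auto
        finally have "\<bar>A n (indicator {..b n * x}) X - A (k n) (H (b n * x) n (k n)) X\<bar> \<le> ?Dn n + ?En n"
          using telescope_bound[OF elim(1), of "b n * x" X] by linarith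
        moreover have "\<bar>A (k n) (H (b n * x) n (k n)) X - ?\<Phi> * W (k n) X\<bar>
            \<le> d n * W (k n) X + A (k n) (far (k n)) X"
        proof -
          let ?T = "particles X (k n)"
          have d0: "0 \<le> d n" by (simp add: d_def)
          have point: "\<bar>H (b n * x) n (k n) y - ?\<Phi>\<bar> \<le> d n + far (k n) y" for y
          proof (cases "\<bar>y\<bar> > (real (k n) + 1)\<^sup>2")
            case True
            have "0 \<le> ?\<Phi>" "?\<Phi> \<le> 1"
              using real_dist_normal_dist real_distribution.cdf_bounded_prob
              by (auto simp: cdf_def)
            with True d0 H_bounds[of "b n * x" n "k n" y] show ?thesis by (simp add: far_def)
          next
            case False
            then have "\<bar>y / b n\<bar> \<le> \<rho> n"
              using elim(2) by (simp add: \<rho>_def abs_divide divide_right_mono)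
            then have "G n (x + - \<rho> n) \<le> G n (x - y / b n)" "G n (x - y / b n) \<le> G n (x + \<rho> n)"
            proof -
              from \<open>\<bar>y / b n\<bar> \<le> \<rho> n\<close> have "- \<rho> n \<le> y / b n" "y / b n \<le> \<rho> n" by linarith+
              then show "G n (x + - \<rho> n) \<le> G n (x - y / b n)" "G n (x - y / b n) \<le> G n (x + \<rho> n)"
                by (auto intro!: monoD[OF G_mono])
            qed
            with False show ?thesis
            proof -
              have "far (k n) y = 0" using False by (simp add: far_def)
              then show ?thesis
                using \<open>G n (x + - \<rho> n) \<le> _\<close> \<open>_ \<le> G n (x + \<rho> n)\<close>
                unfolding H_eq_G[OF elim(2)] d_def by linarith
            qed
          qed
          have "A (k n) (H (b n * x) n (k n)) X - ?\<Phi> * W (k n) X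
              = (\<Sum>u\<in>?T. H (b n * x) n (k n) (cpos X u) - ?\<Phi>) / growth (k n)"
            by (simp add: A_def sum_subtractf diff_divide_distrib)
          also have "\<bar>\<dots>\<bar> \<le> (\<Sum>u\<in>?T. d n + far (k n) (cpos X u)) / growth (k n)"
            using growth_pos[of "k n"] point
            by (simp only: abs_divide abs_of_pos) (intro divide_right_mono order.trans[OF sum_abs sum_mono] point less_imp_le[OF growth_pos])
          also have "\<dots> = d n * W (k n) X + A (k n) (far (k n)) X"
            by (simp add: A_def sum.distrib add_divide_distrib mult.commute)
          finally show ?thesis .
        qed
        ultimately show ?case by (simp only: real_norm_def)
      qed
      then have "(\<lambda>n. A n (indicator {..b n * x}) X - ?\<Phi> * W (k n) X) \<longlonglongrightarrow> 0"
        by (rule Lim_null_comparison[OF _ bound])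
      from tendsto_add[OF this tendsto_mult_left[OF Wk, of ?\<Phi>]]
      show "(\<lambda>n. A n (indicator {..b n * x}) X) \<longlonglongrightarrow> ?\<Phi> * w" by simp
    qed
  qed
qed

end

section \<open>Survival\<close>

definition subtree :: "nat list \<Rightarrow> (nat list \<Rightarrow> offspring) \<Rightarrow> nat list \<Rightarrow> offspring" where
  "subtree u X = (\<lambda>w. X (u @ w))"

lemma particles_add:
  "particles X (k + n) = (\<Union>u\<in>particles X k. (\<lambda>w. u @ w) ` particles (subtree u X) n)"
proof (induction n)
  case (Suc n)
  show ?case
  proof (intro set_eqI iffI)
    fix v assume "v \<in> particles X (k + Suc n)"
    then obtain v' i where v: "v = v' @ [i]" "v' \<in> particles X (k + n)" "i < fst (X v')"
      by (auto simp: particles.simps(2))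
    then obtain u w where u: "u \<in> particles X k" "w \<in> particles (subtree u X) n" "v' = u @ w"
      using Suc by auto
    then have "w @ [i] \<in> particles (subtree u X) (Suc n)"
      using v by (auto simp: particles.simps(2) subtree_def)
    moreover have "v = u @ (w @ [i])" using u v by simp
    ultimately show "v \<in> (\<Union>u\<in>particles X k. (\<lambda>w. u @ w) ` particles (subtree u X) (Suc n))"
      using u(1) by blast
  next
    fix v assume "v \<in> (\<Union>u\<in>particles X k. (\<lambda>w. u @ w) ` particles (subtree u X) (Suc n))"
    then obtain u w i where "u \<in> particles X k" "w \<in> particles (subtree u X) n" "i < fst (X (u @ w))" "v = u @ w @ [i]"
      by (auto simp: particles.simps(2) subtree_def)
    moreover from this have "u @ w \<in> particles X (k + n)" using Suc by auto
    ultimately show "v \<in> particles X (k + Suc n)" by (auto simp: particles.simps(2))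
  qed
qed auto

lemma card_subtree_le:
  assumes "u \<in> particles X k"
  shows "card (particles (subtree u X) n) \<le> card (particles X (k + n))"
proof -
  have "card ((\<lambda>w. u @ w) ` particles (subtree u X) n) = card (particles (subtree u X) n)"
    by (rule card_image) (simp add: inj_on_def)
  moreover have "card ((\<lambda>w. u @ w) ` particles (subtree u X) n) \<le> card (particles X (k + n))"
    using assms by (intro card_mono finite_particles) (auto simp: particles_add)
  ultimately show ?thesis by simp
qed

text \<open>This is \<open>W n\<close> made available outside \<open>branching_env\<close>:
  \<open>q\<close> is defined for every environment, including exceptional ones, and
  \<open>null_trees\<close> is also applied to shifted environments.\<close>

definition norm_population :: "(nat \<Rightarrow> offspring measure) \<Rightarrow> nat \<Rightarrow> (nat list \<Rightarrow> offspring) \<Rightarrow> real" where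
  "norm_population \<nu> n X = real (card (particles X n)) / (\<Prod>i<n. mean_number (\<nu> i))"

definition null_trees :: "(nat \<Rightarrow> offspring measure) \<Rightarrow> (nat list \<Rightarrow> offspring) set" where
  "null_trees \<nu> = {X. (\<lambda>n. norm_population \<nu> n X) \<longlonglongrightarrow> 0}"

context branching_env
begin

lemma W_norm_population: "W n X = norm_population \<nu> n X"
  by (simp add: W_eq norm_population_def growth_def m_def)

lemma space_Q [simp]: "space Q = UNIV"
  using sets_eq_imp_space_eq[OF L.sets_offspring] by (auto simp: space_PiM)

lemma null_trees_sets [measurable]: "null_trees \<nu> \<in> sets Q"
proof -
  have "{X \<in> space Q. (\<lambda>n. W n X) \<longlonglongrightarrow> 0} \<in> sets Q"
    by (rule predE[OF pred_tendsto]) measurable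
  then show ?thesis by (simp add: null_trees_def W_norm_population)
qed

lemma shifted_env: "branching_env (\<lambda>j. \<nu> (k + j))"
  by (rule branching_env.intro) (rule offspring_law)

lemma growth_add: "growth (k + n) = growth k * (\<Prod>i<n. mean_number (\<nu> (k + i)))"
  by (induction n) (simp_all add: growth_def m_def)

text \<open>A subtree rooted in generation k has at most as many particles in its generation n as
  the whole tree in generation k + n, and the growth factorizes. So its normalized population is at
  most \<open>growth k * W (n + k) X\<close>.\<close>

lemma null_subtree:
  assumes "X \<in> null_trees \<nu>" and u: "u \<in> particles X k"
  shows "subtree u X \<in> null_trees (\<lambda>j. \<nu> (k + j))"
proof -
  interpret Sh: branching_env "\<lambda>j. \<nu> (k + j)" by (rule shifted_env)
  have "(\<lambda>n. W (n + k) X) \<longlonglongrightarrow> 0"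
    using assms(1) by (intro LIMSEQ_ignore_initial_segment) (simp add: null_trees_def W_norm_population)
  from tendsto_mult_left[OF this, of "growth k"]
  have lim: "(\<lambda>n. growth k * W (n + k) X) \<longlonglongrightarrow> 0" by simp
  have "(\<lambda>n. Sh.W n (subtree u X)) \<longlonglongrightarrow> 0"
  proof (rule tendsto_sandwich[OF _ _ tendsto_const lim])
    show "eventually (\<lambda>n. 0 \<le> Sh.W n (subtree u X)) sequentially" by (simp add: Sh.W_nonneg)
    show "eventually (\<lambda>n. Sh.W n (subtree u X) \<le> growth k * W (n + k) X) sequentially"
    proof (intro always_eventually allI)
      fix n
      have g: "growth (n + k) = growth k * Sh.growth n"
        unfolding Sh.growth_def Sh.m_def using growth_add[of k n] by (simp only: add.commute[of n k])
      have "Sh.W n (subtree u X) \<le> real (card (particles X (k + n))) / Sh.growth n"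
        unfolding Sh.W_eq using card_subtree_le[OF u, of n] Sh.growth_pos[of n]
        by (intro divide_right_mono) auto
      also have "\<dots> = growth k * W (n + k) X"
        unfolding W_eq g using growth_pos[of k] by (simp add: add.commute)
      finally show "Sh.W n (subtree u X) \<le> growth k * W (n + k) X" .
    qed
  qed
  then show ?thesis by (simp add: null_trees_def Sh.W_norm_population)
qed

lemma distr_subtree:
  assumes u: "length u = k"
  shows "distr Q (PiM UNIV (\<lambda>w. \<nu> (k + length w))) (subtree u) = PiM UNIV (\<lambda>w. \<nu> (k + length w))"
  using distr_PiM_reindex[of UNIV "\<lambda>u. \<nu> (length u)" "\<lambda>w. u @ w" UNIV] u prob
  by (simp add: subtree_def[abs_def] inj_on_def restrict_def)

lemma subtree_measurable:
  assumes u: "length u = k"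
  shows "subtree u \<in> Q \<rightarrow>\<^sub>M PiM UNIV (\<lambda>w. \<nu> (k + length w))"
proof (rule measurable_PiM_single')
  show "(\<lambda>X. subtree u X w) \<in> Q \<rightarrow>\<^sub>M \<nu> (k + length w)" for w
    using measurable_component_singleton[of "u @ w" UNIV "\<lambda>u. \<nu> (length u)"] u by (simp add: subtree_def)
qed (auto simp: subtree_def PiE_iff sets_eq_imp_space_eq[OF L.sets_offspring])

text \<open>Distinct words of equal length are not prefixes of each other, so their subtrees use
  disjoint coordinates. The induction redraws the coordinates below the new root u and leaves the
  other subtrees alone.\<close>

lemma nn_integral_subtrees:
  assumes T: "finite T" "\<And>u. u \<in> T \<Longrightarrow> length u = k"
    and B: "B \<in> sets (PiM UNIV (\<lambda>w. \<nu> (k + length w)))"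
  shows "(\<integral>\<^sup>+X. (\<Prod>u\<in>T. indicator B (subtree u X)) \<partial>Q)
    = emeasure (PiM UNIV (\<lambda>w. \<nu> (k + length w))) B ^ card T"
  using T
proof (induction T)
  case empty then show ?case using P.emeasure_space_1 by simp
next
  case (insert u T)
  have len: "length u = k" "\<And>w. w \<in> T \<Longrightarrow> length w = k" using insert.prems by auto
  have m: "(\<lambda>X. indicator B (subtree w X) :: ennreal) \<in> borel_measurable Q" if "length w = k" for w
    using measurable_compose[OF subtree_measurable[OF that], of "indicator B" borel] B by simp
  have mT: "(\<lambda>X. (\<Prod>w\<in>T. indicator B (subtree w X)) :: ennreal) \<in> borel_measurable Q"
    using len by (intro borel_measurable_prod_ennreal m) auto
  let ?J = "range (\<lambda>w. u @ w)"
  have 1: "subtree u (resample ?J X Y) = subtree u Y" for X Y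
    by (simp add: subtree_def resample_def)
  have 2: "subtree w (resample ?J X Y) = subtree w X" if "w \<in> T" for w X Y
  proof -
    have "w @ z \<noteq> u @ z'" for z z'
    proof
      assume "w @ z = u @ z'"
      then have "take k (w @ z) = take k (u @ z')" by (rule arg_cong)
      then show False using that insert.hyps(2) len by simp
    qed
    then have "w @ z \<notin> ?J" for z by blast
    then show ?thesis by (simp add: subtree_def resample_def)
  qed
  have "(\<integral>\<^sup>+X. (\<Prod>w\<in>insert u T. indicator B (subtree w X)) \<partial>Q)
      = (\<integral>\<^sup>+X. indicator B (subtree u X) * (\<Prod>w\<in>T. indicator B (subtree w X)) \<partial>Q)"
    using insert.hyps by simp
  also have "\<dots> = (\<integral>\<^sup>+X. \<integral>\<^sup>+Y. indicator B (subtree u Y) * (\<Prod>w\<in>T. indicator B (subtree w X)) \<partial>Q \<partial>Q)"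
  proof -
    have "(\<lambda>X. indicator B (subtree u X) * (\<Prod>w\<in>T. indicator B (subtree w X)) :: ennreal) \<in> borel_measurable Q"
      by (intro borel_measurable_times_ennreal m mT len(1))
    from nn_integral_resample[OF this, of ?J] show ?thesis
      by (simp only: 1 2 cong: prod.cong)
  qed
  also have "\<dots> = (\<integral>\<^sup>+X. (\<integral>\<^sup>+Y. indicator B (subtree u Y) \<partial>Q) * (\<Prod>w\<in>T. indicator B (subtree w X)) \<partial>Q)"
    by (intro nn_integral_cong nn_integral_multc m len)
  also have "\<dots> = (\<integral>\<^sup>+Y. indicator B (subtree u Y) \<partial>Q) * (\<integral>\<^sup>+X. (\<Prod>w\<in>T. indicator B (subtree w X)) \<partial>Q)"
    by (intro nn_integral_cmult mT)
  also have "(\<integral>\<^sup>+Y. indicator B (subtree u Y) \<partial>Q) = emeasure (PiM UNIV (\<lambda>w. \<nu> (k + length w))) B"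
  proof -
    have "(\<integral>\<^sup>+Y. indicator B (subtree u Y) \<partial>Q)
        = (\<integral>\<^sup>+Z. indicator B Z \<partial>distr Q (PiM UNIV (\<lambda>w. \<nu> (k + length w))) (subtree u))"
      using B by (intro nn_integral_distr[symmetric] subtree_measurable len) auto
    then show ?thesis using B by (simp add: distr_subtree[OF len(1)])
  qed
  finally show ?case using insert.IH[OF len(2)] insert.hyps by simp
qed

lemma card_particles_measurable [measurable]: "(\<lambda>X. card (particles X k)) \<in> Q \<rightarrow>\<^sub>M count_space UNIV"
  by (rule measurable_compose[OF measurable_particles[of "\<lambda>X. X" Q, OF coordinate_measurable]]) simp

lemma null_large_sets: "{X \<in> null_trees \<nu>. M \<le> card (particles X k)} \<in> sets Q"
proof -
  have "null_trees \<nu> \<inter> {X \<in> space Q. M \<le> card (particles X k)} \<in> sets Q" by measurable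
  also have "null_trees \<nu> \<inter> {X \<in> space Q. M \<le> card (particles X k)} = {X \<in> null_trees \<nu>. M \<le> card (particles X k)}"
    by auto
  finally show ?thesis .
qed

text \<open>In a null tree all subtrees rooted in generation k are null. Given the first k
  generations these are independent, at least M in number, and each null with probability at most
  q.\<close>

lemma null_trees_large_generation:
  assumes q: "emeasure (PiM UNIV (\<lambda>w. \<nu> (k + length w))) (null_trees (\<lambda>j. \<nu> (k + j))) \<le> ennreal q" and "0 \<le> q" "q \<le> 1"
  shows "emeasure Q {X \<in> null_trees \<nu>. M \<le> card (particles X k)} \<le> ennreal (q ^ M)"
proof -
  interpret Sh: branching_env "\<lambda>j. \<nu> (k + j)" by (rule shifted_env)
  let ?B = "null_trees (\<lambda>j. \<nu> (k + j))"
  have B [measurable]: "?B \<in> sets Sh.Q" by (rule Sh.null_trees_sets)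
  define g :: "(nat list \<Rightarrow> offspring) \<Rightarrow> ennreal" where
    "g X = (\<Prod>u\<in>particles X k. indicator ?B (subtree u X))" for X
  define f :: "(nat list \<Rightarrow> offspring) \<Rightarrow> ennreal" where
    "f X = indicator {X \<in> space Q. M \<le> card (particles X k)} X * g X" for X
  have f_meas: "f \<in> borel_measurable Q"
  proof -
    \<comment> \<open>\<open>subtree_measurable\<close> is about words of length k. The guard always
      holds for an actual generation, but it lets the countable case split run over all finite sets
      T.\<close>
    have "(\<lambda>X. if \<forall>u\<in>T. length u = k then \<Prod>u\<in>T. indicator ?B (subtree u X) else (0::ennreal)) \<in> borel_measurable Q" for T
    proof (cases "\<forall>u\<in>T. length u = k")
      case True
      have "(\<lambda>X. indicator ?B (subtree u X) :: ennreal) \<in> borel_measurable Q" if "u \<in> T" for u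
        using True that measurable_compose[OF subtree_measurable[of u k], of "indicator ?B" borel] B by simp
      with True show ?thesis by (simp add: borel_measurable_prod_ennreal)
    next
      case False
      then show ?thesis by (simp only: if_False borel_measurable_const)
    qed
    note measurable_compose_countable'[where f="\<lambda>T X. if \<forall>u\<in>T. length u = k then \<Prod>u\<in>T. indicator ?B (subtree u X) else (0::ennreal)",
        OF this measurable_particles[of "\<lambda>X. X" Q k, OF coordinate_measurable] countable_finite_lists]
    then have [measurable]: "g \<in> borel_measurable Q"
      by (simp add: length_particles g_def[abs_def])
    show ?thesis unfolding f_def[abs_def] by measurable
  qed
  have "emeasure Q {X \<in> null_trees \<nu>. M \<le> card (particles X k)}
      = (\<integral>\<^sup>+X. indicator {X \<in> null_trees \<nu>. M \<le> card (particles X k)} X \<partial>Q)"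
    by (rule nn_integral_indicator[OF null_large_sets, symmetric])
  also have "\<dots> \<le> (\<integral>\<^sup>+X. f X \<partial>Q)"
  proof (rule nn_integral_mono)
    fix X
    have "f X = 1" if "X \<in> null_trees \<nu>" "M \<le> card (particles X k)"
      using that null_subtree[OF that(1), of _ k] by (simp add: f_def g_def)
    then show "indicator {X \<in> null_trees \<nu>. M \<le> card (particles X k)} X \<le> f X"
      by (simp add: indicator_def)
  qed
  also have "\<dots> = (\<integral>\<^sup>+X. \<integral>\<^sup>+Y. f (resample (J k) X Y) \<partial>Q \<partial>Q)"
    by (rule nn_integral_resample[OF f_meas])
  also have "\<dots> \<le> (\<integral>\<^sup>+X. ennreal (q ^ M) \<partial>Q)"
  proof (rule nn_integral_mono)
    fix X
    have sub: "subtree u (resample (J k) X Y) = subtree u Y" if "u \<in> particles X k" for u Y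
      using length_particles[OF that] by (simp add: subtree_def resample_def J_def)
    show "(\<integral>\<^sup>+Y. f (resample (J k) X Y) \<partial>Q) \<le> ennreal (q ^ M)"
    proof (cases "M \<le> card (particles X k)")
      case True
      then have "f (resample (J k) X Y) = (\<Prod>u\<in>particles X k. indicator ?B (subtree u Y))" for Y
        by (simp add: f_def g_def sub cong: prod.cong)
      then have "(\<integral>\<^sup>+Y. f (resample (J k) X Y) \<partial>Q) = (\<integral>\<^sup>+Y. (\<Prod>u\<in>particles X k. indicator ?B (subtree u Y)) \<partial>Q)"
        by (simp only:)
      also have "\<dots> = emeasure Sh.Q ?B ^ card (particles X k)"
        by (rule nn_integral_subtrees[OF finite_particles length_particles B])
      also have "\<dots> \<le> ennreal q ^ card (particles X k)" by (intro power_mono q) auto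
      also have "\<dots> = ennreal (q ^ card (particles X k))" using \<open>0 \<le> q\<close> by (rule ennreal_power)
      also have "\<dots> \<le> ennreal (q ^ M)" using assms True by (intro ennreal_leI power_decreasing) auto
      finally show ?thesis .
    qed (simp add: f_def)
  qed
  also have "\<dots> = ennreal (q ^ M)" using P.emeasure_space_1 by simp
  finally show ?thesis .
qed

text \<open>Explosion puts a tree, for every M, into some \<open>E M l\<close>. The bound q^M on the
  probability of \<open>E M l\<close> is free of l, since a favourable k exists beyond every l;
  hence it survives the increasing union over l and vanishes as M grows.\<close>

lemma AE_not_null_on_explosion:
  assumes q: "0 \<le> q" "q < 1"
    and inf: "\<And>l. \<exists>k\<ge>l. emeasure (PiM UNIV (\<lambda>w. \<nu> (k + length w))) (null_trees (\<lambda>j. \<nu> (k + j))) \<le> ennreal q"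
  shows "AE X in Q. filterlim (\<lambda>n. real (card (particles X n))) at_top sequentially \<longrightarrow> X \<notin> null_trees \<nu>"
proof -
  define E where "E M l = {X \<in> null_trees \<nu>. \<forall>k\<ge>l. M \<le> card (particles X k)}" for M l :: nat
  have E_sets [measurable]: "E M l \<in> sets Q" for M l
  proof -
    have "null_trees \<nu> \<inter> {X \<in> space Q. \<forall>k\<ge>l. M \<le> card (particles X k)} \<in> sets Q" by measurable
    also have "null_trees \<nu> \<inter> {X \<in> space Q. \<forall>k\<ge>l. M \<le> card (particles X k)} = E M l"
      by (auto simp: E_def)
    finally show ?thesis .
  qed
  have E_le: "emeasure Q (E M l) \<le> ennreal (q ^ M)" for M l
  proof -
    obtain k where k: "k \<ge> l" "emeasure (PiM UNIV (\<lambda>w. \<nu> (k + length w))) (null_trees (\<lambda>j. \<nu> (k + j))) \<le> ennreal q"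
      using inf by blast
    have "emeasure Q (E M l) \<le> emeasure Q {X \<in> null_trees \<nu>. M \<le> card (particles X k)}"
      by (rule emeasure_mono[OF _ null_large_sets]) (use k in \<open>auto simp: E_def\<close>)
    also have "\<dots> \<le> ennreal (q ^ M)" using k q by (intro null_trees_large_generation) auto
    finally show ?thesis .
  qed
  have U: "emeasure Q (\<Union>l. E M l) \<le> ennreal (q ^ M)" for M
  proof -
    have "incseq (E M)" unfolding incseq_def E_def by fastforce
    then have "emeasure Q (\<Union>l. E M l) = (SUP l. emeasure Q (E M l))"
      by (intro SUP_emeasure_incseq[symmetric]) auto
    then show ?thesis using E_le by (auto intro!: SUP_least)
  qed
  define Z where "Z = (\<Inter>M. \<Union>l. E M l)"
  have Z [measurable]: "Z \<in> sets Q" unfolding Z_def by measurable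
  have Z_le: "emeasure Q Z \<le> ennreal (q ^ M)" for M
    by (rule order.trans[OF emeasure_mono U[of M]]) (auto simp: Z_def)
  have "(\<lambda>M. ennreal (q ^ M)) \<longlonglongrightarrow> ennreal 0"
    using q by (intro tendsto_ennrealI LIMSEQ_power_zero) auto
  then have "emeasure Q Z \<le> ennreal 0" by (rule LIMSEQ_le_const) (use Z_le in auto)
  then have "Z \<in> null_sets Q" by auto
  then have "AE X in Q. X \<notin> Z" by (rule AE_not_in)
  then show ?thesis
  proof eventually_elim
    case (elim X)
    show ?case
    proof (intro impI notI)
      assume lim: "filterlim (\<lambda>n. real (card (particles X n))) at_top sequentially" and null: "X \<in> null_trees \<nu>"
      have "\<exists>l. X \<in> E M l" for M
      proof -
        have "eventually (\<lambda>n. real M \<le> real (card (particles X n))) sequentially"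
          using lim unfolding filterlim_at_top by blast
        then show ?thesis using null by (auto simp: E_def eventually_sequentially)
      qed
      then show False using elim by (auto simp: Z_def)
    qed
  qed
qed

end

section \<open>The random environment\<close>

lemma measurable_kernel_integral:
  fixes f :: "'a \<Rightarrow> 'b \<Rightarrow> real"
  assumes f [measurable]: "(\<lambda>p. f (fst p) (snd p)) \<in> borel_measurable (M \<Otimes>\<^sub>M N)"
    and L: "L \<in> M \<rightarrow>\<^sub>M subprob_algebra N"
  shows "(\<lambda>x. \<integral>y. f x y \<partial>L x) \<in> borel_measurable M"
proof -
  have nn: "(\<lambda>x. \<integral>\<^sup>+y. g (f x y) \<partial>L x) \<in> borel_measurable M" if [measurable]: "g \<in> borel_measurable borel" for g :: "real \<Rightarrow> ennreal"
    by (rule nn_integral_measurable_subprob_algebra2[OF _ L]) (simp add: split_beta')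
  have fx: "f x \<in> borel_measurable (L x)" if "x \<in> space M" for x
    using measurable_compose[OF measurable_Pair1'[OF that] f] sets_kernel[OF L that] by (simp cong: measurable_cong_sets)
  \<comment> \<open>The Bochner integral is 0 where the integrand is not integrable, so it becomes a
    case distinction between nonnegative integrals, each measurable in x.\<close>
  have eq: "(\<integral>y. f x y \<partial>L x) = (if (\<integral>\<^sup>+y. ennreal (norm (f x y)) \<partial>L x) < \<infinity>
      then enn2real (\<integral>\<^sup>+y. ennreal (f x y) \<partial>L x) - enn2real (\<integral>\<^sup>+y. ennreal (- f x y) \<partial>L x) else 0)"
    if "x \<in> space M" for x
    using fx[OF that] by (auto simp: integrable_iff_bounded real_lebesgue_integral_def not_integrable_integral_eq)
  show ?thesis
    using nn[of "\<lambda>y. ennreal (norm y)"] nn[of ennreal] nn[of "\<lambda>y. ennreal (- y)"]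
    by (subst measurable_cong[OF eq]) auto
qed

lemma measurable_offspring_sum_kernel:
  fixes h :: "'a \<Rightarrow> real \<Rightarrow> real"
  assumes "(\<lambda>p. h (fst p) (snd p)) \<in> borel_measurable (M \<Otimes>\<^sub>M borel)"
  shows "(\<lambda>p. offspring_sum (h (fst p)) (snd p)) \<in> borel_measurable (M \<Otimes>\<^sub>M offspring_algebra)"
  unfolding offspring_sum_def
proof (rule measurable_random_sum)
  show "(\<lambda>p. fst (snd p)) \<in> M \<Otimes>\<^sub>M offspring_algebra \<rightarrow>\<^sub>M count_space UNIV"
    by (rule measurable_compose[OF measurable_snd measurable_offspring(1)])
  have "(\<lambda>p. (fst p, snd (snd p) i)) \<in> M \<Otimes>\<^sub>M offspring_algebra \<rightarrow>\<^sub>M M \<Otimes>\<^sub>M borel" for i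
    by (intro measurable_Pair measurable_fst measurable_compose[OF measurable_snd measurable_offspring(2)])
  from measurable_compose[OF this assms]
  show "(\<lambda>p. h (fst p) (snd (snd p) i)) \<in> borel_measurable (M \<Otimes>\<^sub>M offspring_algebra)" for i by simp
qed

abbreviation (input) offspring_laws :: "offspring measure measure" where
  "offspring_laws \<equiv> prob_algebra offspring_algebra"

lemma id_kernel: "(\<lambda>\<nu>. \<nu>) \<in> offspring_laws \<rightarrow>\<^sub>M subprob_algebra offspring_algebra"
  by (rule measurable_prob_algebraD) simp

lemma snd_real_fst: "(\<lambda>p. real (fst (snd p))) \<in> borel_measurable (M \<Otimes>\<^sub>M offspring_algebra)"
  by (rule measurable_compose[OF measurable_snd measurable_real_fst])

lemma mean_number_measurable [measurable]: "mean_number \<in> borel_measurable offspring_laws"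
  unfolding mean_number_def[abs_def]
  by (rule measurable_kernel_integral[OF _ id_kernel]) (rule snd_real_fst)

lemma mean_position_measurable [measurable]: "mean_position \<in> borel_measurable offspring_laws"
  unfolding mean_position_def[abs_def]
  by (intro borel_measurable_times borel_measurable_divide borel_measurable_const mean_number_measurable
    measurable_kernel_integral[OF _ id_kernel] measurable_offspring_sum_kernel) simp

lemma variance_position_measurable [measurable]: "variance_position \<in> borel_measurable offspring_laws"
  unfolding variance_position_def[abs_def]
proof (intro borel_measurable_times borel_measurable_divide borel_measurable_const mean_number_measurable
    measurable_kernel_integral[OF _ id_kernel] measurable_offspring_sum_kernel)
  show "(\<lambda>p. (snd p - mean_position (fst p))\<^sup>2) \<in> borel_measurable (offspring_laws \<Otimes>\<^sub>M borel)"
    by measurable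
qed

text \<open>The truncated second moment of \<open>step_law\<close>, written as a nonnegative
  integral over the offspring law. In this form measurability in \<nu> is immediate for every law;
  \<open>tail_variance_eq\<close> identifies the value under \<open>offspring_law\<close>.\<close>

definition tail_variance :: "real \<Rightarrow> offspring measure \<Rightarrow> ennreal" where
  "tail_variance M \<nu> = (\<integral>\<^sup>+z. ennreal (1 / mean_number \<nu> *
     offspring_sum (\<lambda>y. (y - mean_position \<nu>)\<^sup>2 * indicator {y. \<bar>y\<bar> > M} (y - mean_position \<nu>)) z) \<partial>\<nu>)"

lemma tail_variance_measurable [measurable]: "tail_variance M \<in> borel_measurable offspring_laws"
  unfolding tail_variance_def[abs_def]
proof (rule nn_integral_measurable_subprob_algebra2[OF _ id_kernel])
  have [measurable]: "(\<lambda>p. offspring_sum (\<lambda>y. (y - mean_position (fst p))\<^sup>2 * indicator {y. \<bar>y\<bar> > M} (y - mean_position (fst p))) (snd p))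
      \<in> borel_measurable (offspring_laws \<Otimes>\<^sub>M offspring_algebra)"
    by (rule measurable_offspring_sum_kernel) measurable
  show "(\<lambda>(\<nu>, z). ennreal (1 / mean_number \<nu> * offspring_sum (\<lambda>y. (y - mean_position \<nu>)\<^sup>2 * indicator {y. \<bar>y\<bar> > M} (y - mean_position \<nu>)) z))
      \<in> borel_measurable (offspring_laws \<Otimes>\<^sub>M offspring_algebra)"
    unfolding split_beta' by measurable
qed

definition tail_number :: "real \<Rightarrow> offspring measure \<Rightarrow> ennreal" where
  "tail_number t \<nu> = (\<integral>\<^sup>+z. ennreal (if real (fst z) \<le> t then 0 else real (fst z) / mean_number \<nu>) \<partial>\<nu>)"

lemma tail_number_measurable [measurable]: "tail_number t \<in> borel_measurable offspring_laws"
  unfolding tail_number_def[abs_def]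
proof (rule nn_integral_measurable_subprob_algebra2[OF _ id_kernel])
  note [measurable] = snd_real_fst[of offspring_laws]
  show "(\<lambda>(\<nu>, z). ennreal (if real (fst z) \<le> t then 0 else real (fst z) / mean_number \<nu>))
      \<in> borel_measurable (offspring_laws \<Otimes>\<^sub>M offspring_algebra)"
    unfolding split_beta' by measurable
qed

lemma (in offspring_law) tail_variance_eq:
  "tail_variance M \<nu> = ennreal (\<integral>y. y\<^sup>2 * indicator {y. \<bar>y\<bar> > M} y \<partial>step_law \<nu>)"
proof -
  have i: "integrable (step_law \<nu>) (\<lambda>y. y\<^sup>2 * indicator {y. \<bar>y\<bar> > M} y)"
    by (rule Bochner_Integration.integrable_bound[OF step_law_square(1)]) (auto simp: indicator_def)
  have "ennreal (\<integral>y. y\<^sup>2 * indicator {y. \<bar>y\<bar> > M} y \<partial>step_law \<nu>)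
      = (\<integral>\<^sup>+y. ennreal (y\<^sup>2 * indicator {y. \<bar>y\<bar> > M} y) \<partial>step_law \<nu>)"
    using i by (intro nn_integral_eq_integral[symmetric]) auto
  also have "\<dots> = (\<integral>\<^sup>+z. ennreal (1 / mean_number \<nu>) * (\<Sum>i<fst z. ennreal ((snd z i - mean_position \<nu>)\<^sup>2 *
      indicator {y. \<bar>y\<bar> > M} (snd z i - mean_position \<nu>))) \<partial>\<nu>)"
    by (rule nn_integral_step_law[OF sets_offspring]) measurable
  also have "\<dots> = tail_variance M \<nu>"
    unfolding tail_variance_def
  proof (intro nn_integral_cong)
    fix z :: offspring
    let ?h = "\<lambda>y. (y - mean_position \<nu>)\<^sup>2 * indicator {y. \<bar>y\<bar> > M} (y - mean_position \<nu>)"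
    have "ennreal (1 / mean_number \<nu> * offspring_sum ?h z) = ennreal (1 / mean_number \<nu>) * ennreal (offspring_sum ?h z)"
      using number_pos by (intro ennreal_mult offspring_sum_nonneg) auto
    also have "ennreal (offspring_sum ?h z) = (\<Sum>i<fst z. ennreal (?h (snd z i)))"
      by (rule ennreal_offspring_sum) simp
    finally show "ennreal (1 / mean_number \<nu>) * (\<Sum>i<fst z. ennreal (?h (snd z i))) = ennreal (1 / mean_number \<nu> * offspring_sum ?h z)" ..
  qed
  finally show ?thesis ..
qed

section \<open>Annealed and quenched statements\<close>

locale random_env =
  fixes \<Theta> :: "'e measure" and \<tau> :: "(nat \<Rightarrow> 'e) measure" and \<eta> :: "'e \<Rightarrow> offspring measure"
  assumes law: "stationary_ergodic_law \<Theta> \<tau>"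
    and \<eta>: "\<eta> \<in> \<Theta> \<rightarrow>\<^sub>M offspring_laws"
begin

abbreviation trees :: "(nat list \<Rightarrow> offspring) measure" where
  "trees \<equiv> \<Pi>\<^sub>M u\<in>UNIV. offspring_algebra"

lemma sets_\<tau>: "sets \<tau> = sets (\<Pi>\<^sub>M n\<in>UNIV. \<Theta>)"
  using law by (simp add: stationary_ergodic_law_def)

lemma env_coordinate: "(\<lambda>\<xi>. \<xi> n) \<in> \<tau> \<rightarrow>\<^sub>M \<Theta>"
  using measurable_cong_sets[OF sets_\<tau> refl, of \<Theta>] by (simp add: measurable_component_singleton)

lemma shift_pow: "(shift ^^ n) \<xi> = (\<lambda>i. \<xi> (n + i))"
  by (induction n) (auto simp: shift_def)

sublocale ergodic_map \<tau> shift
proof -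
  have "shift \<in> \<tau> \<rightarrow>\<^sub>M (\<Pi>\<^sub>M n\<in>UNIV. \<Theta>)"
  proof (rule measurable_PiM_single')
    show "(\<lambda>\<xi>. shift \<xi> n) \<in> \<tau> \<rightarrow>\<^sub>M \<Theta>" for n
      unfolding shift_def by (rule env_coordinate)
    show "shift \<in> space \<tau> \<rightarrow> (\<Pi>\<^sub>E i\<in>UNIV. space \<Theta>)"
      using measurable_space[OF env_coordinate] by (auto simp: shift_def)
  qed
  then have "shift \<in> \<tau> \<rightarrow>\<^sub>M \<tau>" using measurable_cong_sets[OF refl sets_\<tau>, of \<tau>] by simp
  then show "ergodic_map \<tau> shift"
    using law by (auto simp: stationary_ergodic_law_def ergodic_map_def ergodic_map_axioms_def)
qed

lemma env_law: "(\<lambda>\<xi>. \<eta> (\<xi> n)) \<in> \<tau> \<rightarrow>\<^sub>M offspring_laws"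
  by (rule measurable_compose[OF env_coordinate \<eta>])

lemma env_prob: "\<xi> \<in> space \<tau> \<Longrightarrow> prob_space (\<eta> (\<xi> n))"
  and env_sets: "\<xi> \<in> space \<tau> \<Longrightarrow> sets (\<eta> (\<xi> n)) = sets offspring_algebra"
  using measurable_space[OF env_law] by (auto simp: space_prob_algebra)

lemma quenched_measurable: "quenched \<eta> \<in> \<tau> \<rightarrow>\<^sub>M prob_algebra trees"
  by (rule measurable_quenched[OF sets_\<tau> \<eta>])

lemma quenched_prob: "\<xi> \<in> space \<tau> \<Longrightarrow> prob_space (quenched \<eta> \<xi>)"
  and quenched_sets: "\<xi> \<in> space \<tau> \<Longrightarrow> sets (quenched \<eta> \<xi>) = sets trees"
  using measurable_space[OF quenched_measurable] by (auto simp: space_prob_algebra)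

lemma joint_kernel:
  "(\<lambda>\<xi>. distr (quenched \<eta> \<xi>) (\<tau> \<Otimes>\<^sub>M trees) (Pair \<xi>)) \<in> \<tau> \<rightarrow>\<^sub>M subprob_algebra (\<tau> \<Otimes>\<^sub>M trees)"
  by (rule measurable_prob_algebraD[OF measurable_distr_prob_space2[OF quenched_measurable]]) simp

lemma Pair_measurable: "\<xi> \<in> space \<tau> \<Longrightarrow> Pair \<xi> \<in> quenched \<eta> \<xi> \<rightarrow>\<^sub>M \<tau> \<Otimes>\<^sub>M trees"
  using measurable_Pair1'[of \<xi> \<tau> trees] measurable_cong_sets[OF quenched_sets refl] by blast

lemma nn_integral_annealed:
  assumes [measurable]: "f \<in> borel_measurable (\<tau> \<Otimes>\<^sub>M trees)"
  shows "(\<integral>\<^sup>+p. f p \<partial>annealed \<eta> \<tau>) = (\<integral>\<^sup>+\<xi>. \<integral>\<^sup>+X. f (\<xi>, X) \<partial>quenched \<eta> \<xi> \<partial>\<tau>)"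
  unfolding annealed_def nn_integral_bind[OF assms joint_kernel]
  by (intro nn_integral_cong nn_integral_distr Pair_measurable) auto

lemma AE_annealed_iff:
  assumes P: "Measurable.pred (\<tau> \<Otimes>\<^sub>M trees) P"
  shows "(AE p in annealed \<eta> \<tau>. P p) \<longleftrightarrow> (AE \<xi> in \<tau>. AE X in quenched \<eta> \<xi>. P (\<xi>, X))"
  unfolding annealed_def AE_bind[OF joint_kernel P]
proof (intro AE_cong)
  fix \<xi> assume \<xi>: "\<xi> \<in> space \<tau>"
  show "(AE p in distr (quenched \<eta> \<xi>) (\<tau> \<Otimes>\<^sub>M trees) (Pair \<xi>). P p) \<longleftrightarrow> (AE X in quenched \<eta> \<xi>. P (\<xi>, X))"
    using P by (subst AE_distr_iff[OF Pair_measurable[OF \<xi>]]) (auto simp: pred_def)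
qed

lemma sets_annealed: "sets (annealed \<eta> \<tau>) = sets (\<tau> \<Otimes>\<^sub>M trees)"
  by (rule prob_space_annealed(2)[OF law \<eta>])

text \<open>P is arbitrary here: its exceptional set is enclosed in a measurable null set, to which
  \<open>AE_annealed_iff\<close> applies.\<close>

lemma AE_annealedD:
  assumes "AE p in annealed \<eta> \<tau>. P p"
  shows "AE \<xi> in \<tau>. AE X in quenched \<eta> \<xi>. P (\<xi>, X)"
proof -
  from AE_E[OF assms] obtain N where N: "{p \<in> space (annealed \<eta> \<tau>). \<not> P p} \<subseteq> N" "emeasure (annealed \<eta> \<tau>) N = 0" "N \<in> sets (annealed \<eta> \<tau>)"
    by blast
  have "AE p in annealed \<eta> \<tau>. p \<notin> N" using N by (intro AE_not_in) auto
  moreover have "Measurable.pred (\<tau> \<Otimes>\<^sub>M trees) (\<lambda>p. p \<notin> N)"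
    using N(3) by (simp add: sets_annealed)
  ultimately have "AE \<xi> in \<tau>. AE X in quenched \<eta> \<xi>. (\<xi>, X) \<notin> N" by (simp add: AE_annealed_iff)
  then show ?thesis using AE_space
  proof eventually_elim
    case (elim \<xi>)
    have sp: "(\<xi>, X) \<in> space (annealed \<eta> \<tau>)" if "X \<in> space (quenched \<eta> \<xi>)" for X
      using measurable_space[OF Pair_measurable[OF elim(2)] that] by (simp add: sets_eq_imp_space_eq[OF sets_annealed])
    from elim(1) AE_space[of "quenched \<eta> \<xi>"] show ?case
    proof eventually_elim
      case (elim X)
      then show ?case using N(1) sp by blast
    qed
  qed
qed

lemma AE_annealed_envD:
  assumes "AE (\<xi>, X) in annealed \<eta> \<tau>. P \<xi>"
  shows "AE \<xi> in \<tau>. P \<xi>"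
  using AE_annealedD[OF assms] AE_space
proof eventually_elim
  case (elim \<xi>)
  interpret Qp: prob_space "quenched \<eta> \<xi>" using elim(2) by (rule quenched_prob)
  show ?case using elim(1) by simp
qed

lemma distr_annealed: "distr (annealed \<eta> \<tau>) \<tau> fst = \<tau>"
proof (rule measure_eqI)
  fix S assume "S \<in> sets (distr (annealed \<eta> \<tau>) \<tau> fst)"
  then have S [measurable]: "S \<in> sets \<tau>" by simp
  have f: "fst \<in> annealed \<eta> \<tau> \<rightarrow>\<^sub>M \<tau>" using measurable_cong_sets[OF sets_annealed refl, of \<tau>] by simp
  have "emeasure (distr (annealed \<eta> \<tau>) \<tau> fst) S = (\<integral>\<^sup>+\<xi>. indicator S \<xi> \<partial>distr (annealed \<eta> \<tau>) \<tau> fst)"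
    using S by simp
  also have "\<dots> = (\<integral>\<^sup>+p. indicator S (fst p) \<partial>annealed \<eta> \<tau>)"
    by (rule nn_integral_distr[OF f]) measurable
  also have "\<dots> = (\<integral>\<^sup>+\<xi>. \<integral>\<^sup>+X. indicator S \<xi> \<partial>quenched \<eta> \<xi> \<partial>\<tau>)"
    by (subst nn_integral_annealed) auto
  also have "\<dots> = (\<integral>\<^sup>+\<xi>. indicator S \<xi> \<partial>\<tau>)"
    by (intro nn_integral_cong) (simp add: prob_space.emeasure_space_1[OF quenched_prob])
  finally show "emeasure (distr (annealed \<eta> \<tau>) \<tau> fst) S = emeasure \<tau> S" using S by simp
qed simp

lemma annealed_env_integral:
  fixes g :: "(nat \<Rightarrow> 'e) \<Rightarrow> real"
  assumes [measurable]: "g \<in> borel_measurable \<tau>"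
  shows "integrable (annealed \<eta> \<tau>) (\<lambda>(\<xi>, X). g \<xi>) \<longleftrightarrow> integrable \<tau> g"
    and "(\<integral>(\<xi>, X). g \<xi> \<partial>annealed \<eta> \<tau>) = (\<integral>\<xi>. g \<xi> \<partial>\<tau>)"
proof -
  have f: "fst \<in> annealed \<eta> \<tau> \<rightarrow>\<^sub>M \<tau>" using measurable_cong_sets[OF sets_annealed refl, of \<tau>] by simp
  show "integrable (annealed \<eta> \<tau>) (\<lambda>(\<xi>, X). g \<xi>) \<longleftrightarrow> integrable \<tau> g"
    using integrable_distr_eq[OF f assms] by (simp add: distr_annealed split_beta')
  show "(\<integral>(\<xi>, X). g \<xi> \<partial>annealed \<eta> \<tau>) = (\<integral>\<xi>. g \<xi> \<partial>\<tau>)"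
    using integral_distr[OF f assms] by (simp add: distr_annealed split_beta')
qed

lemma env_statistic_measurable:
  assumes "g \<in> borel_measurable offspring_laws"
  shows "(\<lambda>\<xi>. g (\<eta> (\<xi> n))) \<in> borel_measurable \<tau>"
  by (rule measurable_compose[OF env_law assms])

text \<open>The quenched probability that W = 0. At \<open>(shift ^^ k) \<xi>\<close> it is the
  probability that a subtree rooted in generation k is null.\<close>

definition q :: "(nat \<Rightarrow> 'e) \<Rightarrow> ennreal" where
  "q \<xi> = emeasure (quenched \<eta> \<xi>) (null_trees (\<lambda>j. \<eta> (\<xi> j)))"

lemma tree_coordinate: "(\<lambda>p. snd p u) \<in> \<tau> \<Otimes>\<^sub>M trees \<rightarrow>\<^sub>M offspring_algebra"
  by (rule measurable_compose[OF measurable_snd measurable_component_singleton]) simp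

lemma card_particles_joint: "(\<lambda>p. card (particles (snd p) n)) \<in> \<tau> \<Otimes>\<^sub>M trees \<rightarrow>\<^sub>M count_space UNIV"
  by (rule measurable_compose[OF measurable_particles[of snd, OF tree_coordinate]]) simp

lemma null_trees_joint: "Measurable.pred (\<tau> \<Otimes>\<^sub>M trees) (\<lambda>p. snd p \<in> null_trees (\<lambda>j. \<eta> (fst p j)))"
proof -
  note [measurable] = card_particles_joint
    measurable_compose[OF measurable_fst env_statistic_measurable[OF mean_number_measurable]]
  have "(\<lambda>p. norm_population (\<lambda>j. \<eta> (fst p j)) n (snd p)) \<in> borel_measurable (\<tau> \<Otimes>\<^sub>M trees)" for n
    unfolding norm_population_def by measurable
  from pred_tendsto[OF this] show ?thesis unfolding null_trees_def by simp
qed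

lemma q_measurable [measurable]: "q \<in> borel_measurable \<tau>"
proof -
  note [measurable] = null_trees_joint
  have "(\<lambda>\<xi>. \<integral>\<^sup>+X. indicator (null_trees (\<lambda>j. \<eta> (\<xi> j))) X \<partial>quenched \<eta> \<xi>) \<in> borel_measurable \<tau>"
  proof (rule nn_integral_measurable_subprob_algebra2[OF _ measurable_prob_algebraD[OF quenched_measurable]])
    have "(\<lambda>p. if snd p \<in> null_trees (\<lambda>j. \<eta> (fst p j)) then 1 else 0 :: ennreal) \<in> borel_measurable (\<tau> \<Otimes>\<^sub>M trees)"
      by measurable
    then show "(\<lambda>(\<xi>, X). indicator (null_trees (\<lambda>j. \<eta> (\<xi> j))) X :: ennreal) \<in> borel_measurable (\<tau> \<Otimes>\<^sub>M trees)"
      by (simp add: split_beta' indicator_def of_bool_def)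
  qed
  moreover have "(\<integral>\<^sup>+X. indicator (null_trees (\<lambda>j. \<eta> (\<xi> j))) X \<partial>quenched \<eta> \<xi>) = q \<xi>" if \<xi>: "\<xi> \<in> space \<tau>" for \<xi>
  proof -
    have "{X \<in> space (quenched \<eta> \<xi>). X \<in> null_trees (\<lambda>j. \<eta> (\<xi> j))} \<in> sets (quenched \<eta> \<xi>)"
      using measurable_compose[OF Pair_measurable[OF \<xi>] null_trees_joint] by (simp add: pred_def)
    moreover have "space (quenched \<eta> \<xi>) = UNIV"
      using sets_eq_imp_space_eq[OF quenched_sets[OF \<xi>]] by (simp add: space_PiM)
    ultimately show ?thesis unfolding q_def by simp
  qed
  ultimately show ?thesis by (simp cong: measurable_cong)
qed

end

section \<open>Almost sure properties of the environment\<close>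

locale random_env_moments = random_env +
  assumes offspring_laws: "AE \<xi> in \<tau>. \<forall>n. offspring_law (\<eta> (\<xi> n))"
    and ln_integrable: "integrable \<tau> (\<lambda>\<xi>. ln (mean_number (\<eta> (\<xi> 0))))"
    and ln_pos: "0 < (\<integral>\<xi>. ln (mean_number (\<eta> (\<xi> 0))) \<partial>\<tau>)"
    and NlogN: "(\<integral>\<^sup>+\<xi>. \<integral>\<^sup>+z. ennreal (real (fst z) / mean_number (\<eta> (\<xi> 0)) * log_plus (real (fst z))) \<partial>\<eta> (\<xi> 0) \<partial>\<tau>) < \<infinity>"
    and var_integrable: "integrable \<tau> (\<lambda>\<xi>. variance_position (\<eta> (\<xi> 0)))"
    and var_pos: "0 < (\<integral>\<xi>. variance_position (\<eta> (\<xi> 0)) \<partial>\<tau>)"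
begin

text \<open>Half the mean of log \<open>m\<^sub>0\<close>: positive, and strictly below the mean, as
  \<open>ergodic_sums_lower\<close> requires.\<close>

definition c :: real where "c = (\<integral>\<xi>. ln (mean_number (\<eta> (\<xi> 0))) \<partial>\<tau>) / 2"

definition v\<^sub>0 :: real where "v\<^sub>0 = (\<integral>\<xi>. variance_position (\<eta> (\<xi> 0)) \<partial>\<tau>)"

lemma c_pos: "0 < c" using ln_pos by (simp add: c_def)

lemma AE_growth: "AE \<xi> in \<tau>. \<exists>C>0. \<forall>n. C * exp (c * real n) \<le> (\<Prod>i<n. mean_number (\<eta> (\<xi> i)))"
proof -
  have "AE \<xi> in \<tau>. \<exists>C. \<forall>n. c * real n - C \<le> (\<Sum>i<n. ln (mean_number (\<eta> ((shift ^^ i) \<xi> 0))))"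
    using ln_pos by (intro ergodic_sums_lower ln_integrable) (simp add: c_def)
  with offspring_laws show ?thesis
  proof eventually_elim
    case (elim \<xi>)
    then obtain C where C: "\<And>n. c * real n - C \<le> (\<Sum>i<n. ln (mean_number (\<eta> (\<xi> i))))"
      by (auto simp: shift_pow)
    have pos: "0 < mean_number (\<eta> (\<xi> i))" for i using elim(1) by (simp add: offspring_law.number_pos)
    have "exp (- C) * exp (c * real n) \<le> (\<Prod>i<n. mean_number (\<eta> (\<xi> i)))" for n
    proof -
      have "exp (- C) * exp (c * real n) \<le> exp (\<Sum>i<n. ln (mean_number (\<eta> (\<xi> i))))"
        using C[of n] by (simp flip: exp_add)
      also have "\<dots> = (\<Prod>i<n. mean_number (\<eta> (\<xi> i)))" by (simp add: exp_sum pos)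
      finally show ?thesis .
    qed
    then show ?case by (intro exI[of _ "exp (- C)"]) auto
  qed
qed

text \<open>The two slopes are chosen strictly below and strictly above the mean, as
  \<open>ergodic_sums_lower\<close> and \<open>ergodic_sums_upper\<close> require.\<close>

lemma AE_variance: "AE \<xi> in \<tau>. \<exists>C. \<forall>n.
    v\<^sub>0 / 2 * real n - C \<le> (\<Sum>i<n. variance_position (\<eta> (\<xi> i))) \<and>
    (\<Sum>i<n. variance_position (\<eta> (\<xi> i))) \<le> (v\<^sub>0 + 1) * real n + C"
proof -
  have "AE \<xi> in \<tau>. \<exists>C. \<forall>n. v\<^sub>0 / 2 * real n - C \<le> (\<Sum>i<n. variance_position (\<eta> ((shift ^^ i) \<xi> 0)))"
    using var_pos by (intro ergodic_sums_lower var_integrable) (simp add: v\<^sub>0_def)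
  moreover have "AE \<xi> in \<tau>. \<exists>C. \<forall>n. (\<Sum>i<n. variance_position (\<eta> ((shift ^^ i) \<xi> 0))) \<le> (v\<^sub>0 + 1) * real n + C"
    by (intro ergodic_sums_upper var_integrable) (simp add: v\<^sub>0_def)
  ultimately show ?thesis
  proof eventually_elim
    case (elim \<xi>)
    from elim(1) obtain C where C: "\<And>n. v\<^sub>0 / 2 * real n - C \<le> (\<Sum>i<n. variance_position (\<eta> (\<xi> i)))"
      by (auto simp: shift_pow)
    from elim(2) obtain C' where C': "\<And>n. (\<Sum>i<n. variance_position (\<eta> (\<xi> i))) \<le> (v\<^sub>0 + 1) * real n + C'"
      by (auto simp: shift_pow)
    show ?case
    proof (intro exI[of _ "max C C'"] allI conjI)
      fix n
      show "v\<^sub>0 / 2 * real n - max C C' \<le> (\<Sum>i<n. variance_position (\<eta> (\<xi> i)))"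
        using C[of n] by linarith
      show "(\<Sum>i<n. variance_position (\<eta> (\<xi> i))) \<le> (v\<^sub>0 + 1) * real n + max C C'"
        using C'[of n] by linarith
    qed
  qed
qed

text \<open>By dominated convergence the mean of the truncated variance tends to 0 as the level
  grows, so at a suitable level \<open>ergodic_sums_upper\<close> gives any prescribed slope. The
  slopes 1 / (j + 1) suffice, and countably many null sets combine into one valid for all
  \<epsilon>.\<close>

lemma AE_variance_tail: "AE \<xi> in \<tau>. \<forall>\<epsilon>>0. \<exists>M C. \<forall>n.
    (\<Sum>i<n. \<integral>y. y\<^sup>2 * indicator {y. \<bar>y\<bar> > M} y \<partial>step_law (\<eta> (\<xi> i))) \<le> \<epsilon> * real n + C"
proof -
  let ?I = "\<lambda>M \<nu>. \<integral>y. y\<^sup>2 * indicator {y. \<bar>y\<bar> > M} y \<partial>step_law \<nu>"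
  define f where "f M \<xi> = enn2real (tail_variance M (\<eta> (\<xi> 0)))" for M and \<xi> :: "nat \<Rightarrow> 'a"
  have f_meas [measurable]: "f M \<in> borel_measurable \<tau>" for M
    unfolding f_def[abs_def] using env_statistic_measurable[OF tail_variance_measurable, of M 0] by measurable
  have I: "f M ((shift ^^ n) \<xi>) = ?I M (\<eta> (\<xi> n))" "0 \<le> ?I M (\<eta> (\<xi> n))"
      "?I M (\<eta> (\<xi> n)) \<le> variance_position (\<eta> (\<xi> n))" "(\<lambda>K. ?I (real K) (\<eta> (\<xi> n))) \<longlonglongrightarrow> 0"
    if "offspring_law (\<eta> (\<xi> n))" for M n \<xi>
  proof -
    interpret L: offspring_law "\<eta> (\<xi> n)" by (rule that)
    have int: "integrable (step_law (\<eta> (\<xi> n))) (\<lambda>y. y\<^sup>2 * indicator {y. \<bar>y\<bar> > M} y)" for M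
      by (rule Bochner_Integration.integrable_bound[OF L.step_law_square(1)]) (auto simp: indicator_def)
    show pos: "0 \<le> ?I M (\<eta> (\<xi> n))" by (intro Bochner_Integration.integral_nonneg) auto
    show "f M ((shift ^^ n) \<xi>) = ?I M (\<eta> (\<xi> n))"
      using pos by (simp add: f_def shift_pow L.tail_variance_eq)
    show "?I M (\<eta> (\<xi> n)) \<le> variance_position (\<eta> (\<xi> n))"
      unfolding L.step_law_square(2)[symmetric]
      by (intro integral_mono int L.step_law_square(1)) (auto simp: indicator_def)
    have "(\<lambda>K. ?I (real K) (\<eta> (\<xi> n))) \<longlonglongrightarrow> (\<integral>y. 0 \<partial>step_law (\<eta> (\<xi> n)))"
    proof (rule integral_dominated_convergence[where w="\<lambda>y. y\<^sup>2"])
      show "AE y in step_law (\<eta> (\<xi> n)). (\<lambda>K. y\<^sup>2 * indicator {y. \<bar>y\<bar> > real K} y) \<longlonglongrightarrow> 0"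
      proof (rule AE_I2)
        fix y :: real
        obtain N :: nat where N: "\<bar>y\<bar> \<le> real N" using real_arch_simple by blast
        have "eventually (\<lambda>K. y\<^sup>2 * indicator {y. \<bar>y\<bar> > real K} y = 0) sequentially"
          unfolding eventually_sequentially using N by (intro exI[of _ N]) (auto simp: indicator_def)
        then show "(\<lambda>K. y\<^sup>2 * indicator {y. \<bar>y\<bar> > real K} y) \<longlonglongrightarrow> 0" by (rule tendsto_eventually)
      qed
    qed (auto simp: L.step_law_square indicator_def)
    then show "(\<lambda>K. ?I (real K) (\<eta> (\<xi> n))) \<longlonglongrightarrow> 0" by simp
  qed
  have f_le: "AE \<xi> in \<tau>. norm (f M \<xi>) \<le> variance_position (\<eta> (\<xi> 0))" for M
    using offspring_laws
  proof eventually_elim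
    case (elim \<xi>)
    then show ?case using I(1-3)[of \<xi> 0 M] by simp
  qed
  have f_int: "integrable \<tau> (f M)" for M
  proof (rule Bochner_Integration.integrable_bound[OF var_integrable f_meas])
    show "AE \<xi> in \<tau>. norm (f M \<xi>) \<le> norm (variance_position (\<eta> (\<xi> 0)))"
      using f_le[of M] by eventually_elim simp
  qed
  have "(\<lambda>K. \<integral>\<xi>. f (real K) \<xi> \<partial>\<tau>) \<longlonglongrightarrow> (\<integral>\<xi>. 0 \<partial>\<tau>)"
  proof (rule integral_dominated_convergence[OF _ _ var_integrable])
    show "AE \<xi> in \<tau>. (\<lambda>K. f (real K) \<xi>) \<longlonglongrightarrow> 0"
      using offspring_laws
    proof eventually_elim
      case (elim \<xi>)
      then show ?case using I(4)[of \<xi> 0] I(1)[of \<xi> 0] by simp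
    qed
  qed (use f_le in auto)
  then have lim: "(\<lambda>K. \<integral>\<xi>. f (real K) \<xi> \<partial>\<tau>) \<longlonglongrightarrow> 0" by simp
  have "AE \<xi> in \<tau>. \<exists>M C. \<forall>n. (\<Sum>i<n. f M ((shift ^^ i) \<xi>)) \<le> inverse (real (Suc j)) * real n + C" for j
  proof -
    have "eventually (\<lambda>K. (\<integral>\<xi>. f (real K) \<xi> \<partial>\<tau>) < inverse (real (Suc j))) sequentially"
      by (rule order_tendstoD[OF lim]) simp
    then obtain K where "(\<integral>\<xi>. f (real K) \<xi> \<partial>\<tau>) < inverse (real (Suc j))"
      by (auto simp: eventually_sequentially)
    from ergodic_sums_upper[OF f_int this] show ?thesis by eventually_elim blast
  qed
  then have "AE \<xi> in \<tau>. \<forall>j. \<exists>M C. \<forall>n. (\<Sum>i<n. f M ((shift ^^ i) \<xi>)) \<le> inverse (real (Suc j)) * real n + C"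
    by (simp add: AE_all_countable)
  with offspring_laws show ?thesis
  proof eventually_elim
    case (elim \<xi>)
    show ?case
    proof (intro allI impI)
      fix \<epsilon> :: real assume "0 < \<epsilon>"
      then obtain j where j: "inverse (real (Suc j)) < \<epsilon>" using reals_Archimedean by blast
      obtain M C where MC: "\<And>n. (\<Sum>i<n. f M ((shift ^^ i) \<xi>)) \<le> inverse (real (Suc j)) * real n + C"
        using elim(2) by blast
      have "(\<Sum>i<n. ?I M (\<eta> (\<xi> i))) \<le> \<epsilon> * real n + C" for n
      proof -
        have "(\<Sum>i<n. ?I M (\<eta> (\<xi> i))) = (\<Sum>i<n. f M ((shift ^^ i) \<xi>))"
          using elim(1) I(1) by simp
        also have "\<dots> \<le> inverse (real (Suc j)) * real n + C" by (rule MC)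
        also have "\<dots> \<le> \<epsilon> * real n + C" using j by (intro add_right_mono mult_right_mono) auto
        finally show ?thesis .
      qed
      then show "\<exists>M C. \<forall>n. (\<Sum>i<n. ?I M (\<eta> (\<xi> i))) \<le> \<epsilon> * real n + C" by blast
    qed
  qed
qed

text \<open>The number of \<open>j\<close> with \<open>N > exp (c j / 4)\<close> is at most \<open>1 + 4 / c * log\<^sup>+ N\<close>.\<close>

lemma suminf_tail_le:
  fixes N :: nat and m :: real
  assumes m: "0 < m"
  shows "(\<Sum>j. ennreal (if real N \<le> exp (c * real j / 4) then 0 else real N / m))
    \<le> ennreal (real N / m) + ennreal (4 / c) * ennreal (real N / m * log_plus (real N))"
proof -
  define J where "J = nat \<lceil>4 / c * log_plus (real N)\<rceil>"
  have lp: "0 \<le> log_plus (real N)" by (simp add: log_plus_def)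
  have J: "4 / c * log_plus (real N) \<le> real J" "real J \<le> 4 / c * log_plus (real N) + 1"
  proof -
    have "0 \<le> 4 / c * log_plus (real N)" using lp c_pos by simp
    then show "4 / c * log_plus (real N) \<le> real J" "real J \<le> 4 / c * log_plus (real N) + 1"
      unfolding J_def by linarith+
  qed
  have zero: "real N \<le> exp (c * real j / 4)" if "J \<le> j" for j
  \<comment> \<open>For N \<le> 1 the threshold is already reached at j = 0; otherwise
    \<open>log_plus\<close> is the logarithm.\<close>
  proof (cases "N \<le> 1")
    case True
    then have "real N \<le> 1" by simp
    also have "1 \<le> exp (c * real j / 4)" using c_pos by simp
    finally show ?thesis .
  next
    case False
    have "4 / c * ln (real N) \<le> real j" using J(1) that False by (simp add: log_plus_def)
    then have "ln (real N) \<le> c * real j / 4" using c_pos by (simp add: field_simps)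
    then have "exp (ln (real N)) \<le> exp (c * real j / 4)" by simp
    then show ?thesis using False by simp
  qed
  have "(\<Sum>j. ennreal (if real N \<le> exp (c * real j / 4) then 0 else real N / m))
      = (\<Sum>j<J. ennreal (if real N \<le> exp (c * real j / 4) then 0 else real N / m))"
    by (rule suminf_finite) (use zero in \<open>auto simp: not_less\<close>)
  also have "\<dots> \<le> (\<Sum>j<J. ennreal (real N / m))" using m by (intro sum_mono ennreal_leI) auto
  also have "\<dots> = ennreal (real J * (real N / m))"
    using m by (simp add: ennreal_of_nat_eq_real_of_nat flip: ennreal_mult)
  also have "\<dots> \<le> ennreal ((4 / c * log_plus (real N) + 1) * (real N / m))"
    using m J by (intro ennreal_leI mult_right_mono) auto
  also have "(4 / c * log_plus (real N) + 1) * (real N / m) = real N / m + 4 / c * (real N / m * log_plus (real N))"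
    by (simp add: algebra_simps)
  also have "ennreal \<dots> = ennreal (real N / m) + ennreal (4 / c) * ennreal (real N / m * log_plus (real N))"
    using m c_pos lp by (subst ennreal_plus, simp, simp, subst ennreal_mult) auto
  finally show ?thesis .
qed

text \<open>By stationarity the expectation of the j-th term can be evaluated in generation 0 with
  the j-th threshold. Exchanging sum and integral there makes \<open>suminf_tail_le\<close>
  applicable, and the logarithmic moment bounds the result.\<close>

lemma AE_tail_summable:
  "AE \<xi> in \<tau>. summable (\<lambda>j. \<integral>z. (if real (fst z) \<le> exp (c * real j / 4) then 0
      else real (fst z) / mean_number (\<eta> (\<xi> j))) \<partial>\<eta> (\<xi> j))"
proof -
  let ?t = "\<lambda>j. exp (c * real j / 4)"
  have meas: "(\<lambda>\<xi>. tail_number (?t j) (\<eta> (\<xi> n))) \<in> borel_measurable \<tau>" for j n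
    by (rule env_statistic_measurable[OF tail_number_measurable])
  have "(\<integral>\<^sup>+\<xi>. (\<Sum>j. tail_number (?t j) (\<eta> (\<xi> j))) \<partial>\<tau>) = (\<Sum>j. \<integral>\<^sup>+\<xi>. tail_number (?t j) (\<eta> (\<xi> j)) \<partial>\<tau>)"
    by (rule nn_integral_suminf[OF meas])
  also have "(\<lambda>j. \<integral>\<^sup>+\<xi>. tail_number (?t j) (\<eta> (\<xi> j)) \<partial>\<tau>) = (\<lambda>j. \<integral>\<^sup>+\<xi>. tail_number (?t j) (\<eta> (\<xi> 0)) \<partial>\<tau>)"
  proof
    fix j
    show "(\<integral>\<^sup>+\<xi>. tail_number (?t j) (\<eta> (\<xi> j)) \<partial>\<tau>) = (\<integral>\<^sup>+\<xi>. tail_number (?t j) (\<eta> (\<xi> 0)) \<partial>\<tau>)"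
      using nn_integral_T_pow[OF meas[of j 0], of j] by (simp add: shift_pow)
  qed
  also have "(\<Sum>j. \<integral>\<^sup>+\<xi>. tail_number (?t j) (\<eta> (\<xi> 0)) \<partial>\<tau>) = (\<integral>\<^sup>+\<xi>. (\<Sum>j. tail_number (?t j) (\<eta> (\<xi> 0))) \<partial>\<tau>)"
    by (rule nn_integral_suminf[OF meas, symmetric])
  also have "\<dots> \<le> (\<integral>\<^sup>+\<xi>. 1 + ennreal (4 / c) * (\<integral>\<^sup>+z. ennreal (real (fst z) / mean_number (\<eta> (\<xi> 0)) * log_plus (real (fst z))) \<partial>\<eta> (\<xi> 0)) \<partial>\<tau>)"
  proof (rule nn_integral_mono_AE)
    show "AE \<xi> in \<tau>. (\<Sum>j. tail_number (?t j) (\<eta> (\<xi> 0)))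
      \<le> 1 + ennreal (4 / c) * (\<integral>\<^sup>+z. ennreal (real (fst z) / mean_number (\<eta> (\<xi> 0)) * log_plus (real (fst z))) \<partial>\<eta> (\<xi> 0))"
      using offspring_laws
    proof eventually_elim
      case (elim \<xi>)
      interpret L: offspring_law "\<eta> (\<xi> 0)" using elim by simp
      let ?\<nu> = "\<eta> (\<xi> 0)" and ?m = "mean_number (\<eta> (\<xi> 0))"
      have [measurable]: "(\<lambda>z. real (fst z)) \<in> borel_measurable ?\<nu>"
        by (simp add: L.sets_offspring cong: measurable_cong_sets)
      have [measurable]: "log_plus \<in> borel_measurable borel" unfolding log_plus_def[abs_def] by measurable
      have "(\<Sum>j. tail_number (?t j) ?\<nu>)
          = (\<integral>\<^sup>+z. (\<Sum>j. ennreal (if real (fst z) \<le> ?t j then 0 else real (fst z) / ?m)) \<partial>?\<nu>)"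
        unfolding tail_number_def by (rule nn_integral_suminf[symmetric]) measurable
      also have "\<dots> \<le> (\<integral>\<^sup>+z. ennreal (real (fst z) / ?m) + ennreal (4 / c) * ennreal (real (fst z) / ?m * log_plus (real (fst z))) \<partial>?\<nu>)"
        by (intro nn_integral_mono suminf_tail_le L.number_pos)
      also have "\<dots> = (\<integral>\<^sup>+z. ennreal (real (fst z) / ?m) \<partial>?\<nu>) + ennreal (4 / c) * (\<integral>\<^sup>+z. ennreal (real (fst z) / ?m * log_plus (real (fst z))) \<partial>?\<nu>)"
        by (subst nn_integral_add) (auto simp: nn_integral_cmult)
      also have "(\<integral>\<^sup>+z. ennreal (real (fst z) / ?m) \<partial>?\<nu>) = ennreal (\<integral>z. real (fst z) / ?m \<partial>?\<nu>)"
        using L.number_integrable L.number_pos by (intro nn_integral_eq_integral) auto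
      also have "(\<integral>z. real (fst z) / ?m \<partial>?\<nu>) = 1"
        using L.number_pos by (simp add: mean_number_def)
      finally show ?case by simp
    qed
  qed
  also have "\<dots> = 1 + ennreal (4 / c) * (\<integral>\<^sup>+\<xi>. \<integral>\<^sup>+z. ennreal (real (fst z) / mean_number (\<eta> (\<xi> 0)) * log_plus (real (fst z))) \<partial>\<eta> (\<xi> 0) \<partial>\<tau>)"
  proof -
    have [measurable]: "(\<lambda>\<xi>. \<integral>\<^sup>+z. ennreal (real (fst z) / mean_number (\<eta> (\<xi> 0)) * log_plus (real (fst z))) \<partial>\<eta> (\<xi> 0)) \<in> borel_measurable \<tau>"
    proof (rule nn_integral_measurable_subprob_algebra2[OF _ measurable_prob_algebraD[OF env_law]])
      note [measurable] = snd_real_fst[of \<tau>] measurable_compose[OF measurable_fst env_statistic_measurable[OF mean_number_measurable, of 0]]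
      have [measurable]: "log_plus \<in> borel_measurable borel" unfolding log_plus_def[abs_def] by measurable
      show "(\<lambda>(\<xi>, z). ennreal (real (fst z) / mean_number (\<eta> (\<xi> 0)) * log_plus (real (fst z)))) \<in> borel_measurable (\<tau> \<Otimes>\<^sub>M offspring_algebra)"
        unfolding split_beta' by measurable
    qed
    note m = this
    show ?thesis
      by (simp only: nn_integral_add[OF borel_measurable_const borel_measurable_times_ennreal[OF borel_measurable_const m]]
          nn_integral_cmult[OF m] nn_integral_const emeasure_space_1 mult_1)
  qed
  also have "\<dots> < \<infinity>" using NlogN by (simp add: ennreal_mult_less_top)
  finally have "AE \<xi> in \<tau>. (\<Sum>j. tail_number (?t j) (\<eta> (\<xi> j))) \<noteq> \<infinity>"
    using meas by (intro nn_integral_PInf_AE borel_measurable_suminf) auto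
  with offspring_laws show ?thesis
  proof eventually_elim
    case (elim \<xi>)
    interpret B: branching_env "\<lambda>j. \<eta> (\<xi> j)" using elim(1) by (simp add: branching_env_def)
    have "tail_number (?t j) (\<eta> (\<xi> j)) = ennreal (B.tail j (?t j))" for j
      unfolding tail_number_def B.tail_def B.m_def
      using B.m_pos[of j] B.tail_integrable[of j "?t j"] unfolding B.m_def
      by (intro nn_integral_eq_integral) auto
    with elim(2) have "summable (\<lambda>j. B.tail j (?t j))"
      by (intro summable_suminf_not_top B.tail_nonneg) simp
    then show ?case unfolding B.tail_def B.m_def .
  qed
qed

lemma AE_good_env: "AE \<xi> in \<tau>. \<exists>C\<^sub>1 C\<^sub>2. good_env (\<lambda>j. \<eta> (\<xi> j)) c C\<^sub>1 (v\<^sub>0 / 2) (v\<^sub>0 + 1) C\<^sub>2"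
  using offspring_laws AE_growth AE_variance AE_variance_tail AE_tail_summable
proof eventually_elim
  case (elim \<xi>)
  interpret B: branching_env "\<lambda>j. \<eta> (\<xi> j)" using elim(1) by (simp add: branching_env_def)
  obtain C\<^sub>1 where C\<^sub>1: "0 < C\<^sub>1" "\<And>n. C\<^sub>1 * exp (c * real n) \<le> (\<Prod>i<n. mean_number (\<eta> (\<xi> i)))"
    using elim(2) by blast
  obtain C\<^sub>2 where C\<^sub>2: "\<And>n. v\<^sub>0 / 2 * real n - C\<^sub>2 \<le> (\<Sum>i<n. variance_position (\<eta> (\<xi> i)))"
      "\<And>n. (\<Sum>i<n. variance_position (\<eta> (\<xi> i))) \<le> (v\<^sub>0 + 1) * real n + C\<^sub>2"
    using elim(3) by blast
  have "good_env (\<lambda>j. \<eta> (\<xi> j)) c C\<^sub>1 (v\<^sub>0 / 2) (v\<^sub>0 + 1) C\<^sub>2"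
  proof (intro good_env.intro B.branching_env_axioms good_env_axioms.intro)
    show "0 < v\<^sub>0 / 2" using var_pos by (simp add: v\<^sub>0_def)
    show "C\<^sub>1 * exp (c * real n) \<le> B.growth n" for n using C\<^sub>1(2) by (simp add: B.growth_def B.m_def)
    show "summable (\<lambda>j. B.tail j (exp (c * real j / 4)))" using elim(5) unfolding B.tail_def B.m_def .
    show "\<exists>M C. \<forall>n. (\<Sum>i<n. \<integral>y. y\<^sup>2 * indicator {y. \<bar>y\<bar> > M} y \<partial>step_law (\<eta> (\<xi> i))) \<le> \<epsilon> * real n + C"
      if "0 < \<epsilon>" for \<epsilon> using elim(4) that by blast
  qed (fact c_pos C\<^sub>1(1) C\<^sub>2)+
  then show ?case by blast
qed

lemma AE_q_less_1: "AE \<xi> in \<tau>. q \<xi> < 1"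
  using AE_good_env
proof eventually_elim
  case (elim \<xi>)
  then obtain C\<^sub>1 C\<^sub>2 where "good_env (\<lambda>j. \<eta> (\<xi> j)) c C\<^sub>1 (v\<^sub>0 / 2) (v\<^sub>0 + 1) C\<^sub>2" by blast
  then interpret G: good_env "\<lambda>j. \<eta> (\<xi> j)" c C\<^sub>1 "v\<^sub>0 / 2" "v\<^sub>0 + 1" C\<^sub>2 .
  have "\<not> (AE X in G.Q. X \<in> null_trees (\<lambda>j. \<eta> (\<xi> j)))"
    using G.W_not_AE_null by (simp add: null_trees_def G.W_norm_population)
  then have "G.P.prob (null_trees (\<lambda>j. \<eta> (\<xi> j))) \<noteq> 1"
    using G.P.prob_eq_1[OF G.null_trees_sets] by simp
  then have "G.P.prob (null_trees (\<lambda>j. \<eta> (\<xi> j))) < 1"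
    using G.P.prob_le_1 by (simp add: less_le)
  then show ?case unfolding q_def quenched_def by (simp add: G.P.emeasure_eq_measure ennreal_less_one_iff)
qed

text \<open>As q < 1 almost surely, some set where q stays below 1 by a fixed margin has positive
  measure, and the shifted environment visits it infinitely often. One r < 1 must serve all these
  visits, because its powers have to vanish.\<close>

lemma AE_q_recurrent: "AE \<xi> in \<tau>. \<exists>r. 0 \<le> r \<and> r < 1 \<and> (\<forall>l. \<exists>k\<ge>l. q ((shift ^^ k) \<xi>) \<le> ennreal r)"
proof -
  define S where "S i = {\<xi> \<in> space \<tau>. q \<xi> \<le> ennreal (1 - inverse (real (Suc i)))}" for i
  have S [measurable]: "S i \<in> sets \<tau>" for i unfolding S_def by measurable
  have "AE \<xi> in \<tau>. \<xi> \<in> (\<Union>i. S i)"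
    using AE_q_less_1 AE_space
  proof eventually_elim
    case (elim \<xi>)
    define r where "r = enn2real (q \<xi>)"
    have r: "q \<xi> = ennreal r" "0 \<le> r" using elim(1) by (auto simp: r_def less_top[symmetric] top.extremum_strict dest: order.strict_trans[OF _ ennreal_one_less_top])
    then have "r < 1" using elim(1) by (simp add: ennreal_less_one_iff)
    then obtain i where "inverse (real (Suc i)) < 1 - r" using reals_Archimedean[of "1 - r"] by auto
    then have "\<xi> \<in> S i" using elim(2) r by (auto simp: S_def intro!: ennreal_leI)
    then show ?case by blast
  qed
  moreover have "\<not> (\<forall>i. measure \<tau> (S i) = 0)" if *: "AE \<xi> in \<tau>. \<xi> \<in> (\<Union>i. S i)"
  proof
    assume "\<forall>i. measure \<tau> (S i) = 0"
    then have "AE \<xi> in \<tau>. \<xi> \<notin> S i" for i using prob_eq_0[OF S] by simp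
    then have "AE \<xi> in \<tau>. \<forall>i. \<xi> \<notin> S i" by (simp add: AE_all_countable)
    with * have "AE \<xi> in \<tau>. False" by eventually_elim blast
    then show False by simp
  qed
  ultimately obtain i where "measure \<tau> (S i) \<noteq> 0" by blast
  then have "0 < measure \<tau> (S i)" by (simp add: less_le)
  from AE_infinitely_often[OF S this] show ?thesis
  proof eventually_elim
    case (elim \<xi>)
    have "inverse (real (Suc i)) \<le> 1" by (simp add: inverse_le_1_iff)
    then show ?case using elim
      by (intro exI[of _ "1 - inverse (real (Suc i))"]) (auto simp: S_def)
  qed
qed

text \<open>The growth cancels in the quotient: the numerator tends to the normal value times w and
  the denominator to w, which is nonzero on explosion.\<close>

lemma AE_quenched_clt:
  "AE \<xi> in \<tau>. AE X in quenched \<eta> \<xi>.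
     filterlim (\<lambda>n. measure (counting_measure X n) UNIV) at_top sequentially \<longrightarrow>
     (\<lambda>n. measure (counting_measure X n) {..scaling \<eta> \<xi> n * x + centering \<eta> \<xi> n}
          / measure (counting_measure X n) UNIV)
       \<longlonglongrightarrow> cdf std_normal_distribution x"
  using AE_good_env AE_q_recurrent
proof eventually_elim
  case (elim \<xi>)
  let ?Z = "\<lambda>X n. measure (counting_measure X n)" and ?B = "\<lambda>n. {..scaling \<eta> \<xi> n * x + centering \<eta> \<xi> n}"
  from elim(1) obtain C\<^sub>1 C\<^sub>2 where "good_env (\<lambda>j. \<eta> (\<xi> j)) c C\<^sub>1 (v\<^sub>0 / 2) (v\<^sub>0 + 1) C\<^sub>2" by blast
  then interpret G: good_env "\<lambda>j. \<eta> (\<xi> j)" c C\<^sub>1 "v\<^sub>0 / 2" "v\<^sub>0 + 1" C\<^sub>2 .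
  from elim(2) obtain r where r: "0 \<le> r" "r < 1" "\<And>l. \<exists>k\<ge>l. q ((shift ^^ k) \<xi>) \<le> ennreal r" by blast
  have "AE X in G.Q. filterlim (\<lambda>n. real (card (particles X n))) at_top sequentially \<longrightarrow> X \<notin> null_trees (\<lambda>j. \<eta> (\<xi> j))"
    using r(3) by (intro G.AE_not_null_on_explosion[OF r(1,2)]) (simp add: q_def quenched_def shift_pow)
  with G.AE_W_converges G.AE_cdf_tendsto[of x]
  have "AE X in G.Q. filterlim (\<lambda>n. ?Z X n UNIV) at_top sequentially \<longrightarrow>
     (\<lambda>n. ?Z X n (?B n) / ?Z X n UNIV) \<longlonglongrightarrow> cdf std_normal_distribution x"
  proof eventually_elim
    case (elim X)
    have total: "?Z X n UNIV = real (card (particles X n))" for n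
      by (simp add: measure_counting_measure)
    have below: "?Z X n (?B n)
        = G.growth n * G.A n (indicator {..G.b n * x}) X" for n
    proof -
      \<comment> \<open>All particles of generation n carry the same centering, so it can be moved
        into the threshold.\<close>
      have "G.growth n * G.A n (indicator {..G.b n * x}) X
          = (\<Sum>u\<in>particles X n. indicator {..G.b n * x} (G.cpos X u))"
        using G.growth_pos[of n] by (simp add: G.A_def)
      also have "\<dots> = (\<Sum>u\<in>particles X n. if position X u \<in> (?B n) then 1 else 0)"
        by (intro sum.cong) (auto simp: G.cpos_def length_particles indicator_def G.b_def scaling_def centering_def algebra_simps)
      also have "\<dots> = ?Z X n (?B n)"
        by (simp add: measure_counting_measure sum.If_cases finite_particles Int_def)
      finally show ?thesis ..
    qed
    show ?case
    proof
      assume "filterlim (\<lambda>n. ?Z X n UNIV) at_top sequentially"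
      then have nonnull: "X \<notin> null_trees (\<lambda>j. \<eta> (\<xi> j))" using elim(3) by (simp add: total)
      obtain w where w: "(\<lambda>n. G.W n X) \<longlonglongrightarrow> w" using elim(1) by (auto simp: convergent_def)
      have "w \<noteq> 0" using w nonnull by (auto simp: null_trees_def G.W_norm_population)
      have "(\<lambda>n. G.A n (indicator {..G.b n * x}) X / G.W n X) \<longlonglongrightarrow> cdf std_normal_distribution x * w / w"
        using elim(2) w \<open>w \<noteq> 0\<close> by (intro tendsto_divide) auto
      moreover have "G.A n (indicator {..G.b n * x}) X / G.W n X =
          ?Z X n (?B n) / ?Z X n UNIV" for n
        unfolding below total G.W_eq using G.growth_pos[of n] by simp
      ultimately show "(\<lambda>n. ?Z X n (?B n) / ?Z X n UNIV) \<longlonglongrightarrow> cdf std_normal_distribution x"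
        using \<open>w \<noteq> 0\<close> by simp
    qed
  qed
  then show ?case unfolding quenched_def .
qed

end

section \<open>Measurability of the limit event and passage to the annealed law\<close>

lemma pred_filterlim_at_top:
  fixes f :: "nat \<Rightarrow> 'a \<Rightarrow> real"
  assumes [measurable]: "\<And>n. f n \<in> borel_measurable M"
  shows "Measurable.pred M (\<lambda>x. filterlim (\<lambda>n. f n x) at_top sequentially)"
proof -
  have "filterlim (\<lambda>n. f n x) at_top sequentially \<longleftrightarrow> (\<forall>Z::nat. \<exists>N. \<forall>n\<ge>N. real Z \<le> f n x)" for x
  proof
    assume "filterlim (\<lambda>n. f n x) at_top sequentially"
    then show "\<forall>Z::nat. \<exists>N. \<forall>n\<ge>N. real Z \<le> f n x"
      unfolding filterlim_at_top eventually_sequentially by blast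
  next
    assume *: "\<forall>Z::nat. \<exists>N. \<forall>n\<ge>N. real Z \<le> f n x"
    show "filterlim (\<lambda>n. f n x) at_top sequentially"
      unfolding filterlim_at_top eventually_sequentially
    proof
      fix z :: real
      obtain Z :: nat where "z \<le> real Z" using real_arch_simple by blast
      with * show "\<exists>N. \<forall>n\<ge>N. z \<le> f n x" by (meson order.trans)
    qed
  qed
  then show ?thesis by (simp only:) measurable
qed

context random_env
begin

text \<open>Together with \<open>below_measurable\<close> this makes the final statement a
  measurable predicate, so that \<open>AE_annealed_iff\<close> carries the quenched result back to
  the annealed law.\<close>

lemma total_measurable:
  "(\<lambda>p. measure (counting_measure (snd p) n) UNIV) \<in> borel_measurable (\<tau> \<Otimes>\<^sub>M trees)"
proof -
  note [measurable] = card_particles_joint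
  have "(\<lambda>p. real (card (particles (snd p) n))) \<in> borel_measurable (\<tau> \<Otimes>\<^sub>M trees)" by measurable
  then show ?thesis by (simp add: measure_counting_measure)
qed

lemma below_measurable:
  "(\<lambda>p. measure (counting_measure (snd p) n) {..scaling \<eta> (fst p) n * x + centering \<eta> (fst p) n})
    \<in> borel_measurable (\<tau> \<Otimes>\<^sub>M trees)"
proof -
  note [measurable] = measurable_position[of snd, OF tree_coordinate]
    measurable_compose[OF measurable_fst env_statistic_measurable[OF mean_position_measurable]]
    measurable_compose[OF measurable_fst env_statistic_measurable[OF variance_position_measurable]]
  have "(\<lambda>p. \<Sum>u\<in>particles (snd p) n. if position (snd p) u \<le> scaling \<eta> (fst p) n * x + centering \<eta> (fst p) n then 1 else 0 :: real)
      \<in> borel_measurable (\<tau> \<Otimes>\<^sub>M trees)"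
    by (intro measurable_sum_particles[of snd, OF tree_coordinate]) (unfold scaling_def centering_def, measurable)
  then show ?thesis
    by (simp add: measure_counting_measure sum.If_cases finite_particles Int_def)
qed

end

theorem theorem10p2:
  fixes \<Theta> :: "'e measure" and \<tau> :: "(nat \<Rightarrow> 'e) measure"
    and \<eta> :: "'e \<Rightarrow> offspring measure" and \<epsilon> x :: real
  assumes "stationary_ergodic_law \<Theta> \<tau>"
    and "\<eta> \<in> \<Theta> \<rightarrow>\<^sub>M prob_algebra offspring_algebra"
    \<comment> \<open>\<open>E log m\<^sub>0\<close> lies in \<open>(0,\<infinity>)\<close>; in particular \<open>0 < m\<^sub>0 < \<infinity>\<close> a.s.\<close>
    and "AE (\<xi>, X) in annealed \<eta> \<tau>. integrable (\<eta> (\<xi> 0)) (\<lambda>z. real (fst z)) \<and> mean_number (\<eta> (\<xi> 0)) > 0"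
    and "integrable (annealed \<eta> \<tau>) (\<lambda>(\<xi>, X). ln (mean_number (\<eta> (\<xi> 0))))"
    and "(\<integral>(\<xi>, X). ln (mean_number (\<eta> (\<xi> 0))) \<partial>annealed \<eta> \<tau>) > 0"
    \<comment> \<open>\<open>E (N / m\<^sub>0) log\<^sup>+ N < \<infinity>\<close>\<close>
    and "integrable (annealed \<eta> \<tau>)
           (\<lambda>(\<xi>, X). real (fst (X [])) / mean_number (\<eta> (\<xi> 0)) * log_plus (real (fst (X []))))"
    \<comment> \<open>\<open>\<mu>\<^sub>0\<close> is well defined and \<open>E \<bar>\<mu>\<^sub>0\<bar>\<^sup>\<epsilon> < \<infinity>\<close>\<close>
    and "AE (\<xi>, X) in annealed \<eta> \<tau>. integrable (\<eta> (\<xi> 0)) (offspring_sum (\<lambda>y. y))"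
    and "\<epsilon> > 0"
    and "integrable (annealed \<eta> \<tau>) (\<lambda>(\<xi>, X). \<bar>mean_position (\<eta> (\<xi> 0))\<bar> powr \<epsilon>)"
    \<comment> \<open>\<open>E \<sigma>\<^sub>0\<^sup>2\<close> lies in \<open>(0,\<infinity>)\<close>; in particular \<open>\<sigma>\<^sub>0\<^sup>2 < \<infinity>\<close> a.s.\<close>
    and "AE (\<xi>, X) in annealed \<eta> \<tau>.
           integrable (\<eta> (\<xi> 0)) (offspring_sum (\<lambda>y. (y - mean_position (\<eta> (\<xi> 0)))\<^sup>2))"
    and "integrable (annealed \<eta> \<tau>) (\<lambda>(\<xi>, X). variance_position (\<eta> (\<xi> 0)))"
    and "(\<integral>(\<xi>, X). variance_position (\<eta> (\<xi> 0)) \<partial>annealed \<eta> \<tau>) > 0"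
  shows "AE (\<xi>, X) in annealed \<eta> \<tau>.
           filterlim (\<lambda>n. measure (counting_measure X n) UNIV) at_top sequentially \<longrightarrow>
           (\<lambda>n. measure (counting_measure X n) {..scaling \<eta> \<xi> n * x + centering \<eta> \<xi> n}
                / measure (counting_measure X n) UNIV)
             \<longlonglongrightarrow> cdf std_normal_distribution x"
proof -
  interpret random_env \<Theta> \<tau> \<eta> using assms(1,2) by (rule random_env.intro)
  \<comment> \<open>The integrability hypotheses speak of generation 0; stationarity then carries
    them to all generations outside one null set.\<close>
  have "AE \<xi> in \<tau>. offspring_law (\<eta> (\<xi> 0))"
    using AE_annealed_envD[OF assms(3)] AE_annealed_envD[OF assms(7)] AE_annealed_envD[OF assms(10)] AE_space
    by eventually_elim (auto simp: offspring_law_def env_prob env_sets)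
  from AE_T_pow[OF this] have laws: "AE \<xi> in \<tau>. \<forall>n. offspring_law (\<eta> (\<xi> n))"
    by (simp add: shift_pow)
  \<comment> \<open>The moment hypothesis concerns the root's offspring \<open>X []\<close>, whose
    quenched law is \<open>\<eta> (\<xi> 0)\<close>, so it becomes an iterated integral over the
    environment and one offspring vector.\<close>
  have NlogN: "(\<integral>\<^sup>+\<xi>. \<integral>\<^sup>+z. ennreal (real (fst z) / mean_number (\<eta> (\<xi> 0)) * log_plus (real (fst z))) \<partial>\<eta> (\<xi> 0) \<partial>\<tau>) < \<infinity>"
  proof -
    have lp [measurable]: "log_plus \<in> borel_measurable borel" unfolding log_plus_def[abs_def] by measurable
    have [measurable]: "(\<lambda>p. real (fst (snd p []))) \<in> borel_measurable (\<tau> \<Otimes>\<^sub>M trees)"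
      by (rule measurable_compose[OF tree_coordinate measurable_real_fst])
    note [measurable] = measurable_compose[OF measurable_fst env_statistic_measurable[OF mean_number_measurable, of 0]]
    let ?f = "\<lambda>\<xi> z. real (fst z) / mean_number (\<eta> (\<xi> 0)) * log_plus (real (fst z))"
    have "(\<integral>\<^sup>+\<xi>. \<integral>\<^sup>+z. ennreal (?f \<xi> z) \<partial>\<eta> (\<xi> 0) \<partial>\<tau>) = (\<integral>\<^sup>+\<xi>. \<integral>\<^sup>+X. ennreal (?f \<xi> (X [])) \<partial>quenched \<eta> \<xi> \<partial>\<tau>)"
      using laws
    proof (intro nn_integral_cong_AE, eventually_elim)
      case (elim \<xi>)
      interpret B: branching_env "\<lambda>j. \<eta> (\<xi> j)" using elim by (simp add: branching_env_def)
      have "(\<lambda>z. ennreal (?f \<xi> z)) \<in> borel_measurable (\<eta> (\<xi> (length ([] :: nat list))))" by measurable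
      from B.nn_integral_coordinate[OF this] show ?case by (simp add: quenched_def)
    qed
    also have "\<dots> = (\<integral>\<^sup>+p. ennreal (?f (fst p) (snd p [])) \<partial>annealed \<eta> \<tau>)"
      by (subst nn_integral_annealed) auto
    also have "\<dots> \<le> (\<integral>\<^sup>+p. ennreal (norm (?f (fst p) (snd p []))) \<partial>annealed \<eta> \<tau>)"
      by (intro nn_integral_mono ennreal_leI) (simp only: real_norm_def abs_ge_self)
    also have "\<dots> < \<infinity>" using assms(6) by (simp add: integrable_iff_bounded split_beta')
    finally show ?thesis .
  qed
  note stat = env_statistic_measurable[of _ 0]
  note ln_meas = stat[OF borel_measurable_ln[OF mean_number_measurable]]
  note var_meas = stat[OF variance_position_measurable]
  interpret random_env_moments \<Theta> \<tau> \<eta>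
    using laws NlogN assms(4,5,11,12) annealed_env_integral[OF ln_meas] annealed_env_integral[OF var_meas]
    by unfold_locales auto
  let ?P = "\<lambda>p. filterlim (\<lambda>n. measure (counting_measure (snd p) n) UNIV) at_top sequentially \<longrightarrow>
           (\<lambda>n. measure (counting_measure (snd p) n) {..scaling \<eta> (fst p) n * x + centering \<eta> (fst p) n}
                / measure (counting_measure (snd p) n) UNIV)
             \<longlonglongrightarrow> cdf std_normal_distribution x"
  have "Measurable.pred (\<tau> \<Otimes>\<^sub>M trees) ?P"
    by (intro pred_intros_logic pred_filterlim_at_top pred_tendsto borel_measurable_divide total_measurable below_measurable)
  from AE_annealed_iff[OF this] AE_quenched_clt have "AE p in annealed \<eta> \<tau>. ?P p" by simp
  then show ?thesis by (simp add: split_beta')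
qed

end
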